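(* Let $m\ge1$ and let $G_m$ be the braid Gauss diagram of a word in $\sigma_1^{\pm1},\dots,\sigma_{m-1}^{\pm1}$, representing the link $L$. Then for every integer $k\ge0$, $$P^\star_{k+1}(G_m)=\mathcal{P}_k(L),\qquad\text{where }\mathcal{P}_k(L):=z^k\frac{\partial^kP(L)}{\partial a^k}\Big|_{a=1}.$$
   Context: HOMFLY-PT polynomial: $P(L)\in\mathbb{Z}[a^{\pm1},z^{\pm1}]$ is the invariant of oriented links determined by $aP(L_+)-a^{-1}P(L_-)=zP(L_0)$ for any skein triple and $P(O_r)=\left(\frac{a-a^{-1}}{z}\right)^{r-1}$ for the $r$-component unlink $O_r$. Braid Gauss diagrams. $B_m$ is the Artin braid group with generators $\sigma_1,\dots,\sigma_{m-1}$. For a word $\beta$ in $\sigma_i^{\pm1}$, the closed braid diagram $D$ of $\beta$ is obtained by joining the top and bottom endpoints of the $m$ strands by $m$ parallel closing strands; it represents an oriented link. The Gauss diagram $G$ of $D$ has one oriented circle parametrizing each component of $D$, and for each crossing an arrow joining its two preimages, pointing from the overpassing preimage to the underpassing one, carrying the sign (local writhe) of the crossing. An arc of $G$ is a connected component of the complement in the circles of all arrow endpoints. The braid Gauss diagram $G_m$ is $G$ together with labels $a_1,\dots,a_m$, where $a_i$ is the arc of $G$ containing the preimage of the $i$-th closing strand. The writhe $w(G_m)$ is the sum of the signs of all arrows. $\star$-colored braid Gauss diagrams. For $k\ge1$, a $\star$-colored braid Gauss diagram associated with $k$ and $G_m$ is $G_m$ together with: base points $*_1,\dots,*_k$ placed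 on arcs $a_{j_1},\dots,a_{j_k}$ with $m=j_1>j_2>\dots>j_k\ge1$ (one base point per arc); and, for each remaining labeled arc $a_j$ ($j\notin\{j_1,\dots,j_k\}$), a number from $\{1,\dots,l\}$, where $l$ is the largest index such that $j<j_l$. $\mathfrak{G}^\star_{k,m}$ denotes the set of all such diagrams. Arrow diagrams. An arrow diagram is a finite collection of oriented circles with finitely many arrows joining pairs of distinct points of the circles, up to orientation-preserving diffeomorphisms of the circles; its arcs are the components of the complement of arrow endpoints. Its surface $\Sigma(A)$ is obtained by gluing an oriented disk to each circle and attaching, for each arrow, an untwisted band (1-handle) with that arrow as core, so that $\Sigma(A)$ is oriented. Each arc of $A$ lies on exactly one boundary component of $\Sigma(A)$. $A$ is multibased with $k$ boundary components if $\Sigma(A)$ has exactly $k$ boundary components and base points $*_1,\dots,*_k$ are placed on arcs lying on $k$ pairwise different boundary components; the one containing $*_i$ is the $i$-th boundary component. Traverse the boundary components in the order $i=1,\dots,k$, each starting from $*_i$ in the boundary orientation (which agrees with the circle orientation along arcs). Each band has two sides parallel to its core arrow; $A$ is ascending if for every arrow the first time the traversal runs along a side of its band it runs from the head end to the tail end. $\mathcal{A}_{n,k}$ is the set of ascending multibased arrow diagrams with $n$ arrows and $k$ boundary components ($\mathcal{A}_{n,k}=\emptyset$ for $n<0$). Pairing. Let $A$ be multibased with $k$ boundary components and $G\in\mathfrak{G}^\star_{k,m}$. A homomorphism $\phi:A\to G$ is a bijection between the circles of $A$ and those of $G$ together with orientation-preserving homeomorphisms of corresponding circles, mapping each base point $*_i$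 of $A$ to the base point $*_i$ of $G$, mapping arrows of $A$ injectively onto arrows of $G$ (tail to tail, head to head), and such that every non-based labeled arc of $G$ colored by a number $j$ is contained in the image of an arc of $A$ lying on the $j$-th boundary component. Homomorphisms are determined by their image set of arrows. The sign $\varepsilon(\phi)$ is the product of signs of the arrows in the image. $\langle A,G\rangle:=\sum_\phi\varepsilon(\phi)$, and $\langle A,G\rangle=0$ if $A$ and $G$ have different numbers of circles. Invariants. For $j,k\ge1$: $f_j^{(k)}(G_m):=\frac{d^{k-1}}{da^{k-1}}\left(a^{-m-w(G_m)+1}(a^2-1)^{j-1}\right)\big|_{a=1}$. For $1\le j\le k$: $A_{n,k,j}(G_m):=\sum_{G\in\mathfrak{G}^\star_{j,m}}\sum_{A\in\mathcal{A}_{n+j-k,j}}\langle A,G\rangle$, $A_{n,k}(G_m):=\sum_{j=1}^kf_j^{(k)}(G_m)A_{n,k,j}(G_m)$, and $P^\star_k(G_m):=\sum_{n\ge0}A_{n,k}(G_m)z^n$. *)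

theory Defs
  imports "HOL-Analysis.Analysis"
begin

text \<open>A letter (i, True) is sigma_i, (i, False) is sigma_i inverse.
  Geometric convention: strands are oriented upward, positions 1..m numbered
  from left to right, the word is read from bottom to top; at sigma_i the strand
  coming from position i (going up-right) passes OVER the one coming from
  position i+1, which is a positive crossing; sigma_i inverse is the mirror crossing
  (negative, the strand from position i+1 is over).  The closing strand number q
  joins the top endpoint q to the bottom endpoint q (running downward).\<close>

type_synonym letter = "nat \<times> bool"
type_synonym endpt = "nat \<times> bool"   \<comment> \<open>(arrow id, True = head)\<close>
type_synonym adiag = "endpt list list" \<comment> \<open>circles, each a cyclic list of arrow endpoints\<close>
type_synonym arc = "nat \<times> nat"         \<comment> \<open>(circle, index p): arc from endpoint p to endpoint p+1\<close>

definition braid_word :: "nat \<Rightarrow> letter list \<Rightarrow> bool" where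
  "braid_word m w \<longleftrightarrow> (\<forall>l\<in>set w. 1 \<le> fst l \<and> fst l < m)"

definition swp :: "nat \<Rightarrow> nat \<Rightarrow> nat" where
  "swp i q = (if q = i then Suc i else if q = Suc i then i else q)"

text \<open>Arrow endpoints met by the strand entering at bottom position q, crossings
  numbered from t on.  Arrow id = index of the crossing in the word.\<close>
fun bpass :: "nat \<Rightarrow> letter list \<Rightarrow> nat \<Rightarrow> endpt list" where
  "bpass t [] q = []"
| "bpass t ((i,b)#w) q =
     (if q = i \<or> q = Suc i then [(t, \<not> ((b \<and> q = i) \<or> (\<not> b \<and> q = Suc i)))] else [])
     @ bpass (Suc t) w (swp i q)"

definition bperm :: "letter list \<Rightarrow> nat \<Rightarrow> nat" where
  "bperm w q = foldl (\<lambda>q l. swp (fst l) q) q w"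

definition cyc_len :: "letter list \<Rightarrow> nat \<Rightarrow> nat" where
  "cyc_len w r = (LEAST n. 0 < n \<and> (bperm w ^^ n) r = r)"

definition cyc :: "letter list \<Rightarrow> nat \<Rightarrow> nat list" where
  "cyc w r = map (\<lambda>j. (bperm w ^^ j) r) [0..<cyc_len w r]"

definition reps :: "nat \<Rightarrow> letter list \<Rightarrow> nat list" where
  "reps m w = sorted_list_of_set {r \<in> {1..m}. \<forall>j. r \<le> (bperm w ^^ j) r}"

definition gd_circles :: "nat \<Rightarrow> letter list \<Rightarrow> adiag" where
  "gd_circles m w = map (\<lambda>r. concat (map (bpass 0 w) (cyc w r))) (reps m w)"

text \<open>The arc a_r containing the preimage of the r-th closing strand.\<close>
definition gd_label :: "nat \<Rightarrow> letter list \<Rightarrow> nat \<Rightarrow> arc" where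
  "gd_label m w r =
     (let c = (SOME c. c < length (reps m w) \<and> r \<in> set (cyc w (reps m w ! c)));
          cl = cyc w (reps m w ! c);
          j = (SOME j. j < length cl \<and> cl ! j = r);
          N = length (concat (map (bpass 0 w) (take j cl)));
          L = length (gd_circles m w ! c)
      in (c, if L = 0 then 0 else (N + L - 1) mod L))"

definition gd_sign :: "letter list \<Rightarrow> nat \<Rightarrow> int" where
  "gd_sign w t = (if snd (w ! t) then 1 else -1)"

definition writhe :: "letter list \<Rightarrow> int" where
  "writhe w = (\<Sum>t<length w. gd_sign w t)"

definition arrs :: "adiag \<Rightarrow> nat set" where
  "arrs D = fst ` set (concat D)"

definition arrow_diagram :: "nat \<Rightarrow> adiag \<Rightarrow> bool" where
  "arrow_diagram n D \<longleftrightarrow> distinct (concat D) \<and> set (concat D) = {..<n} \<times> UNIV"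

definition arcs :: "adiag \<Rightarrow> arc set" where
  "arcs D = {x. fst x < length D \<and> (if D ! fst x = [] then snd x = 0 else snd x < length (D ! fst x))}"

definition endp :: "adiag \<Rightarrow> arc \<Rightarrow> endpt" where
  "endp D x = (let xs = D ! fst x in xs ! (Suc (snd x) mod length xs))"

definition loc :: "adiag \<Rightarrow> endpt \<Rightarrow> arc" where
  "loc D e = (SOME x. fst x < length D \<and> snd x < length (D ! fst x) \<and> D ! fst x ! snd x = e)"

text \<open>Boundary of the surface: after running along an arc up to its end endpoint e,
  the boundary runs along the side of the band of e's arrow to the other end e'
  and continues along the arc starting at e'.\<close>
definition next_arc :: "adiag \<Rightarrow> arc \<Rightarrow> arc" where
  "next_arc D x = (if D ! fst x = [] then x else loc D (fst (endp D x), \<not> snd (endp D x)))"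

definition bcomp :: "adiag \<Rightarrow> arc \<Rightarrow> arc set" where
  "bcomp D x = {y. \<exists>j. y = (next_arc D ^^ j) x}"

definition nbcomp :: "adiag \<Rightarrow> nat" where
  "nbcomp D = card (bcomp D ` arcs D)"

definition multibased :: "nat \<Rightarrow> adiag \<Rightarrow> arc list \<Rightarrow> bool" where
  "multibased k D bs \<longleftrightarrow> nbcomp D = k \<and> length bs = k \<and> set bs \<subseteq> arcs D \<and>
     (\<forall>i<k. \<forall>j<k. i \<noteq> j \<longrightarrow> bcomp D (bs ! i) \<noteq> bcomp D (bs ! j))"

definition trav :: "adiag \<Rightarrow> arc \<Rightarrow> arc list" where
  "trav D x = map (\<lambda>j. (next_arc D ^^ j) x) [0..<card (bcomp D x)]"

definition ascending :: "adiag \<Rightarrow> arc list \<Rightarrow> bool" where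
  "ascending D bs \<longleftrightarrow>
     (let T = filter (\<lambda>y. D ! fst y \<noteq> []) (concat (map (trav D) bs)) in
      \<forall>i<length T. \<not> snd (endp D (T ! i)) \<longrightarrow>
         (\<exists>j<i. fst (endp D (T ! j)) = fst (endp D (T ! i))))"

definition AD :: "nat \<Rightarrow> nat \<Rightarrow> (adiag \<times> arc list) set" where
  "AD n k = {(D, bs). arrow_diagram n D \<and> multibased k D bs \<and> ascending D bs}"

definition sidx :: "'a list \<Rightarrow> 'a \<Rightarrow> nat" where
  "sidx xs e = (SOME q. q < length xs \<and> xs ! q = e)"

definition amap :: "(nat \<Rightarrow> nat) \<Rightarrow> endpt \<Rightarrow> endpt" where
  "amap \<alpha> e = (\<alpha> (fst e), snd e)"

text \<open>Arc y of DB is contained in the image of arc x of DA.\<close>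
definition inimg :: "adiag \<Rightarrow> adiag \<Rightarrow> (nat \<Rightarrow> nat) \<Rightarrow> (nat \<Rightarrow> nat) \<Rightarrow> arc \<Rightarrow> arc \<Rightarrow> bool" where
  "inimg DA DB \<pi> \<alpha> x y \<longleftrightarrow> fst y = \<pi> (fst x) \<and> (DA ! fst x = [] \<or>
     (let xs = DA ! fst x; ys = DB ! fst y; LB = length ys;
          q1 = sidx ys (amap \<alpha> (xs ! snd x));
          q2 = sidx ys (amap \<alpha> (endp DA x));
          d = (q2 + LB - q1) mod LB
      in (snd y + LB - q1) mod LB < (if d = 0 then LB else d)))"

definition hom :: "adiag \<Rightarrow> arc list \<Rightarrow> adiag \<Rightarrow> arc list \<Rightarrow> (nat \<Rightarrow> nat) \<Rightarrow> (nat \<Rightarrow> nat) \<Rightarrow> bool" where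
  "hom DA bsA DB bsB \<pi> \<alpha> \<longleftrightarrow>
     bij_betw \<pi> {..<length DA} {..<length DB} \<and>
     inj_on \<alpha> (arrs DA) \<and> \<alpha> ` arrs DA \<subseteq> arrs DB \<and>
     (\<forall>c<length DA. \<exists>r. rotate r (filter (\<lambda>e. fst e \<in> \<alpha> ` arrs DA) (DB ! \<pi> c))
                         = map (amap \<alpha>) (DA ! c)) \<and>
     length bsA = length bsB \<and>
     (\<forall>i<length bsA. inimg DA DB \<pi> \<alpha> (bsA ! i) (bsB ! i))"

definition iso :: "adiag \<times> arc list \<Rightarrow> adiag \<times> arc list \<Rightarrow> bool" where
  "iso A B \<longleftrightarrow> (\<exists>\<pi> \<alpha>. hom (fst A) (snd A) (fst B) (snd B) \<pi> \<alpha> \<and> \<alpha> ` arrs (fst A) = arrs (fst B))"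

definition Acal :: "nat \<Rightarrow> nat \<Rightarrow> (adiag \<times> arc list) set set" where
  "Acal n k = AD n k // {(A, B). A \<in> AD n k \<and> B \<in> AD n k \<and> iso A B}"

text \<open>Star-colored braid Gauss diagrams: decreasing list js of based labels and colours.\<close>
definition lmax :: "nat list \<Rightarrow> nat \<Rightarrow> nat" where
  "lmax js j = Max {l \<in> {1..length js}. j < js ! (l - 1)}"

definition Gstar :: "nat \<Rightarrow> nat \<Rightarrow> (nat list \<times> (nat \<Rightarrow> nat)) set" where
  "Gstar k m = {(js, col). length js = k \<and> sorted_wrt (>) js \<and> js \<noteq> [] \<and> hd js = m \<and>
      set js \<subseteq> {1..m} \<and>
      (\<forall>j. (j \<in> {1..m} - set js \<longrightarrow> 1 \<le> col j \<and> col j \<le> lmax js j) \<and>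
           (j \<notin> {1..m} - set js \<longrightarrow> col j = 0))}"

definition pairing :: "adiag \<times> arc list \<Rightarrow> nat \<Rightarrow> letter list \<Rightarrow> nat list \<times> (nat \<Rightarrow> nat) \<Rightarrow> int" where
  "pairing A m w G =
     (let DA = fst A; bsA = snd A; js = fst G; col = snd G;
          DG = gd_circles m w; bsG = map (gd_label m w) js
      in \<Sum>S \<in> {\<alpha> ` arrs DA | \<pi> \<alpha>. hom DA bsA DG bsG \<pi> \<alpha> \<and>
                 (\<forall>j \<in> {1..m} - set js. \<exists>x \<in> arcs DA.
                     x \<in> bcomp DA (bsA ! (col j - 1)) \<and> inimg DA DG \<pi> \<alpha> x (gd_label m w j))}.
           \<Prod>t\<in>S. gd_sign w t)"

definition fcoef :: "nat \<Rightarrow> nat \<Rightarrow> nat \<Rightarrow> letter list \<Rightarrow> real" where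
  "fcoef j k m w = (deriv ^^ (k - 1))
      (\<lambda>a::real. a powi (- int m - writhe w + 1) * (a\<^sup>2 - 1) ^ (j - 1)) 1"

definition Ankj :: "nat \<Rightarrow> nat \<Rightarrow> nat \<Rightarrow> nat \<Rightarrow> letter list \<Rightarrow> int" where
  "Ankj n k j m w = (\<Sum>G\<in>Gstar j m. if n + j < k then 0
      else (\<Sum>C\<in>Acal (n + j - k) j. pairing (SOME A. A \<in> C) m w G))"

definition Ank :: "nat \<Rightarrow> nat \<Rightarrow> nat \<Rightarrow> letter list \<Rightarrow> real" where
  "Ank n k m w = (\<Sum>j=1..k. fcoef j k m w * of_int (Ankj n k j m w))"

text \<open>P m w a z is the value at (a, z) (a, z nonzero) of the HOMFLY-PT polynomial
  of the closure of the braid word w in B_m.  It is characterised by Markov invariance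
  (free reduction, braid relations, conjugation, stabilisation), the skein
  relation and the unlink normalisation (these determine it uniquely).\<close>
definition homfly_braid :: "(nat \<Rightarrow> letter list \<Rightarrow> real \<Rightarrow> real \<Rightarrow> real) \<Rightarrow> bool" where
  "homfly_braid P \<longleftrightarrow>
   (\<forall>m u v i b a z. braid_word m (u @ v) \<and> 1 \<le> i \<and> i < m \<and> a \<noteq> 0 \<and> z \<noteq> 0 \<longrightarrow>
       P m (u @ [(i, b), (i, \<not> b)] @ v) a z = P m (u @ v) a z) \<and>
   (\<forall>m u v i a z. braid_word m (u @ v) \<and> 1 \<le> i \<and> Suc i < m \<and> a \<noteq> 0 \<and> z \<noteq> 0 \<longrightarrow>
       P m (u @ [(i, True), (Suc i, True), (i, True)] @ v) a z
     = P m (u @ [(Suc i, True), (i, True), (Suc i, True)] @ v) a z) \<and>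
   (\<forall>m u v i j a z. braid_word m (u @ v) \<and> 1 \<le> i \<and> Suc i < j \<and> j < m \<and> a \<noteq> 0 \<and> z \<noteq> 0 \<longrightarrow>
       P m (u @ [(i, True), (j, True)] @ v) a z = P m (u @ [(j, True), (i, True)] @ v) a z) \<and>
   (\<forall>m u v a z. braid_word m (u @ v) \<and> a \<noteq> 0 \<and> z \<noteq> 0 \<longrightarrow> P m (u @ v) a z = P m (v @ u) a z) \<and>
   (\<forall>m w b a z. 1 \<le> m \<and> braid_word m w \<and> a \<noteq> 0 \<and> z \<noteq> 0 \<longrightarrow>
       P (Suc m) (w @ [(m, b)]) a z = P m w a z) \<and>
   (\<forall>r a z. 1 \<le> r \<and> a \<noteq> 0 \<and> z \<noteq> 0 \<longrightarrow> P r [] a z = ((a - 1 / a) / z) ^ (r - 1)) \<and>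
   (\<forall>m u v i a z. braid_word m (u @ v) \<and> 1 \<le> i \<and> i < m \<and> a \<noteq> 0 \<and> z \<noteq> 0 \<longrightarrow>
       a * P m (u @ [(i, True)] @ v) a z - (1 / a) * P m (u @ [(i, False)] @ v) a z
         = z * P m (u @ v) a z)"

end

theory Submission
  imports Defs
begin

text \<open>
  Put \<open>Q = a^writhe P\<close>, so that the skein relation reads
  \<open>Q(sigma_i) - Q(sigma_i^-1) = z Q(smoothing)\<close>. Travel along the closed braid starting
  at the bottom of the last strand and insist on passing over at the first visit of each crossing: a
  crossing first met from below is expanded into the switched and the smoothed one. Once the traveller
  has reached the top at position \<open>q\<close>, the braid has become
  \<open>u sigma_(m-1)^-1 ... sigma_q^-1\<close> with \<open>u\<close> on \<open>m - 1\<close> strands. If \<open>q < m\<close>, destabilisation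
  gives a factor \<open>a^-1\<close>; if \<open>q = m\<close>, splitting off an unknot gives \<open>(a - 1/a)/z\<close>; in both cases the
  journey continues on \<open>m - 1\<close> strands. The outcome is a sum over the sets \<open>S\<close> of smoothed crossings
  that are all first met from below.

  On the other side, the boundary components of the surface of the arrows in \<open>S\<close> are the
  cycles of the permutation of the braid smoothed at \<open>S\<close>. The colours force the base points onto
  the maximal labels of the cycles, which are the starting points of the journey above, and they are
  then determined themselves. So each \<open>S\<close> is the image of a homomorphism for at most one pair of a
  coloured Gauss diagram and an arrow diagram, and for exactly one iff it occurs in the sum.
\<close>

section \<open>Braid words and the skein relation\<close>

text \<open>The difficulty is that the expansion changes the braid as it goes: over-strands
  disappear through Markov moves and the other crossings are renumbered. To compare it with the
  fixed Gauss diagram, each strand of the braid smoothed at \<open>S\<close> keeps its bottom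
  position as a label. A stage of the journey is then the set of labels not yet travelled, and
  positions are recovered by counting (\<open>idx\<close>). The coefficients come from one count. If
  the smoothed braid has c cycles, m - c strands end in a destabilisation and c - 1 in a splitting,
  so with w the writhe the power of a is a^(-w) a^(-(m-c)) (a - 1/a)^(c-1) = a^(-m-w+1) (a^2 -
  1)^(c-1), the function differentiated in \<open>fcoef\<close>. The power of z is card S - (c-1);
  multiplied by z^k it equals z^n iff card S = n + c - (k+1), the number of arrows in
  \<open>Ankj\<close>. Terms with c > k + 1 vanish to order above k at a = 1, which is why the sum
  over j may stop at k + 1.\<close>

definition wr :: "letter list \<Rightarrow> int" where
  "wr w = (\<Sum>l\<leftarrow>w. if snd l then 1 else -1)"

lemma wr_simps [simp]: "wr [] = 0" "wr (l # w) = (if snd l then 1 else -1) + wr w"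
  "wr (u @ v) = wr u + wr v"
  by (auto simp: wr_def)

lemma writhe_eq_wr: "writhe w = wr w"
  by (simp add: writhe_def wr_def gd_sign_def sum_list_sum_nth atLeast0LessThan)

lemma braid_word_simps [simp]: "braid_word m []"
  "braid_word m (l # w) \<longleftrightarrow> 1 \<le> fst l \<and> fst l < m \<and> braid_word m w"
  "braid_word m (u @ v) \<longleftrightarrow> braid_word m u \<and> braid_word m v"
  by (auto simp: braid_word_def)

lemma braid_word_mono: "braid_word m w \<Longrightarrow> m \<le> n \<Longrightarrow> braid_word n w"
  by (auto simp: braid_word_def)

definition winv :: "letter list \<Rightarrow> letter list" where
  "winv w = rev (map (\<lambda>(i, b). (i, \<not> b)) w)"

lemma winv_winv [simp]: "winv (winv w) = w"
  by (simp add: winv_def rev_map o_def case_prod_beta)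

lemma winv_simps [simp]: "winv [] = []" "winv ((i, b) # w) = winv w @ [(i, \<not> b)]"
  by (simp_all add: winv_def)

lemma braid_word_winv [simp]: "braid_word m (winv w) \<longleftrightarrow> braid_word m w"
  by (auto simp: braid_word_def winv_def)

text \<open>The track of the traveller: the strand that starts at the bottom in position
  \<open>m\<close> and passes over all others down to position \<open>q\<close>. At an inverse
  letter the strand coming from the right is the upper one.\<close>

definition Dwn :: "nat \<Rightarrow> nat \<Rightarrow> letter list" where
  "Dwn m q = map (\<lambda>i. (i, False)) (rev [q..<m])"

lemma Dwn_refl [simp]: "Dwn m m = []"
  by (simp add: Dwn_def)

lemma Dwn_Suc: "q \<le> m \<Longrightarrow> Dwn (Suc m) q = (m, False) # Dwn m q"
  by (simp add: Dwn_def)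

lemma Dwn_snoc: "q < m \<Longrightarrow> Dwn m q = Dwn m (Suc q) @ [(q, False)]"
  by (simp add: Dwn_def upt_conv_Cons)

lemma Dwn_split: "q \<le> r \<Longrightarrow> r \<le> m \<Longrightarrow> Dwn m q = Dwn m r @ Dwn r q"
  using upt_add_eq_append[of q r "m - r"] by (simp add: Dwn_def)

lemma set_Dwn: "set (Dwn m q) = (\<lambda>i. (i, False)) ` {q..<m}"
  by (simp add: Dwn_def)

lemma braid_word_Dwn [simp]: "1 \<le> q \<Longrightarrow> m \<le> n \<Longrightarrow> braid_word n (Dwn m q)"
  by (auto simp: braid_word_def set_Dwn)

section \<open>Braid relations inside the values of P\<close>

locale homfly_eval =
  fixes P :: "nat \<Rightarrow> letter list \<Rightarrow> real \<Rightarrow> real \<Rightarrow> real" and a z :: real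
  assumes homfly: "homfly_braid P" and a_nz: "a \<noteq> 0" and z_nz: "z \<noteq> 0"
begin

abbreviation V :: "nat \<Rightarrow> letter list \<Rightarrow> real" where "V m w \<equiv> P m w a z"

lemma V_cancel: "braid_word m (u @ v) \<Longrightarrow> 1 \<le> i \<Longrightarrow> i < m \<Longrightarrow>
    V m (u @ [(i, b), (i, \<not> b)] @ v) = V m (u @ v)"
  and V_braid: "braid_word m (u @ v) \<Longrightarrow> 1 \<le> i \<Longrightarrow> Suc i < m \<Longrightarrow>
    V m (u @ [(i, True), (Suc i, True), (i, True)] @ v)
      = V m (u @ [(Suc i, True), (i, True), (Suc i, True)] @ v)"
  and V_far: "braid_word m (u @ v) \<Longrightarrow> 1 \<le> i \<Longrightarrow> Suc i < j \<Longrightarrow> j < m \<Longrightarrow>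
    V m (u @ [(i, True), (j, True)] @ v) = V m (u @ [(j, True), (i, True)] @ v)"
  and V_conj: "braid_word m (u @ v) \<Longrightarrow> V m (u @ v) = V m (v @ u)"
  and V_stab: "1 \<le> m \<Longrightarrow> braid_word m w \<Longrightarrow> V (Suc m) (w @ [(m, b)]) = V m w"
  and V_unlink: "1 \<le> r \<Longrightarrow> V r [] = ((a - 1 / a) / z) ^ (r - 1)"
  and V_skein: "braid_word m (u @ v) \<Longrightarrow> 1 \<le> i \<Longrightarrow> i < m \<Longrightarrow>
    a * V m (u @ [(i, True)] @ v) - (1 / a) * V m (u @ [(i, False)] @ v) = z * V m (u @ v)"
proof -
  note h = homfly[unfolded homfly_braid_def]
  note h1 = conjunct1[OF h] and g1 = conjunct2[OF h]
  note h2 = conjunct1[OF g1] and g2 = conjunct2[OF g1]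
  note h3 = conjunct1[OF g2] and g3 = conjunct2[OF g2]
  note h4 = conjunct1[OF g3] and g4 = conjunct2[OF g3]
  note h5 = conjunct1[OF g4] and g5 = conjunct2[OF g4]
  note h6 = conjunct1[OF g5] and h7 = conjunct2[OF g5]
  show "braid_word m (u @ v) \<Longrightarrow> 1 \<le> i \<Longrightarrow> i < m \<Longrightarrow>
    V m (u @ [(i, b), (i, \<not> b)] @ v) = V m (u @ v)"
    by (rule h1[rule_format]) (use a_nz z_nz in simp)
  show "braid_word m (u @ v) \<Longrightarrow> 1 \<le> i \<Longrightarrow> Suc i < m \<Longrightarrow>
    V m (u @ [(i, True), (Suc i, True), (i, True)] @ v)
      = V m (u @ [(Suc i, True), (i, True), (Suc i, True)] @ v)"
    by (rule h2[rule_format]) (use a_nz z_nz in simp)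
  show "braid_word m (u @ v) \<Longrightarrow> 1 \<le> i \<Longrightarrow> Suc i < j \<Longrightarrow> j < m \<Longrightarrow>
    V m (u @ [(i, True), (j, True)] @ v) = V m (u @ [(j, True), (i, True)] @ v)"
    by (rule h3[rule_format]) (use a_nz z_nz in simp)
  show "braid_word m (u @ v) \<Longrightarrow> V m (u @ v) = V m (v @ u)"
    by (rule h4[rule_format]) (use a_nz z_nz in simp)
  show "1 \<le> m \<Longrightarrow> braid_word m w \<Longrightarrow> V (Suc m) (w @ [(m, b)]) = V m w"
    by (rule h5[rule_format]) (use a_nz z_nz in simp)
  show "1 \<le> r \<Longrightarrow> V r [] = ((a - 1 / a) / z) ^ (r - 1)"
    by (rule h6[rule_format]) (use a_nz z_nz in simp)
  show "braid_word m (u @ v) \<Longrightarrow> 1 \<le> i \<Longrightarrow> i < m \<Longrightarrow>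
    a * V m (u @ [(i, True)] @ v) - (1 / a) * V m (u @ [(i, False)] @ v) = z * V m (u @ v)"
    by (rule h7[rule_format]) (use a_nz z_nz in simp)
qed

text \<open>A congruence standing in for equality in the braid group: equal values of
  \<open>P\<close> in every context. The group itself is never constructed.\<close>

definition beq :: "nat \<Rightarrow> letter list \<Rightarrow> letter list \<Rightarrow> bool" where
  "beq m u v \<longleftrightarrow> braid_word m u \<and> braid_word m v \<and>
     (\<forall>x y. braid_word m x \<longrightarrow> braid_word m y \<longrightarrow> V m (x @ u @ y) = V m (x @ v @ y))"

lemma beqD: "beq m u v \<Longrightarrow> braid_word m x \<Longrightarrow> braid_word m y \<Longrightarrow> V m (x @ u @ y) = V m (x @ v @ y)"
  by (auto simp: beq_def)

lemma beq_refl: "braid_word m u \<Longrightarrow> beq m u u"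
  by (auto simp: beq_def)

lemma beq_sym: "beq m u v \<Longrightarrow> beq m v u"
  by (auto simp: beq_def)

lemma beq_trans [trans]: "beq m u v \<Longrightarrow> beq m v x \<Longrightarrow> beq m u x"
  by (auto simp: beq_def)

lemma beq_append: assumes "beq m u u'" "beq m v v'" shows "beq m (u @ v) (u' @ v')"
proof -
  have b: "braid_word m u" "braid_word m v" "braid_word m u'" "braid_word m v'"
    using assms by (auto simp: beq_def)
  have "V m (x @ (u @ v) @ y) = V m (x @ (u' @ v') @ y)"
    if "braid_word m x" "braid_word m y" for x y
    using beqD[OF assms(1), of x "v @ y"] beqD[OF assms(2), of "x @ u'" y] b that by simp
  then show ?thesis using b by (auto simp: beq_def)
qed

lemma beq_ctx: "beq m u v \<Longrightarrow> braid_word m x \<Longrightarrow> braid_word m y \<Longrightarrow> beq m (x @ u @ y) (x @ v @ y)"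
  by (intro beq_append beq_refl)

lemma beq_cancel: "1 \<le> i \<Longrightarrow> i < m \<Longrightarrow> beq m [(i, b), (i, \<not> b)] []"
  using V_cancel[of m _ _ i b] by (simp add: beq_def)

lemma beq_winv_right: "braid_word m u \<Longrightarrow> beq m (u @ winv u) []"
proof (induction u)
  case Nil then show ?case by (simp add: beq_refl)
next
  case (Cons l u)
  obtain i b where l: "l = (i, b)" by force
  have "beq m ([l] @ (u @ winv u) @ [(i, \<not> b)]) ([l] @ [] @ [(i, \<not> b)])"
    using Cons l by (intro beq_ctx) auto
  also have "beq m ([l] @ [] @ [(i, \<not> b)]) []"
    using Cons.prems beq_cancel[of i m b] l by simp
  finally show ?case by (simp add: l)
qed

lemma beq_winv_left: "braid_word m u \<Longrightarrow> beq m (winv u @ u) []"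
  using beq_winv_right[of m "winv u"] by simp

text \<open>With u = v, inserting v v^-1 gives u^-1 = u^-1 v v^-1 = u^-1 u v^-1 = v^-1.\<close>

lemma beq_winv: assumes "beq m u v" shows "beq m (winv u) (winv v)"
proof -
  have b: "braid_word m u" "braid_word m v" using assms by (auto simp: beq_def)
  have "beq m (winv u @ [] @ []) (winv u @ (v @ winv v) @ [])"
    using b by (intro beq_ctx beq_sym[OF beq_winv_right]) auto
  also have "beq m (winv u @ (v @ winv v) @ []) (winv u @ u @ winv v)"
    using beq_ctx[OF beq_sym[OF assms], of "winv u" "winv v"] b by simp
  also have "beq m (winv u @ u @ winv v) (winv v)"
    using beq_append[OF beq_winv_left[OF b(1)] beq_refl[of m "winv v"]] b by simp
  finally show ?thesis by simp
qed

text \<open>\<open>homfly_braid\<close> states the braid relations for positive letters only. If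
  conjugation by \<open>u\<close> sends one letter to another, it also sends the inverse letter to
  the inverse; all mixed signs are obtained in this way.\<close>

lemma beq_conj_flip:
  assumes "beq m (u @ [(i, b)]) ((j, b) # u)"
  shows "beq m (u @ [(i, \<not> b)]) ((j, \<not> b) # u)"
proof -
  have b: "braid_word m u" "1 \<le> i" "i < m" "1 \<le> j" "j < m" using assms by (auto simp: beq_def)
  have "beq m ([] @ [] @ u @ [(i, \<not> b)]) ([] @ [(j, \<not> b), (j, \<not> \<not> b)] @ u @ [(i, \<not> b)])"
    using b by (intro beq_ctx beq_sym[OF beq_cancel]) auto
  also have "beq m ([] @ [(j, \<not> b), (j, \<not> \<not> b)] @ u @ [(i, \<not> b)])
     ([(j, \<not> b)] @ (u @ [(i, b)]) @ [(i, \<not> b)])"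
    using beq_ctx[OF beq_sym[OF assms], of "[(j, \<not> b)]" "[(i, \<not> b)]"] b by simp
  also have "beq m ([(j, \<not> b)] @ (u @ [(i, b)]) @ [(i, \<not> b)]) ([(j, \<not> b)] @ u)"
    using beq_ctx[OF beq_cancel[of i m b], of "(j, \<not> b) # u" "[]"] b by simp
  finally show ?thesis by simp
qed

lemma beq_conj_any:
  assumes "beq m (u @ [(i, b)]) ((j, b) # u)"
  shows "beq m (u @ [(i, c)]) ((j, c) # u)"
  using assms beq_conj_flip[OF assms] by (cases "c = b") auto

lemma beq_far:
  assumes "1 \<le> i" "i < m" "1 \<le> j" "j < m" "Suc i < j \<or> Suc j < i"
  shows "beq m [(i, b), (j, c)] [(j, c), (i, b)]"
proof -
  have "beq m [(i, True), (j, True)] [(j, True), (i, True)]"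
    using assms V_far[of m _ _ i j] V_far[of m _ _ j i] by (auto simp: beq_def)
  then have "beq m [(i, True), (j, c)] [(j, c), (i, True)]"
    using beq_conj_any[of m "[(i, True)]" j True j c] by simp
  then have "beq m ([(j, c)] @ [(i, True)]) ((i, True) # [(j, c)])"
    using beq_sym by simp
  then have "beq m ([(j, c)] @ [(i, b)]) ((i, b) # [(j, c)])"
    by (rule beq_conj_any)
  then show ?thesis using beq_sym by simp
qed

lemma beq_far_word:
  assumes "braid_word m u" "1 \<le> i" "i < m" "\<And>l. l \<in> set u \<Longrightarrow> Suc i < fst l \<or> Suc (fst l) < i"
  shows "beq m (u @ [(i, b)]) ((i, b) # u)"
  using assms
proof (induction u)
  case Nil then show ?case by (simp add: beq_refl)
next
  case (Cons l u)
  obtain j c where l: "l = (j, c)" by force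
  have jc: "1 \<le> j" "j < m" "Suc j < i \<or> Suc i < j" and u: "braid_word m u"
    using Cons.prems(1) Cons.prems(4)[of l] l by auto
  have IH: "beq m (u @ [(i, b)]) ((i, b) # u)"
    using Cons.IH[OF u Cons.prems(2,3)] Cons.prems(4) by auto
  have "beq m ([l] @ (u @ [(i, b)])) ([l] @ ((i, b) # u))"
    using l jc by (intro beq_append IH beq_refl) simp
  also have "beq m ([l] @ ((i, b) # u)) ([(i, b), l] @ u)"
    using beq_append[OF beq_far[of j m i c b] beq_refl[OF u]] jc Cons.prems(2,3) l by simp
  finally show ?case by simp
qed

text \<open>The inverted braid relation says that u = sigma_(i+1)^-1 sigma_i^-1 conjugates
  sigma_(i+1)^-1 to sigma_i^-1; the sign of the moved letter is then free. Geometrically, a crossing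
  slides below an over-strand.\<close>

lemma beq_slide:
  assumes "1 \<le> i" "Suc i < m"
  shows "beq m ([(Suc i, False), (i, False)] @ [(Suc i, b)]) ((i, b) # [(Suc i, False), (i, False)])"
proof -
  have "beq m [(i, True), (Suc i, True), (i, True)] [(Suc i, True), (i, True), (Suc i, True)]"
    using assms V_braid[of m _ _ i] by (auto simp: beq_def)
  from beq_winv[OF this] have "beq m [(i, False), (Suc i, False), (i, False)]
      [(Suc i, False), (i, False), (Suc i, False)]" by simp
  then have "beq m ([(Suc i, False), (i, False)] @ [(Suc i, False)]) ((i, False) # [(Suc i, False), (i, False)])"
    using beq_sym by simp
  then show ?thesis by (rule beq_conj_any)
qed

text \<open>The index drops by one because above the track the traveller counts among the strands to
  the left of the crossing, while below it stands at the far right.\<close>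

lemma beq_Dwn_above:
  assumes "1 \<le> q" "q \<le> i" "Suc i < m"
  shows "beq m (Dwn m q @ [(Suc i, b)]) ((i, b) # Dwn m q)"
proof -
  \<comment> \<open>Only the two middle letters interact with the crossing: all indices in
    \<open>?L\<close> are below \<open>i\<close>, hence far from \<open>Suc i\<close>, and all
    indices in \<open>?U\<close> exceed \<open>Suc i\<close>, hence are far from
    \<open>i\<close>.\<close>
  let ?U = "Dwn m (Suc (Suc i))" and ?M = "[(Suc i, False), (i, False)]" and ?L = "Dwn i q"
  have D: "Dwn m q = ?U @ ?M @ ?L"
    using assms Dwn_split[of q "Suc (Suc i)" m] by (simp add: Dwn_Suc)
  have bw: "braid_word m ?U" "braid_word m ?M" "braid_word m ?L" using assms by auto
  have "beq m ((?U @ ?M) @ (?L @ [(Suc i, b)]) @ []) ((?U @ ?M) @ ((Suc i, b) # ?L) @ [])"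
    using assms bw by (intro beq_ctx beq_far_word) (auto simp: set_Dwn)
  also have "beq m ((?U @ ?M) @ ((Suc i, b) # ?L) @ []) (?U @ ((i, b) # ?M) @ ?L)"
    using beq_ctx[OF beq_slide[of i m b], of ?U ?L] assms bw by simp
  also have "beq m (?U @ ((i, b) # ?M) @ ?L) ([] @ ((i, b) # ?U) @ (?M @ ?L))"
  proof -
    have "beq m (?U @ [(i, b)]) ((i, b) # ?U)"
      using assms bw by (intro beq_far_word) (auto simp: set_Dwn)
    from beq_ctx[OF this, of "[]" "?M @ ?L"] show ?thesis using assms bw by simp
  qed
  finally show ?thesis by (simp add: D)
qed

lemma beq_Dwn_below:
  assumes "1 \<le> i" "Suc i < q" "q \<le> m"
  shows "beq m (Dwn m q @ [(i, b)]) ((i, b) # Dwn m q)"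
  using assms by (intro beq_far_word) (auto simp: set_Dwn)

section \<open>The normalised skein expansion along the traveller\<close>

definition Q :: "nat \<Rightarrow> letter list \<Rightarrow> real" where
  "Q m w = a powi wr w * V m w"

lemma Q_beq: "beq m u v \<Longrightarrow> wr u = wr v \<Longrightarrow> braid_word m x \<Longrightarrow> braid_word m y \<Longrightarrow>
    Q m (x @ u @ y) = Q m (x @ v @ y)"
  using beqD[of m u v x y] by (simp add: Q_def)

lemma Q_skein:
  assumes "braid_word m (u @ v)" "1 \<le> i" "i < m"
  shows "Q m (u @ [(i, b)] @ v) = Q m (u @ [(i, \<not> b)] @ v) + (if b then z else - z) * Q m (u @ v)"
proof -
  let ?e = "wr u + wr v"
  have e: "a powi (?e + 1) = a powi ?e * a" "a powi (?e - 1) = a powi ?e / a"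
    using a_nz by (simp_all add: power_int_add power_int_diff)
  have q: "Q m (u @ [(i, True)] @ v) = a powi (?e + 1) * V m (u @ [(i, True)] @ v)"
     "Q m (u @ [(i, False)] @ v) = a powi (?e - 1) * V m (u @ [(i, False)] @ v)"
     "Q m (u @ v) = a powi ?e * V m (u @ v)"
    by (simp_all add: Q_def algebra_simps)
  have "Q m (u @ [(i, True)] @ v) - Q m (u @ [(i, False)] @ v) = z * Q m (u @ v)"
  proof -
    have "a powi ?e * a * X - a powi ?e / a * Y = a powi ?e * (a * X - (1 / a) * Y)" for X Y
      by (simp add: right_diff_distrib)
    then show ?thesis unfolding q e by (simp only: V_skein[OF assms] mult.left_commute)
  qed
  then show ?thesis by (cases b) (simp_all add: algebra_simps)
qed

text \<open>Skein relation at an extra last crossing: sigma_m and its inverse both destabilise to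
  \<open>w\<close>, and smoothing it leaves \<open>w\<close> beside a free strand.\<close>

lemma Q_split:
  assumes "1 \<le> m" "braid_word m w"
  shows "Q (Suc m) w = (a - 1 / a) / z * Q m w"
proof -
  have "a * V m w - (1 / a) * V m w = z * V (Suc m) w"
    using V_skein[of "Suc m" w "[]" m] V_stab[of m w] assms braid_word_mono[of m w "Suc m"] by simp
  then have "V (Suc m) w = (a - 1 / a) / z * V m w" using z_nz by (simp add: field_simps)
  then show ?thesis by (simp add: Q_def)
qed

text \<open>After moving the rest of the track to the front by conjugation, the only letter using
  the last strand is sigma_m^-1, which destabilises; its writhe -1 gives the factor. What has moved
  to the front is again a track, with the traveller in position \<open>q\<close> of \<open>m\<close>
  strands.\<close>

lemma Q_stab:
  assumes "1 \<le> q" "q \<le> m" "braid_word m w"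
  shows "Q (Suc m) (w @ Dwn (Suc m) q) = inverse a * Q m (Dwn m q @ w)"
proof -
  have "V (Suc m) ((w @ [(m, False)]) @ Dwn m q) = V (Suc m) (Dwn m q @ (w @ [(m, False)]))"
    using assms braid_word_mono[of m w "Suc m"] by (intro V_conj) auto
  also have "\<dots> = V m (Dwn m q @ w)"
    using V_stab[of m "Dwn m q @ w" False] assms by simp
  finally show ?thesis using assms a_nz
    by (simp add: Q_def Dwn_Suc power_int_add power_int_diff divide_inverse mult_ac)
qed

text \<open>The word is \<open>w1 @ Dwn m q @ v\<close> with crossings tagged by their original index; the traveller
  stands at position \<open>q\<close> just below \<open>v\<close>. Crossings in \<open>S\<close> are to be smoothed, which is
  possible only if the traveller arrives from below.\<close>
fun E :: "nat set \<Rightarrow> nat \<Rightarrow> nat \<Rightarrow> (nat \<times> letter) list \<Rightarrow> (nat \<times> letter) list \<Rightarrow> real" where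
  "E S m q w1 [] =
     (if m \<le> 1 then 1
      else if q = m then (a - 1 / a) / z * E S (m - 1) (m - 1) [] w1
      else inverse a * E S (m - 1) q [] w1)"
| "E S m q w1 ((t, i, b) # v) =
     (if q = i then (if t \<in> S then (if b then 0 else - z * E S m q w1 v) else E S m (Suc i) w1 v)
      else if q = Suc i then (if t \<in> S then (if b then z * E S m q w1 v else 0) else E S m i w1 v)
      else E S m q (w1 @ [(t, if q < i then i - 1 else i, b)]) v)"

text \<open>\<open>E\<close> consults \<open>S\<close> only at crossings still present, so the tag
  of a letter just consumed may be added to or dropped from \<open>S\<close>.\<close>

lemma E_cong: "S \<inter> fst ` set (w1 @ v) = S' \<inter> fst ` set (w1 @ v) \<Longrightarrow> E S m q w1 v = E S' m q w1 v"
proof (induction S m q w1 v rule: E.induct)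
  case (1 S m q w1) then show ?case by simp
next
  case (2 S m q w1 t i b v)
  have t: "t \<in> S \<longleftrightarrow> t \<in> S'" using 2(6) by auto
  have I: "S \<inter> fst ` set (w1 @ v) = S' \<inter> fst ` set (w1 @ v)" using 2(6) by auto
  consider "q = i" | "q = Suc i" | "q \<noteq> i" "q \<noteq> Suc i" by blast
  then show ?case
  proof cases
    case 1 with 2(1,2) I t show ?thesis by auto
  next
    case 2 with "2.IH"(3,4) I t show ?thesis by auto
  next
    case 3 with "2.IH"(5)[OF 3] 2(6) show ?thesis by auto
  qed
qed

lemma sum_Pow_insert:
  assumes "finite A" "x \<notin> A"
  shows "sum f (Pow (insert x A)) = (\<Sum>S\<in>Pow A. f S + f (insert x S))"
proof -
  have "sum f (Pow (insert x A)) = sum f (Pow A) + sum f (insert x ` Pow A)"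
    unfolding Pow_insert using assms by (intro sum.union_disjoint) auto
  also have "sum f (insert x ` Pow A) = (\<Sum>S\<in>Pow A. f (insert x S))"
    using assms by (intro sum.reindex_cong[of "insert x"]) (auto intro!: inj_onI)
  finally show ?thesis by (simp add: sum.distrib)
qed

text \<open>Outer induction on the number of strands, inner induction on the crossings still ahead:
  a step upward shortens \<open>v\<close>, arrival at the top lowers \<open>m\<close>. A crossing
  met by the traveller splits the sum according to whether its tag lies in \<open>S\<close>: the
  summands without it form the over-crossing term, those with it the smoothed term, which is 0 if
  the traveller was already above.\<close>

lemma Q_state:
  assumes "distinct (map fst (w1 @ v))" "braid_word (m - 1) (map snd w1)" "braid_word m (map snd v)"
    "1 \<le> q" "q \<le> m"
  shows "Q m (map snd w1 @ Dwn m q @ map snd v) = (\<Sum>S\<in>Pow (fst ` set (w1 @ v)). E S m q w1 v)"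
  using assms
proof (induction m arbitrary: w1 v q)
  case 0 then show ?case by simp
next
  case (Suc m)
  note outer = Suc.IH
  from Suc.prems show ?case
  proof (induction v arbitrary: w1 q)
    case Nil
    show ?case
    proof (cases "m = 0")
      case True
      with Nil have "w1 = []" "q = 1" by (cases w1; auto)+
      with True V_unlink[of 1] show ?thesis by (simp add: Q_def)
    next
      case m: False
      show ?thesis
      proof (cases "q = Suc m")
        case True
        have "Q m (map snd w1) = (\<Sum>S\<in>Pow (fst ` set w1). E S m m [] w1)"
          using outer[of "[]" w1 m] Nil m by simp
        with True Q_split[of m "map snd w1"] Nil m show ?thesis
          by (simp add: sum_distrib_left)
      next
        case False
        have "Q m (Dwn m q @ map snd w1) = (\<Sum>S\<in>Pow (fst ` set w1). E S m q [] w1)"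
          using outer[of "[]" w1 q] Nil m False by simp
        with False Q_stab[of q m "map snd w1"] Nil m show ?thesis
          by (simp add: sum_distrib_left)
      qed
    qed
  next
    case (Cons l v)
    obtain t i b where l: "l = (t, i, b)" by (metis surj_pair)
    let ?M = "Suc m" and ?x = "map snd w1" and ?y = "map snd v" and ?I = "fst ` set (w1 @ v)"
    have i: "1 \<le> i" "i < ?M" and y: "braid_word ?M ?y" and x: "braid_word m ?x"
      and x': "braid_word ?M ?x"
      and dst: "distinct (map fst (w1 @ v))" "t \<notin> ?I"
      using Cons.prems l braid_word_mono[of m ?x ?M] by auto
    have q: "1 \<le> q" "q \<le> ?M" using Cons.prems by auto
    have IH: "Q ?M (?x @ Dwn ?M q' @ ?y) = (\<Sum>S\<in>Pow ?I. E S ?M q' w1 v)"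
      if "1 \<le> q'" "q' \<le> ?M" for q'
      using Cons.IH[of w1 q'] dst x y that by simp
    have ins: "E (insert t S) ?M q' w1 v = E S ?M q' w1 v" for S q'
      using dst by (intro E_cong) auto
    have Pw: "fst ` set (w1 @ l # v) = insert t ?I" using l by auto
    have out: "t \<notin> S" if "S \<in> Pow ?I" for S using that dst by auto
    have sumP: "(\<Sum>S\<in>Pow (fst ` set (w1 @ l # v)). E S ?M q w1 (l # v))
       = (\<Sum>S\<in>Pow ?I. E S ?M q w1 (l # v) + E (insert t S) ?M q w1 (l # v))"
      unfolding Pw using dst by (intro sum_Pow_insert) auto
    have Qc: "Q ?M (?x @ (Dwn ?M q @ [(i, b)]) @ ?y) = Q ?M (?x @ u @ ?y)"
      if "beq ?M (Dwn ?M q @ [(i, b)]) u" "wr (Dwn ?M q @ [(i, b)]) = wr u" for u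
      using Q_beq[OF that x' y] .
    consider "q = i" | "q = Suc i" | "q < i" | "Suc i < q" by linarith
    then show ?case
    proof cases
      case 1
      \<comment> \<open>Coming from the left, the traveller is above at sigma_i, which cancels the
        last letter of the track, and below at sigma_i^-1, which must be expanded.\<close>
      have D: "Dwn ?M i = Dwn ?M (Suc i) @ [(i, False)]" using i by (intro Dwn_snoc) auto
      have up: "Q ?M (?x @ Dwn ?M i @ [(i, True)] @ ?y) = Q ?M (?x @ Dwn ?M (Suc i) @ ?y)"
        using Q_beq[OF beq_cancel[of i ?M False], of "?x @ Dwn ?M (Suc i)" ?y] i x' y
        by (simp add: D)
      have "Q ?M (?x @ Dwn ?M q @ map snd (l # v))
          = Q ?M (?x @ Dwn ?M (Suc i) @ ?y) + (if b then 0 else - z * Q ?M (?x @ Dwn ?M i @ ?y))"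
        using up Q_skein[of ?M "?x @ Dwn ?M i" ?y i False] i x' y 1 l by (cases b) simp_all
      also have "\<dots> = (\<Sum>S\<in>Pow ?I. E S ?M (Suc i) w1 v) + (\<Sum>S\<in>Pow ?I. if b then 0 else - z * E S ?M i w1 v)"
        using IH[of i] IH[of "Suc i"] i by (simp add: sum_distrib_left)
      also have "\<dots> = (\<Sum>S\<in>Pow (fst ` set (w1 @ l # v)). E S ?M q w1 (l # v))"
        unfolding sumP sum.distrib[symmetric] using 1 l out ins by (intro sum.cong) auto
      finally show ?thesis .
    next
      case 2
      \<comment> \<open>Coming from the right the roles are exchanged: sigma_i^-1 simply lengthens
        the track by one letter, and sigma_i is the crossing to be expanded.\<close>
      have D: "Dwn ?M i = Dwn ?M q @ [(i, False)]" using i 2 Dwn_snoc[of i ?M] by auto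
      have "Q ?M (?x @ Dwn ?M q @ map snd (l # v))
          = Q ?M (?x @ Dwn ?M i @ ?y) + (if b then z * Q ?M (?x @ Dwn ?M q @ ?y) else 0)"
        using Q_skein[of ?M "?x @ Dwn ?M q" ?y i True] D i x' y 2 l q by (cases b) simp_all
      also have "\<dots> = (\<Sum>S\<in>Pow ?I. E S ?M i w1 v) + (\<Sum>S\<in>Pow ?I. if b then z * E S ?M q w1 v else 0)"
        using IH[of i] IH[of q] i q by (simp add: sum_distrib_left)
      also have "\<dots> = (\<Sum>S\<in>Pow (fst ` set (w1 @ l # v)). E S ?M q w1 (l # v))"
        unfolding sumP sum.distrib[symmetric] using 2 l out ins by (intro sum.cong) auto
      finally show ?thesis .
    next
      case 3
      then obtain i' where i': "i = Suc i'" by (cases i) auto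
      have "Q ?M (?x @ Dwn ?M q @ map snd (l # v)) = Q ?M (map snd (w1 @ [(t, i', b)]) @ Dwn ?M q @ ?y)"
        using Qc[OF beq_Dwn_above[of q i' ?M b, folded i']] 3 q i i' l by simp
      also have "\<dots> = (\<Sum>S\<in>Pow (fst ` set ((w1 @ [(t, i', b)]) @ v)). E S ?M q (w1 @ [(t, i', b)]) v)"
        using dst x y q i 3 i' by (intro Cons.IH) auto
      also have "\<dots> = (\<Sum>S\<in>Pow (fst ` set (w1 @ l # v)). E S ?M q w1 (l # v))"
        using 3 l i' by (intro sum.cong) auto
      finally show ?thesis .
    next
      case 4
      have "Q ?M (?x @ Dwn ?M q @ map snd (l # v)) = Q ?M (map snd (w1 @ [(t, i, b)]) @ Dwn ?M q @ ?y)"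
        using Qc[OF beq_Dwn_below[of i q ?M b]] 4 q i l by simp
      also have "\<dots> = (\<Sum>S\<in>Pow (fst ` set ((w1 @ [(t, i, b)]) @ v)). E S ?M q (w1 @ [(t, i, b)]) v)"
        using dst x y q i 4 by (intro Cons.IH) auto
      also have "\<dots> = (\<Sum>S\<in>Pow (fst ` set (w1 @ l # v)). E S ?M q w1 (l # v))"
        using 4 l by (intro sum.cong) auto
      finally show ?thesis .
    qed
  qed
qed

end

section \<open>Labelled strands and one upward pass\<close>

definition swap_at :: "nat \<Rightarrow> 'a list \<Rightarrow> 'a list" where
  "swap_at i xs = take (i - 1) xs @ [xs ! i, xs ! (i - 1)] @ drop (Suc i) xs"

lemma split_at: "1 \<le> i \<Longrightarrow> i < length xs \<Longrightarrow> xs = take (i - 1) xs @ [xs ! (i - 1), xs ! i] @ drop (Suc i) xs"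
  by (cases i) (simp_all add: Cons_nth_drop_Suc)

lemma swap_at_props:
  assumes "1 \<le> i" "i < length xs"
  shows "length (swap_at i xs) = length xs" "set (swap_at i xs) = set xs" "distinct xs \<Longrightarrow> distinct (swap_at i xs)"
proof -
  let ?p = "take (i - 1) xs" and ?s = "drop (Suc i) xs"
  note e = split_at[OF assms]
  show "length (swap_at i xs) = length xs" using assms by (simp add: swap_at_def)
  show "set (swap_at i xs) = set xs" by (subst (2) e) (auto simp: swap_at_def)
  assume "distinct xs"
  then have "distinct (?p @ [xs ! (i - 1), xs ! i] @ ?s)" using e by metis
  then show "distinct (swap_at i xs)" by (auto simp: swap_at_def)
qed

text \<open>Here \<open>xs\<close> lists the labels of the strands from left to right at the bottom of the word; the
  strands with labels outside \<open>U\<close> are deleted.\<close>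
fun restrict_word :: "nat set \<Rightarrow> nat set \<Rightarrow> nat list \<Rightarrow> (nat \<times> letter) list \<Rightarrow> (nat \<times> letter) list" where
  "restrict_word U S xs [] = []"
| "restrict_word U S xs ((t, i, b) # w) =
     (if xs ! (i - 1) \<in> U \<and> xs ! i \<in> U
      then [(t, Suc (length (filter (\<lambda>x. x \<in> U) (take (i - 1) xs))), b)] else [])
     @ restrict_word U S (if t \<in> S then xs else swap_at i xs) w"

fun top_config :: "nat set \<Rightarrow> nat list \<Rightarrow> (nat \<times> letter) list \<Rightarrow> nat list" where
  "top_config S xs [] = xs"
| "top_config S xs ((t, i, b) # w) = top_config S (if t \<in> S then xs else swap_at i xs) w"

text \<open>Besides its sign, a smoothed crossing records two labels: the strand arriving in the
  lower position, then the one arriving in the upper position. At sigma_i the lower one comes from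
  the right, at the inverse from the left.\<close>

fun smoothing_data :: "nat set \<Rightarrow> nat list \<Rightarrow> (nat \<times> letter) list \<Rightarrow> (bool \<times> nat \<times> nat) list" where
  "smoothing_data S xs [] = []"
| "smoothing_data S xs ((t, i, b) # w) =
     (if t \<in> S then [(b, if b then xs ! i else xs ! (i - 1), if b then xs ! (i - 1) else xs ! i)] else [])
     @ smoothing_data S (if t \<in> S then xs else swap_at i xs) w"

text \<open>The position of \<open>x\<close>, counted from 1, once the strands with labels outside
  \<open>U\<close> are deleted; this is the position argument expected by \<open>E\<close>.\<close>

definition idx :: "'a set \<Rightarrow> 'a list \<Rightarrow> 'a \<Rightarrow> nat" where
  "idx U xs x = Suc (length (filter (\<lambda>y. y \<in> U) (takeWhile (\<lambda>y. y \<noteq> x) xs)))"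

lemma idx_append: "x \<notin> set ps \<Longrightarrow> idx U (ps @ x # ss) x = Suc (length (filter (\<lambda>y. y \<in> U) ps))"
proof -
  assume "x \<notin> set ps"
  then have "takeWhile (\<lambda>y. y \<noteq> x) (ps @ x # ss) = ps" by (induction ps) auto
  then show ?thesis by (simp add: idx_def)
qed

lemma top_config_props:
  assumes "braid_word (length xs) (map snd w)"
  shows "length (top_config S xs w) = length xs" "set (top_config S xs w) = set xs" "distinct xs \<Longrightarrow> distinct (top_config S xs w)"
  using assms
proof (induction S xs w rule: top_config.induct)
  case (2 S xs t i b w)
  { case 1 with 2 swap_at_props[of i xs] show ?case by auto }
  { case 2 with "2.IH" swap_at_props[of i xs] show ?case by auto }
  { case 3 with 2 swap_at_props[of i xs] show ?case by auto }
qed auto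

lemma filter_diff_length:
  "distinct ps \<Longrightarrow> x \<in> set ps \<Longrightarrow> x \<in> U \<Longrightarrow>
    length (filter (\<lambda>y. y \<in> U) ps) = Suc (length (filter (\<lambda>y. y \<in> U \<and> y \<noteq> x) ps))"
proof (induction ps)
  case (Cons p ps)
  have "filter (\<lambda>y. y \<in> U \<and> y \<noteq> x) ps = filter (\<lambda>y. y \<in> U) ps" if "x \<notin> set ps"
    using that by (intro filter_cong) auto
  with Cons show ?case by auto
qed simp

lemma idx_sw_other:
  assumes "1 \<le> i" "i < length xs" "x \<in> U" "x \<in> set xs"
    "xs ! (i - 1) \<notin> U \<or> xs ! i \<notin> U \<or> x \<noteq> xs ! (i - 1) \<and> x \<noteq> xs ! i"
  shows "idx U (swap_at i xs) x = idx U xs x"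
proof -
  let ?p = "take (i - 1) xs" and ?s = "drop (Suc i) xs"
  have "idx U (ps @ [u, v] @ ss) x = idx U (ps @ [v, u] @ ss) x"
    if h: "x \<in> set (ps @ [v, u] @ ss)" "v \<notin> U \<or> u \<notin> U \<or> x \<noteq> v \<and> x \<noteq> u" for ps ss u v
  proof -
    consider "x \<in> set ps" | "x \<notin> set ps" "x = u" | "x \<notin> set ps" "x = v" | "x \<notin> set ps" "x \<noteq> u" "x \<noteq> v" "x \<in> set ss"
      using h by auto
    then show ?thesis
    proof cases
      case 1
      then obtain p1 p2 where "ps = p1 @ x # p2" "x \<notin> set p1" using split_list_first by metis
      then show ?thesis using idx_append[of x p1 U] by simp
    next
      case 2
      then show ?thesis using idx_append[of u ps U "v # ss"] idx_append[of u "ps @ [v]" U ss] h assms(3)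
        by (cases "u = v") auto
    next
      case 3
      then show ?thesis using idx_append[of v ps U "u # ss"] idx_append[of v "ps @ [u]" U ss] h assms(3)
        by (cases "u = v") auto
    next
      case 4
      then obtain p1 p2 where "ss = p1 @ x # p2" "x \<notin> set p1" using split_list_first by metis
      then show ?thesis using idx_append[of x "ps @ [u, v] @ p1" U p2] idx_append[of x "ps @ [v, u] @ p1" U p2] 4
        by simp
    qed
  qed
  from this[of ?p "xs ! (i - 1)" "xs ! i" ?s]
  have "idx U (?p @ [xs ! i, xs ! (i - 1)] @ ?s) x = idx U (?p @ [xs ! (i - 1), xs ! i] @ ?s) x"
    using assms(4,5) split_at[OF assms(1,2)] by metis
  then show ?thesis using split_at[OF assms(1,2)] by (simp add: swap_at_def)
qed

text \<open>The factor collected while travelling along strand \<open>x\<close> when the strands in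
  \<open>U\<close> are still present. A smoothed crossing counts only if both its strands are
  present and one of them is \<open>x\<close>: arrival from below gives plus or minus
  \<open>z\<close>, arrival from above kills the term.\<close>

definition strand_weight :: "real \<Rightarrow> nat set \<Rightarrow> nat \<Rightarrow> (bool \<times> nat \<times> nat) list \<Rightarrow> real" where
  "strand_weight z U x es = (\<Prod>(b, u, v)\<leftarrow>es. if u \<in> U \<and> v \<in> U \<and> (u = x \<or> v = x)
      then if u = x then if b then z else - z else 0 else 1)"

lemma strand_weight_Nil [simp]: "strand_weight z U x [] = 1"
  and strand_weight_Cons: "strand_weight z U x ((b, u, v) # es) = (if u \<in> U \<and> v \<in> U \<and> (u = x \<or> v = x)
      then if u = x then if b then z else - z else 0 else 1) * strand_weight z U x es"
  by (simp_all add: strand_weight_def)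

context homfly_eval
begin

text \<open>One complete pass: \<open>E\<close> picks up the weight of strand \<open>x\<close>, the
  traveller reaches the top at its position in \<open>top_config\<close>, and the crossings it did
  not meet form the word on the strands other than \<open>x\<close>. The number \<open>M\<close> of
  strands is untouched during a pass and therefore arbitrary here.\<close>

lemma E_sweep:
  assumes "distinct xs" "braid_word (length xs) (map snd w)" "x \<in> U" "x \<in> set xs"
  shows "E S M (idx U xs x) w1 (restrict_word U S xs w)
     = strand_weight z U x (smoothing_data S xs w) * E S M (idx U (top_config S xs w) x) (w1 @ restrict_word (U - {x}) S xs w) []"
  using assms
proof (induction w arbitrary: xs w1)
  case Nil then show ?case by simp
next
  case (Cons l w)
  obtain t i b where l: "l = (t, i, b)" by (metis surj_pair)
  have i: "1 \<le> i" "i < length xs" and w: "braid_word (length xs) (map snd w)"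
    using Cons.prems l by auto
  define ps ss y1 y2 where "ps = take (i - 1) xs" "ss = drop (Suc i) xs" "y1 = xs ! (i - 1)" "y2 = xs ! i"
  have xs: "xs = ps @ [y1, y2] @ ss" and swap_at: "swap_at i xs = ps @ [y2, y1] @ ss"
    using split_at[OF i] by (simp_all add: ps_ss_y1_y2_def swap_at_def)
  have yi: "xs ! (i - 1) = y1" "xs ! i = y2" "take (i - 1) xs = ps" by (simp_all add: ps_ss_y1_y2_def)
  have yi': "xs ! (i - Suc 0) = y1" "take (i - Suc 0) xs = ps" using yi by simp_all
  note swap = swap_at_props[OF i]
  define xs' where "xs' = (if t \<in> S then xs else swap_at i xs)"
  have recs: "restrict_word V S xs (l # w) = (if y1 \<in> V \<and> y2 \<in> V
        then [(t, Suc (length (filter (\<lambda>x. x \<in> V) ps)), b)] else []) @ restrict_word V S xs' w"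
      "top_config S xs (l # w) = top_config S xs' w"
      "smoothing_data S xs (l # w) = (if t \<in> S then [(b, if b then y2 else y1, if b then y1 else y2)] else []) @ smoothing_data S xs' w" for V
    by (simp_all only: l restrict_word.simps top_config.simps smoothing_data.simps xs'_def yi)
  note E1 = E.simps(1)
  have IH: "E S M (idx U xs' x) w1 (restrict_word U S xs' w)
     = strand_weight z U x (smoothing_data S xs' w) * E S M (idx U (top_config S xs' w) x) (w1 @ restrict_word (U - {x}) S xs' w) []" for w1
    using Cons.prems swap w unfolding xs'_def by (intro Cons.IH) auto
  have d: "distinct (ps @ [y1, y2] @ ss)" using Cons.prems(1) xs by simp
  have xin: "x \<in> set (ps @ [y1, y2] @ ss)" using Cons.prems(4) xs by simp
  have oth: "idx U xs' x = idx U xs x" if "y1 \<notin> U \<or> y2 \<notin> U \<or> x \<noteq> y1 \<and> x \<noteq> y2"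
    using idx_sw_other[OF i Cons.prems(3,4)] that yi by (auto simp: xs'_def)
  show ?case
  proof (cases "y1 \<in> U \<and> y2 \<in> U")
    case False
    have r: "restrict_word U S xs (l # w) = restrict_word U S xs' w" "restrict_word (U - {x}) S xs (l # w) = restrict_word (U - {x}) S xs' w"
      using False unfolding recs by auto
    have "strand_weight z U x (smoothing_data S xs (l # w)) = strand_weight z U x (smoothing_data S xs' w)"
      using False unfolding recs by (auto simp: strand_weight_Cons)
    moreover have "idx U xs' x = idx U xs x" using False by (intro oth) auto
    ultimately show ?thesis unfolding r using IH[of w1] by (simp only: recs(2))
  next
    case True
    consider "x = y1" | "x = y2" "x \<noteq> y1" | "x \<noteq> y1" "x \<noteq> y2" "x \<in> set ps" | "x \<noteq> y1" "x \<noteq> y2" "x \<in> set ss" "x \<notin> set ps"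
      using xin by auto
    then show ?thesis
    proof cases
      case 1
      have "idx U xs x = Suc (length (filter (\<lambda>y. y \<in> U) ps))"
        unfolding xs using idx_append[of y1 ps U "y2 # ss"] d 1 by simp
      moreover have "idx U (swap_at i xs) x = Suc (Suc (length (filter (\<lambda>y. y \<in> U) ps)))"
        unfolding swap_at using idx_append[of y1 "ps @ [y2]" U "ss"] d 1 True by simp
      moreover have "y2 \<noteq> x" using d 1 by auto
      ultimately show ?thesis using 1 True IH[of w1] unfolding recs
        by (cases "t \<in> S"; cases b) (simp_all add: l xs'_def strand_weight_Cons del: E1)
    next
      case 2
      have "idx U (swap_at i xs) x = Suc (length (filter (\<lambda>y. y \<in> U) ps))"
        unfolding swap_at using idx_append[of y2 ps U "y1 # ss"] d 2 by simp
      moreover have "idx U xs x = Suc (Suc (length (filter (\<lambda>y. y \<in> U) ps)))"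
        unfolding xs using idx_append[of y2 "ps @ [y1]" U "ss"] d 2 True by simp
      ultimately show ?thesis using 2 True IH[of w1] unfolding recs
        by (cases "t \<in> S"; cases b) (simp_all add: l xs'_def strand_weight_Cons del: E1)
    next
      case 3
      obtain p1 p2 where p: "ps = p1 @ x # p2" "x \<notin> set p1" using split_list_first[OF 3(3)] by auto
      have "idx U xs x = Suc (length (filter (\<lambda>y. y \<in> U) p1))"
        unfolding xs p using idx_append[of x p1 U] p by simp
      then have "idx U xs x < Suc (length (filter (\<lambda>y. y \<in> U) ps))" 
        using Cons.prems(3) p by simp
      \<comment> \<open>Deleting \<open>x\<close>, which lies to the left, lowers the index of this
        crossing by one: exactly the shift \<open>i - 1\<close> in \<open>E\<close> for a traveller
        left of the crossing.\<close>
      moreover have "length (filter (\<lambda>y. y \<in> U) ps) = Suc (length (filter (\<lambda>y. y \<in> U \<and> y \<noteq> x) ps))"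
        using d 3 Cons.prems(3) by (intro filter_diff_length) auto
      ultimately show ?thesis using 3 True IH oth unfolding recs
        by (cases "t \<in> S"; cases b) (simp_all add: l strand_weight_Cons del: E1)
    next
      case 4
      obtain p1 p2 where p: "ss = p1 @ x # p2" "x \<notin> set p1" using split_list_first[OF 4(3)] by auto
      have "idx U xs x = Suc (length (filter (\<lambda>y. y \<in> U) (ps @ [y1, y2] @ p1)))"
        unfolding xs p using idx_append[of x "ps @ [y1, y2] @ p1" U p2] p 4 by simp
      then have "idx U xs x > Suc (Suc (length (filter (\<lambda>y. y \<in> U) ps)))" 
        using True by simp
      moreover have "filter (\<lambda>y. y \<in> U \<and> y \<noteq> x) ps = filter (\<lambda>y. y \<in> U) ps"
        using 4 by (intro filter_cong) auto
      ultimately show ?thesis using 4 True IH oth unfolding recs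
        by (cases "t \<in> S"; cases b) (simp_all add: l strand_weight_Cons del: E1)
    qed
  qed
qed

end

section \<open>The complete journey, cycle by cycle\<close>

fun path_to :: "('a \<Rightarrow> 'a) \<Rightarrow> 'a \<Rightarrow> 'a list \<Rightarrow> bool" where
  "path_to \<sigma> B [] = False"
| "path_to \<sigma> B [x] = (\<sigma> x = B)"
| "path_to \<sigma> B (x # y # l) = (\<sigma> x = y \<and> path_to \<sigma> B (y # l))"

text \<open>Each list is a cycle of \<sigma> cut open at its first entry, and that entry exceeds
  everything after it. It is thus the rightmost strand left when the previous cycle closes, which is
  where \<open>E\<close> restarts after a splitting.\<close>

fun max_led :: "(nat \<Rightarrow> nat) \<Rightarrow> nat list list \<Rightarrow> bool" where
  "max_led \<sigma> [] = True"
| "max_led \<sigma> (c # css) = (path_to \<sigma> (hd c) c \<and> (\<forall>v\<in>set (tl c @ concat css). v < hd c) \<and> max_led \<sigma> css)"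

lemma path_to_image: "path_to \<sigma> B l \<Longrightarrow> \<sigma> ` set l = insert B (set (tl l))"
  by (induction \<sigma> B l rule: path_to.induct) auto

lemma max_led_image: "max_led \<sigma> css \<Longrightarrow> \<sigma> ` set (concat css) = set (concat css)"
proof (induction \<sigma> css rule: max_led.induct)
  case (2 \<sigma> c css)
  then have "c \<noteq> []" by auto
  then have "insert (hd c) (set (tl c)) = set c" by (cases c) auto
  with 2 path_to_image[of \<sigma> "hd c" c] show ?case by (simp add: image_Un)
qed simp

text \<open>Travelled strands are deleted, so the present set is always the remaining tail; a
  smoothed crossing is weighed only while both its strands are there.\<close>

fun run_weight :: "real \<Rightarrow> nat list \<Rightarrow> (bool \<times> nat \<times> nat) list \<Rightarrow> real" where
  "run_weight z [] es = 1"
| "run_weight z (x # L) es = strand_weight z (set (x # L)) x es * run_weight z L es"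

lemma idx_eq_card:
  assumes "distinct ys" "\<And>p. p < length ys \<Longrightarrow> \<sigma> (ys ! p) = Suc p" "U \<subseteq> set ys" "x \<in> set ys"
  shows "idx U ys x = Suc (card {y \<in> U. \<sigma> y < (\<sigma> x :: nat)})"
proof -
  obtain p where p: "p < length ys" "ys ! p = x" using assms(4) by (auto simp: in_set_conv_nth)
  have tw: "takeWhile (\<lambda>y. y \<noteq> x) ys = take p ys"
    using p assms(1) by (intro takeWhile_eq_take_P_nth) (auto simp: nth_eq_iff_index_eq)
  have "set (filter (\<lambda>y. y \<in> U) (take p ys)) = {y \<in> U. \<sigma> y < \<sigma> x}"
  proof -
    have "y \<in> set (take p ys) \<longleftrightarrow> \<sigma> y < \<sigma> x" if yy: "y \<in> set ys" for y
    proof -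
      obtain q where q: "q < length ys" "ys ! q = y" using yy by (auto simp: in_set_conv_nth)
      have "y \<in> set (take p ys) \<longleftrightarrow> q < p"
        using p q assms(1) by (auto simp: in_set_conv_nth nth_eq_iff_index_eq)
      then show ?thesis using assms(2) p q by auto
    qed
    then show ?thesis using assms(3) by auto
  qed
  then have "length (filter (\<lambda>y. y \<in> U) (take p ys)) = card {y \<in> U. \<sigma> y < \<sigma> x}"
    using distinct_card[of "filter (\<lambda>y. y \<in> U) (take p ys)"] assms(1) by simp
  then show ?thesis by (simp add: idx_def tw)
qed

context homfly_eval
begin

text \<open>Here \<open>l\<close> is the untravelled part of the current cycle, \<open>B\<close> the
  label where that cycle began, and \<open>css\<close> the later cycles. A strand followed by
  another one of its cycle destabilises; the last strand of a cycle splits off, except at the very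
  end of the journey. This yields the two exponents.\<close>

lemma E_run:
  assumes xs: "xs = [1..<Suc m]" and w: "braid_word m (map snd w)"
    and \<sigma>: "\<And>p. p < m \<Longrightarrow> \<sigma> (top_config S xs w ! p) = Suc p"
    and "path_to \<sigma> B l" "\<forall>v\<in>set (tl l @ concat css). v < B" "max_led \<sigma> css"
    "distinct (l @ concat css)" "set (l @ concat css) \<subseteq> {1..m}"
  defines "d \<equiv> (a - 1 / a) / z"
  shows "E S (length (l @ concat css)) (idx (set (l @ concat css)) xs (hd l)) []
        (restrict_word (set (l @ concat css)) S xs w)
      = run_weight z (l @ concat css) (smoothing_data S xs w) * inverse a ^ (length (l @ concat css) - Suc (length css)) * d ^ length css"
  using assms(4-8)
proof (induction "l @ concat css" arbitrary: l css B)
  case Nil then show ?case by simp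
next
  case (Cons x L l css B)
  then obtain l' where l: "l = x # l'" by (cases l) auto
  have L: "L = l' @ concat css" using Cons.hyps(2) l by simp
  let ?U = "set (x # L)" and ?M = "Suc (length L)"
  note pre = Cons.prems[unfolded l, simplified]
  have U: "?U \<subseteq> {1..m}" "distinct (x # L)" using Cons.prems(4,5) Cons.hyps(2) by auto
  have setxs: "set xs = {1..m}" "distinct xs" "length xs = m" using xs by auto
  note fp = top_config_props[of xs w S, unfolded setxs, OF w]
  have fl: "length (top_config S xs w) = m" "set (top_config S xs w) = {1..m}" "distinct (top_config S xs w)"
    using fp setxs by auto
  have ix: "idx V (top_config S xs w) y = Suc (card {v \<in> V. \<sigma> v < \<sigma> y})" if "V \<subseteq> {1..m}" "y \<in> {1..m}" for V y
    using that \<sigma> fl by (intro idx_eq_card) auto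
  have ix0: "idx V xs y = Suc (card {v \<in> V. v < y})" if "V \<subseteq> {1..m}" "y \<in> {1..m}" for V y
  proof -
    have "xs ! p = Suc p" if "p < m" for p using that by (simp add: xs del: upt_Suc)
    then show ?thesis using that setxs idx_eq_card[of xs id V y] by simp
  qed
  have inj: "inj_on \<sigma> {1..m}"
  proof (rule inj_onI)
    fix u v assume "u \<in> {1..m}" "v \<in> {1..m}" "\<sigma> u = \<sigma> v"
    moreover from this obtain p q where "p < m" "q < m" "top_config S xs w ! p = u" "top_config S xs w ! q = v"
      unfolding fl(2)[symmetric] using fl(1) by (metis in_set_conv_nth)
    ultimately show "u = v" using \<sigma> by auto
  qed
  \<comment> \<open>The upper ends of the remaining strands lie under the labels in \<open>L\<close>
    and, additionally, under \<open>B\<close>: the strand starting at \<open>B\<close> or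
    \<open>x\<close> itself accounts for the one bottom end in excess. As \<open>B\<close> exceeds
    all of \<open>L\<close>, an upper end at \<open>B\<close> is the rightmost.\<close>
  have "\<sigma> ` ?U = \<sigma> ` set l \<union> \<sigma> ` set (concat css)" by (auto simp: L l)
  also have "\<dots> = insert B (set L)"
    using path_to_image[OF Cons.prems(1)] max_led_image[OF Cons.prems(3)] by (simp add: l L)
  finally have im: "\<sigma> ` ?U = insert B (set L)" .
  have lt: "v < B" if "v \<in> set L" for v using Cons.prems(2) that by (auto simp: l L)
  have "E S ?M (idx ?U xs x) [] (restrict_word ?U S xs w)
      = strand_weight z ?U x (smoothing_data S xs w) * E S ?M (idx ?U (top_config S xs w) x) (restrict_word (?U - {x}) S xs w) []"
    using E_sweep[of xs w x ?U S ?M "[]"] setxs U w by auto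
  also have "?U - {x} = set L" using U by auto
  finally have sweep: "E S ?M (idx ?U xs x) [] (restrict_word ?U S xs w)
      = strand_weight z ?U x (smoothing_data S xs w) * E S ?M (idx ?U (top_config S xs w) x) (restrict_word (set L) S xs w) []" .
  have goalL: "l @ concat css = x # L" using L l by simp
  have hdl: "hd l = x" by (simp add: l)
  have ixx: "idx ?U (top_config S xs w) x = Suc (card {v \<in> ?U. \<sigma> v < \<sigma> x})" using ix[of ?U x] U by auto
  have cardL: "card (set L) = length L" using U distinct_card by auto
  show ?case
  proof (cases l')
    case Nil
    have sx: "\<sigma> x = B" using Cons.prems(1) by (simp add: l Nil)
    show ?thesis
    proof (cases css)
      case (Cons c css')
      have L': "L = c @ concat css'" using L Nil Cons by simp
      have c: "c \<noteq> []" and mx: "path_to \<sigma> (hd c) c" "\<forall>v\<in>set (tl c @ concat css'). v < hd c" "max_led \<sigma> css'"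
        using \<open>max_led \<sigma> css\<close> by (auto simp: Cons)
      have IH: "E S (length L) (idx (set L) xs (hd c)) [] (restrict_word (set L) S xs w)
          = run_weight z L (smoothing_data S xs w) * inverse a ^ (length L - Suc (length css')) * d ^ length css'"
        using Cons.hyps(1)[OF L' mx] U unfolding L'[symmetric] by auto
      \<comment> \<open>The cycle closes: \<open>x\<close> ends at \<open>B\<close>, to the right of
        every other strand, so its position is the number of strands and \<open>E\<close> takes its
        splitting branch.\<close>
      have "v \<in> set L" if "v \<in> ?U" "\<sigma> v < B" for v using that sx by auto
      moreover have "\<sigma> v < B" if "v \<in> set L" for v
      proof -
        have "\<sigma> v \<in> insert B (set L)" using im that by auto
        moreover have "\<sigma> v \<noteq> \<sigma> x" using inj_onD[OF inj, of v x] U that by auto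
        ultimately show ?thesis using lt sx by auto
      qed
      ultimately have "{v \<in> ?U. \<sigma> v < \<sigma> x} = set L" using sx by auto
      then have M: "idx ?U (top_config S xs w) x = ?M" using ixx cardL by simp
      have hc: "hd c \<in> set L" using c L' by auto
      have "{v \<in> set L. v < hd c} = set L - {hd c}"
        using mx(2) L' c by (cases c) auto
      moreover have "hd c \<in> {1..m}" "set L \<subseteq> {1..m}" "0 < length L" using hc U by auto
      ultimately have "idx (set L) xs (hd c) = length L"
        using ix0[of "set L" "hd c"] cardL card_Diff_singleton[OF hc] by simp
      with IH have "E S (length L) (length L) [] (restrict_word (set L) S xs w)
          = run_weight z L (smoothing_data S xs w) * inverse a ^ (length L - Suc (length css')) * d ^ length css'" by simp
      moreover have "length L > 0" using hc by auto
      ultimately show ?thesis unfolding goalL hdl using sweep M Cons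
        by (simp add: d_def mult_ac)
    next
      case Nil2: Nil
      then have "L = []" using L Nil by simp
      then show ?thesis unfolding goalL hdl using sweep Nil2 by simp
    qed
  next
    case (Cons y l'')
    have sx: "\<sigma> x = y" and ch: "path_to \<sigma> B l'" using \<open>path_to \<sigma> B l\<close> by (simp_all add: l Cons)
    have yL: "y \<in> set L" using L Cons by simp
    have IH: "E S (length L) (idx (set L) xs y) [] (restrict_word (set L) S xs w)
          = run_weight z L (smoothing_data S xs w) * inverse a ^ (length L - Suc (length css)) * d ^ length css"
      using Cons.hyps(1)[OF L ch] Cons.prems U unfolding L[symmetric] by (auto simp: l Cons L)
    \<comment> \<open>The cycle continues at \<open>y\<close>. Strands ending left of
      \<open>x\<close> correspond under \<sigma> to the labels of \<open>L\<close> below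
      \<open>y\<close>, so the position reached at the top is the starting position of
      \<open>y\<close> among the strands left.\<close>
    have "\<sigma> ` {v \<in> ?U. \<sigma> v < y} = {v \<in> \<sigma> ` ?U. v < y}" by auto
    also have "\<dots> = {v \<in> set L. v < y}" using lt[OF yL] unfolding im by auto
    finally have im2: "\<sigma> ` {v \<in> ?U. \<sigma> v < y} = {v \<in> set L. v < y}" .
    have sub: "{v \<in> ?U. \<sigma> v < y} \<subseteq> {1..m}" using U by blast
    have "card {v \<in> set L. v < y} = card {v \<in> ?U. \<sigma> v < y}"
      using card_image[OF inj_on_subset[OF inj sub]] unfolding im2 .
    then have i1: "idx ?U (top_config S xs w) x = idx (set L) xs y"
      using ixx sx ix0[of "set L" y] yL U by auto
    have "card {v \<in> set L. v < y} < card (set L)"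
      using yL by (intro psubset_card_mono) auto
    then have i2: "idx (set L) xs y \<noteq> ?M" using ix0[of "set L" y] yL U cardL by auto
    \<comment> \<open>Keeps the natural subtraction in the exponent of \<open>inverse a\<close>
      honest: the list \<open>l'\<close> and every later cycle contain at least one strand.\<close>
    have ge: "Suc (length css) \<le> length L"
    proof -
      have "length css \<le> length (concat css)" if "max_led \<sigma> css" for css
        using that by (induction \<sigma> css rule: max_led.induct) (auto simp: Suc_le_eq elim: path_to.elims)
      from this[OF \<open>max_led \<sigma> css\<close>] show ?thesis using L Cons by simp
    qed
    then have "inverse a ^ (Suc (length L) - Suc (length css)) = inverse a * inverse a ^ (length L - Suc (length css))"
      by (simp add: Suc_diff_Suc flip: power_Suc)
    then show ?thesis unfolding goalL hdl using sweep i1 i2 IH ge yL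
      by (auto simp: mult_ac)
  qed
qed

end

fun tag :: "nat \<Rightarrow> letter list \<Rightarrow> (nat \<times> letter) list" where
  "tag t [] = []"
| "tag t (l # w) = (t, l) # tag (Suc t) w"

lemma tag_props: "map snd (tag t w) = w" "fst ` set (tag t w) = {t..<t + length w}"
  "distinct (map fst (tag t w))"
  by (induction t w rule: tag.induct) auto

text \<open>Position at the top of the strand starting at position \<open>p\<close> once the crossings in \<open>S\<close>
  have been smoothed.\<close>
fun strand_end :: "nat set \<Rightarrow> nat \<Rightarrow> letter list \<Rightarrow> nat \<Rightarrow> nat" where
  "strand_end S t [] p = p"
| "strand_end S t ((i, b) # w) p = strand_end S (Suc t) w (if t \<in> S then p else swp i p)"

lemma swp_permutes: "1 \<le> i \<Longrightarrow> i < m \<Longrightarrow> swp i permutes {1..m}"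
proof -
  assume "1 \<le> i" "i < m"
  moreover have "swp i = Transposition.transpose i (Suc i)" by (auto simp: swp_def fun_eq_iff Transposition.transpose_def)
  ultimately show ?thesis by (auto intro: permutes_swap_id)
qed

lemma strand_end_permutes: "braid_word m w \<Longrightarrow> strand_end S t w permutes {1..m}"
proof (induction w arbitrary: t)
  case Nil
  have "strand_end S t [] = id" by auto
  then show ?case by (simp only: permutes_id)
next
  case (Cons l w)
  obtain i b where l: "l = (i, b)" by force
  have e: "strand_end S t (l # w) = strand_end S (Suc t) w \<circ> (if t \<in> S then id else swp i)" by (auto simp: l)
  show ?case unfolding e
    by (rule permutes_compose) (use Cons swp_permutes[of i m] l in \<open>auto simp: permutes_id\<close>)
qed

lemma swap_at_nth:
  assumes "1 \<le> i" "i < length xs" "1 \<le> p" "p \<le> length xs"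
  shows "swap_at i xs ! (swp i p - 1) = xs ! (p - 1)"
proof -
  define ps ss y1 y2 where d: "ps = take (i - 1) xs" "ss = drop (Suc i) xs" "y1 = xs ! (i - 1)" "y2 = xs ! i"
  have xs: "xs = ps @ y1 # y2 # ss" and swap_at: "swap_at i xs = ps @ y2 # y1 # ss"
    using split_at[OF assms(1,2)] by (simp_all add: d swap_at_def)
  have i: "i = Suc (length ps)" using assms(1,2) by (simp add: d)
  consider "p \<le> length ps" | "p = Suc (length ps)" | "p = Suc (Suc (length ps))"
    | k where "p = Suc (length ps + Suc (Suc k))" 
    using less_imp_Suc_add[of "Suc (Suc (length ps))" p] by force
  moreover obtain p' where p': "p = Suc p'" using assms(3) by (cases p) auto
  ultimately have "(ps @ y2 # y1 # ss) ! (swp i p - 1) = (ps @ y1 # y2 # ss) ! (p - 1)"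
    unfolding i by cases (auto simp: swp_def nth_append)
  then show ?thesis using xs swap_at by simp
qed

text \<open>Connects the two descriptions of a smoothed braid: following one strand upward, and
  listing all labels level by level.\<close>

lemma top_config_sp:
  assumes "braid_word (length xs) w" "1 \<le> p" "p \<le> length xs"
  shows "top_config S xs (tag t w) ! (strand_end S t w p - 1) = xs ! (p - 1)"
  using assms
proof (induction S t w p arbitrary: xs rule: strand_end.induct)
  case (2 S t i b w p)
  then have i: "1 \<le> i" "i < length xs" by auto
  let ?xs = "if t \<in> S then xs else swap_at i xs" and ?p = "if t \<in> S then p else swp i p"
  have "top_config S ?xs (tag (Suc t) w) ! (strand_end S (Suc t) w ?p - 1) = ?xs ! (?p - 1)"
    using 2 swap_at_props[OF i] i by (intro "2.IH") (auto simp: swp_def)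
  also have "\<dots> = xs ! (p - 1)" using swap_at_nth[OF i 2(3,4)] by auto
  finally show ?case by simp
qed simp

lemma restrict_word_all:
  "set xs \<subseteq> U \<Longrightarrow> braid_word (length xs) (map snd w) \<Longrightarrow> restrict_word U S xs w = w"
proof (induction U S xs w rule: restrict_word.induct)
  case (2 U S xs t i b w)
  then have i: "1 \<le> i" "i < length xs" by auto
  have "filter (\<lambda>x. x \<in> U) (take (i - 1) xs) = take (i - 1) xs"
    using 2 set_take_subset[of "i - 1" xs] by (intro filter_True) auto
  moreover have "xs ! (i - 1) \<in> U" "xs ! i \<in> U" using i 2 nth_mem by (metis less_imp_diff_less subsetD)+
  ultimately show ?case using i 2 swap_at_props[OF i] by auto
qed simp

section \<open>Orbits\<close>

definition clen :: "('a \<Rightarrow> 'a) \<Rightarrow> 'a \<Rightarrow> nat" where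
  "clen \<sigma> r = (LEAST n. 0 < n \<and> (\<sigma> ^^ n) r = r)"

text \<open>The construction of \<open>cyc\<close> for an arbitrary map; it serves the permutation
  of the closed braid, that of the smoothed braid, and \<open>next_arc\<close> on the arcs of a
  diagram.\<close>

definition orb :: "('a \<Rightarrow> 'a) \<Rightarrow> 'a \<Rightarrow> 'a list" where
  "orb \<sigma> r = map (\<lambda>j. (\<sigma> ^^ j) r) [0..<clen \<sigma> r]"

lemma cyc_eq_orb: "cyc w r = orb (bperm w) r"
  by (simp add: cyc_def orb_def clen_def cyc_len_def)

locale finite_perm =
  fixes \<sigma> :: "'a \<Rightarrow> 'a" and A :: "'a set"
  assumes bij: "bij_betw \<sigma> A A" and finA: "finite A"
begin

lemma pow_in: "r \<in> A \<Longrightarrow> (\<sigma> ^^ j) r \<in> A"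
  using bij_betwE[OF bij] by (induction j) auto

lemma pow_inj: "x \<in> A \<Longrightarrow> y \<in> A \<Longrightarrow> (\<sigma> ^^ j) x = (\<sigma> ^^ j) y \<Longrightarrow> x = y"
  using bij_betw_funpow[OF bij] by (meson bij_betw_imp_inj_on inj_onD)

text \<open>Two iterates coincide since \<open>A\<close> is finite; injectivity cancels the smaller
  exponent.\<close>

lemma clen_ex: assumes "r \<in> A" shows "\<exists>n. 0 < n \<and> (\<sigma> ^^ n) r = r"
proof -
  have "finite ((\<lambda>j. (\<sigma> ^^ j) r) ` UNIV)" by (rule finite_subset[OF _ finA]) (use pow_in assms in auto)
  then have "\<not> inj (\<lambda>j. (\<sigma> ^^ j) r)" using finite_imageD by blast
  then obtain i0 j0 where "(\<sigma> ^^ i0) r = (\<sigma> ^^ j0) r" "i0 \<noteq> j0" by (auto simp: inj_def)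
  then obtain i j where ij: "(\<sigma> ^^ i) r = (\<sigma> ^^ j) r" "i < j" by (metis nat_neq_iff)
  then have "(\<sigma> ^^ i) ((\<sigma> ^^ (j - i)) r) = (\<sigma> ^^ i) r"
    by (metis add_diff_inverse_nat comp_apply funpow_add less_imp_not_less)
  then have "(\<sigma> ^^ (j - i)) r = r"
      using pow_inj[OF pow_in[OF assms] assms] by blast
  then show ?thesis using ij by (intro exI[of _ "j - i"]) auto
qed

lemma clen: assumes "r \<in> A" shows "0 < clen \<sigma> r" "(\<sigma> ^^ clen \<sigma> r) r = r"
  using LeastI_ex[OF clen_ex[OF assms]] by (simp_all add: clen_def)

lemma clen_min: "0 < n \<Longrightarrow> (\<sigma> ^^ n) r = r \<Longrightarrow> clen \<sigma> r \<le> n"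
  unfolding clen_def by (rule Least_le) simp

lemma pow_mod: assumes "r \<in> A" shows "(\<sigma> ^^ (j mod clen \<sigma> r)) r = (\<sigma> ^^ j) r"
  by (rule funpow_mod_eq[OF clen(2)[OF assms]])

lemma set_orb: assumes "r \<in> A" shows "set (orb \<sigma> r) = range (\<lambda>j. (\<sigma> ^^ j) r)"
proof
  show "range (\<lambda>j. (\<sigma> ^^ j) r) \<subseteq> set (orb \<sigma> r)"
  proof
    fix x assume "x \<in> range (\<lambda>j. (\<sigma> ^^ j) r)"
    then obtain j where "x = (\<sigma> ^^ j) r" by auto
    then have "x = (\<sigma> ^^ (j mod clen \<sigma> r)) r" using pow_mod[OF assms] by simp
    then show "x \<in> set (orb \<sigma> r)" using clen(1)[OF assms] by (auto simp: orb_def)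
  qed
qed (auto simp: orb_def)

lemma orb_ne: "r \<in> A \<Longrightarrow> orb \<sigma> r \<noteq> []" and hd_orb: "r \<in> A \<Longrightarrow> hd (orb \<sigma> r) = r"
  using clen(1)[of r] by (auto simp: orb_def hd_map upt_conv_Cons)

lemma distinct_orb: assumes "r \<in> A" shows "distinct (orb \<sigma> r)"
proof -
  have False if "i < j" "j < clen \<sigma> r" "(\<sigma> ^^ i) r = (\<sigma> ^^ j) r" for i j
  proof -
    have "(\<sigma> ^^ i) ((\<sigma> ^^ (j - i)) r) = (\<sigma> ^^ i) r"
      using that by (metis add_diff_inverse_nat comp_apply funpow_add less_imp_not_less)
    then have "(\<sigma> ^^ (j - i)) r = r"
      using pow_inj[OF pow_in[OF assms] assms] by blast
    then have "clen \<sigma> r \<le> j - i" using that by (intro clen_min) auto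
    then show False using that by auto
  qed
  then have "inj_on (\<lambda>j. (\<sigma> ^^ j) r) {0..<clen \<sigma> r}"
    by (intro inj_onI) (metis atLeastLessThan_iff linorder_neqE_nat)
  then show ?thesis by (simp add: orb_def distinct_map)
qed

lemma orb_sym: assumes "r \<in> A" "s \<in> set (orb \<sigma> r)" shows "set (orb \<sigma> s) = set (orb \<sigma> r)"
proof -
  obtain j where j: "s = (\<sigma> ^^ j) r" using assms set_orb by auto
  have s: "s \<in> A" using j pow_in assms by auto
  have sub: "set (orb \<sigma> s') \<subseteq> set (orb \<sigma> r')" if "r' \<in> A" "s' = (\<sigma> ^^ k) r'" for r' s' k
    using set_orb[OF that(1)] set_orb[of s'] that pow_in[OF that(1), of k]
    by (auto simp flip: funpow_add[unfolded comp_def, THEN fun_cong])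
  \<comment> \<open>To return from \<open>s\<close> to \<open>r\<close>, complete the
    \<open>j\<close> steps already made to a multiple of the cycle length;
    \<open>clen \<sigma> r * Suc j\<close> is one that is at least \<open>j\<close>.\<close>
  have le: "j \<le> clen \<sigma> r * Suc j" using clen(1)[OF assms(1)] by (cases "clen \<sigma> r") auto
  have "(\<sigma> ^^ (clen \<sigma> r * Suc j - j)) s = (\<sigma> ^^ (clen \<sigma> r * Suc j - j + j)) r"
    unfolding j by (simp only: funpow_add comp_apply)
  also have "\<dots> = (\<sigma> ^^ (clen \<sigma> r * Suc j)) r" using le by (simp only: le_add_diff_inverse2)
  also have "\<dots> = r" using pow_mod[OF assms(1), of "clen \<sigma> r * Suc j"] by simp
  finally have ret: "(\<sigma> ^^ (clen \<sigma> r * Suc j - j)) s = r" .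
  show ?thesis using sub[OF assms(1) j] sub[OF s ret[symmetric]] by blast
qed

lemma orb_closed: "r \<in> A \<Longrightarrow> s \<in> set (orb \<sigma> r) \<Longrightarrow> \<sigma> s \<in> set (orb \<sigma> r)"
proof -
  assume r: "r \<in> A" and "s \<in> set (orb \<sigma> r)"
  then obtain j where "s = (\<sigma> ^^ j) r" using set_orb by auto
  then have "\<sigma> s = (\<sigma> ^^ Suc j) r" by simp
  then show ?thesis unfolding set_orb[OF r] by (rule range_eqI)
qed

lemma self_in_orb: "r \<in> A \<Longrightarrow> r \<in> set (orb \<sigma> r)"
  using hd_orb orb_ne by (metis hd_in_set)

lemma orb_subset: "r \<in> A \<Longrightarrow> set (orb \<sigma> r) \<subseteq> A"
  using set_orb pow_in by auto

end

section \<open>Cycle maxima and the order of traversal\<close>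

definition mx_reps :: "(nat \<Rightarrow> nat) \<Rightarrow> nat \<Rightarrow> nat list" where
  "mx_reps \<sigma> m = rev (sorted_list_of_set {r \<in> {1..m}. \<forall>j. (\<sigma> ^^ j) r \<le> r})"

text \<open>The order in which the traveller runs through the strands: cycles by decreasing maximum,
  each starting at its maximum.\<close>

definition ordl :: "(nat \<Rightarrow> nat) \<Rightarrow> nat \<Rightarrow> nat list" where
  "ordl \<sigma> m = concat (map (orb \<sigma>) (mx_reps \<sigma> m))"

lemma mx_reps_props:
  "set (mx_reps \<sigma> m) = {r \<in> {1..m}. \<forall>j. (\<sigma> ^^ j) r \<le> r}"
  "sorted_wrt (>) (mx_reps \<sigma> m)"
proof -
  have "finite {r \<in> {1..m}. \<forall>j. (\<sigma> ^^ j) r \<le> r}" by simp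
  then show "set (mx_reps \<sigma> m) = {r \<in> {1..m}. \<forall>j. (\<sigma> ^^ j) r \<le> r}"
    unfolding mx_reps_def set_rev by (rule set_sorted_list_of_set)
  show "sorted_wrt (>) (mx_reps \<sigma> m)"
    unfolding mx_reps_def sorted_wrt_rev by (simp add: strict_sorted_list_of_set)
qed

locale perm_upto = finite_perm \<sigma> "{1..m}" for \<sigma> :: "nat \<Rightarrow> nat" and m :: nat
begin

lemma mx_repsD: "r \<in> set (mx_reps \<sigma> m) \<Longrightarrow> r \<in> {1..m}"
    "r \<in> set (mx_reps \<sigma> m) \<Longrightarrow> v \<in> set (orb \<sigma> r) \<Longrightarrow> v \<le> r"
proof -
  assume "r \<in> set (mx_reps \<sigma> m)"
  then have *: "r \<in> {1..m} \<and> (\<forall>j. (\<sigma> ^^ j) r \<le> r)" unfolding mx_reps_props by blast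
  then show "r \<in> {1..m}" by blast
  assume "v \<in> set (orb \<sigma> r)"
  then show "v \<le> r" using * set_orb by auto
qed

lemma mx_repsI:
  assumes "r \<in> {1..m}" "\<And>v. v \<in> set (orb \<sigma> r) \<Longrightarrow> v \<le> r"
  shows "r \<in> set (mx_reps \<sigma> m)"
  using assms set_orb[OF assms(1)] unfolding mx_reps_props by blast

lemma path_to_orb:
  assumes "r \<in> {1..m}" shows "path_to \<sigma> r (orb \<sigma> r)"
proof -
  have "path_to \<sigma> ((\<sigma> ^^ n) r) (map (\<lambda>j. (\<sigma> ^^ j) r) [k..<n])" if "k < n" for k n
    using that
  proof (induction "n - k" arbitrary: k)
    case (Suc d)
    show ?case
    proof (cases "Suc k = n")
      case True then show ?thesis by (auto simp: upt_conv_Cons)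
    next
      case False
      then have "path_to \<sigma> ((\<sigma> ^^ n) r) (map (\<lambda>j. (\<sigma> ^^ j) r) [Suc k..<n])"
        using Suc by (intro Suc.hyps(1)) auto
      then show ?thesis using Suc.prems False by (simp add: upt_conv_Cons)
    qed
  qed simp
  from this[OF clen(1)[OF assms]] show ?thesis by (simp add: orb_def clen(2)[OF assms])
qed

lemma orb_disjoint:
  assumes "r \<in> set (mx_reps \<sigma> m)" "s \<in> set (mx_reps \<sigma> m)" "v \<in> set (orb \<sigma> r)" "v \<in> set (orb \<sigma> s)"
  shows "r = s"
proof -
  have "set (orb \<sigma> r) = set (orb \<sigma> s)"
    using orb_sym[OF mx_repsD(1)[OF assms(1)] assms(3)] orb_sym[OF mx_repsD(1)[OF assms(2)] assms(4)] by simp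
  then have "r \<in> set (orb \<sigma> s)" "s \<in> set (orb \<sigma> r)"
    using self_in_orb mx_repsD(1) assms(1,2) by blast+
  then show ?thesis using mx_repsD(2) assms(1,2) by (meson le_antisym)
qed

lemma max_led_orbs:
  assumes "sorted_wrt (>) js" "set js \<subseteq> set (mx_reps \<sigma> m)"
  shows "max_led \<sigma> (map (orb \<sigma>) js) \<and> distinct (concat (map (orb \<sigma>) js))"
  using assms
proof (induction js)
  case (Cons r js)
  have r: "r \<in> set (mx_reps \<sigma> m)" and r': "r \<in> {1..m}" using Cons.prems mx_repsD(1) by auto
  have hd: "orb \<sigma> r \<noteq> []" "hd (orb \<sigma> r) = r" "distinct (orb \<sigma> r)"
    using orb_ne hd_orb distinct_orb r' by auto
  have lt: "v < r" if vv: "v \<in> set (tl (orb \<sigma> r) @ concat (map (orb \<sigma>) js))" for v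
  proof (cases "v \<in> set (tl (orb \<sigma> r))")
    case True
    then have "v \<in> set (orb \<sigma> r)" "v \<noteq> r" using hd by (cases "orb \<sigma> r"; auto)+
    then show ?thesis using mx_repsD(2)[OF r] by (meson le_neq_implies_less)
  next
    case False
    then obtain s where s: "s \<in> set js" "v \<in> set (orb \<sigma> s)" using vv by auto
    then have "v \<le> s" "s < r" using mx_repsD(2) Cons.prems by auto
    then show ?thesis by simp
  qed
  have "set (orb \<sigma> r) \<inter> set (concat (map (orb \<sigma>) js)) = {}"
    using orb_disjoint[OF r] Cons.prems by fastforce
  then show ?case using Cons lt hd path_to_orb[OF r'] by auto
qed simp

lemma ordl_props: "distinct (ordl \<sigma> m)" "set (ordl \<sigma> m) = {1..m}" "max_led \<sigma> (map (orb \<sigma>) (mx_reps \<sigma> m))"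
proof -
  show "distinct (ordl \<sigma> m)" "max_led \<sigma> (map (orb \<sigma>) (mx_reps \<sigma> m))"
    using max_led_orbs[OF mx_reps_props(2)] by (auto simp: ordl_def)
  have "x \<in> set (ordl \<sigma> m)" if x: "x \<in> {1..m}" for x
  proof -
    let ?r = "Max (set (orb \<sigma> x))"
    have r: "?r \<in> set (orb \<sigma> x)" using orb_ne[OF x] by (intro Max_in) auto
    then have r': "?r \<in> {1..m}" using orb_subset[OF x] by blast
    have e: "set (orb \<sigma> ?r) = set (orb \<sigma> x)" by (rule orb_sym[OF x r])
    then have "?r \<in> set (mx_reps \<sigma> m)" by (intro mx_repsI r') simp
    moreover have "x \<in> set (orb \<sigma> ?r)" using e self_in_orb[OF x] by simp
    ultimately show ?thesis by (auto simp: ordl_def)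
  qed
  moreover have "set (ordl \<sigma> m) \<subseteq> {1..m}"
    unfolding ordl_def using orb_subset mx_repsD(1) by fastforce
  ultimately show "set (ordl \<sigma> m) = {1..m}" by blast
qed

lemma hd_mx_reps: assumes "1 \<le> m" shows "mx_reps \<sigma> m \<noteq> []" "hd (mx_reps \<sigma> m) = m"
proof -
  have m: "m \<in> set (mx_reps \<sigma> m)" using orb_subset[of m] assms by (intro mx_repsI) auto
  then show ne: "mx_reps \<sigma> m \<noteq> []" by auto
  then obtain r js where js: "mx_reps \<sigma> m = r # js" by (cases "mx_reps \<sigma> m") auto
  then have "r \<le> m" using mx_repsD(1)[of r] by simp
  moreover have "m = r \<or> m < r" using m mx_reps_props(2)[of \<sigma> m] by (auto simp: js)
  moreover have "hd (mx_reps \<sigma> m) = r" by (simp add: js)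
  ultimately show "hd (mx_reps \<sigma> m) = m" by linarith
qed

end

lemma perm_upto_sp: assumes "braid_word m w" shows "perm_upto (strand_end S t w) m"
  unfolding perm_upto_def finite_perm_def using permutes_imp_bij[OF strand_end_permutes[OF assms]] by simp

section \<open>The weight of a set of smoothed crossings\<close>

fun precedes :: "'a list \<Rightarrow> 'a \<Rightarrow> 'a \<Rightarrow> bool" where
  "precedes [] u v = False"
| "precedes (x # L) u v = (x = u \<or> x \<noteq> v \<and> precedes L u v)"

lemma strand_weight_append: "strand_weight z U x (es @ fs) = strand_weight z U x es * strand_weight z U x fs"
  by (simp add: strand_weight_def)

lemma run_weight_append: "run_weight z L (es @ fs) = run_weight z L es * run_weight z L fs"
  by (induction L) (simp_all add: strand_weight_append)

text \<open>The first visited of the two strands decides: it contributes plus or minus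
  \<open>z\<close> if it arrives from below and 0 otherwise. Afterwards it is deleted, and the
  second strand contributes 1.\<close>

lemma run_weight_single:
  assumes "distinct L" "u \<noteq> v"
  shows "run_weight z L [(b, u, v)] = (if u \<in> set L \<and> v \<in> set L then if precedes L u v then if b then z else - z else 0 else 1)"
  using assms by (induction L) (auto simp: strand_weight_Cons)

lemma run_weight_eq:
  assumes "distinct L" "\<And>b u v. (b, u, v) \<in> set es \<Longrightarrow> u \<noteq> v \<and> u \<in> set L \<and> v \<in> set L"
  shows "run_weight z L es = (if \<forall>(b, u, v)\<in>set es. precedes L u v then \<Prod>e\<leftarrow>es. if fst e then z else - z else 0)"
  using assms(2)
proof (induction es)
  case Nil
  show ?case by (induction L) auto
next
  case (Cons e es)
  obtain b u v where e: "e = (b, u, v)" by (metis surj_pair)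
  have "run_weight z L (e # es) = run_weight z L [(b, u, v)] * run_weight z L es" using run_weight_append[of z L "[e]" es] e by simp
  also have "run_weight z L [(b, u, v)] = (if precedes L u v then if b then z else - z else 0)"
    using run_weight_single[OF assms(1), of u v] Cons.prems[of b u v] e by simp
  also have IH: "run_weight z L es = (if \<forall>(b, u, v)\<in>set es. precedes L u v then \<Prod>e\<leftarrow>es. if fst e then z else - z else 0)"
    by (rule Cons.IH, rule Cons.prems, rule list.set_intros(2))
  finally show ?case by (simp add: e)
qed

lemma smoothing_data_labels:
  assumes "distinct xs" "braid_word (length xs) (map snd w)" "(b, u, v) \<in> set (smoothing_data S xs w)"
  shows "u \<noteq> v \<and> u \<in> set xs \<and> v \<in> set xs"
  using assms
proof (induction S xs w rule: smoothing_data.induct)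
  case (2 S xs t i c w)
  then have i: "1 \<le> i" "i < length xs" by auto
  let ?xs = "if t \<in> S then xs else swap_at i xs"
  have x: "xs ! i \<noteq> xs ! (i - 1)" "xs ! i \<in> set xs" "xs ! (i - 1) \<in> set xs"
    using i 2(2) by (auto simp: nth_eq_iff_index_eq)
  have p: "distinct ?xs" "length ?xs = length xs" "set ?xs = set xs" using swap_at_props[OF i] 2(2) by auto
  consider "u = xs ! i \<and> v = xs ! (i - 1) \<or> v = xs ! i \<and> u = xs ! (i - 1)" | "(b, u, v) \<in> set (smoothing_data S ?xs w)"
    using 2(4) by (auto split: if_splits)
  then show ?case
  proof cases
    case 1 then show ?thesis using x by auto
  next
    case 2
    have "u \<noteq> v \<and> u \<in> set ?xs \<and> v \<in> set ?xs"
      by (rule "2.IH"[OF p(1) _ 2]) (use "2.prems"(2) p(2) in simp)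
    then show ?thesis using p(3) by simp
  qed
qed simp

lemma smoothing_data_prod:
  "(\<Prod>e\<leftarrow>smoothing_data S xs (tag t w). if fst e then z else - z :: real)
     = (\<Prod>s<length w. if t + s \<in> S then (if snd (w ! s) then z else - z) else 1)"
proof (induction w arbitrary: t xs)
  case (Cons l w)
  obtain i b where l: "l = (i, b)" by force
  show ?case by (simp add: l Cons prod.lessThan_Suc_shift del: prod.lessThan_Suc cong: if_cong)
qed simp

text \<open>By the order of labels in \<open>smoothing_data\<close>: at each smoothed crossing the
  strand in the lower position is travelled first.\<close>

definition valid :: "nat \<Rightarrow> letter list \<Rightarrow> nat set \<Rightarrow> bool" where
  "valid m w S \<longleftrightarrow> (\<forall>(b, u, v)\<in>set (smoothing_data S [1..<Suc m] (tag 0 w)). precedes (ordl (strand_end S 0 w) m) u v)"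

definition ncyc :: "nat \<Rightarrow> letter list \<Rightarrow> nat set \<Rightarrow> nat" where
  "ncyc m w S = length (mx_reps (strand_end S 0 w) m)"

context homfly_eval
begin

theorem Q_state_sum:
  assumes m: "1 \<le> m" and w: "braid_word m w"
  shows "Q m w = (\<Sum>S | S \<subseteq> {..<length w} \<and> valid m w S.
     of_int (\<Prod>t\<in>S. gd_sign w t) * z ^ card S * inverse a ^ (m - ncyc m w S) * ((a - 1 / a) / z) ^ (ncyc m w S - 1))"
proof -
  let ?xs = "[1..<Suc m]" and ?d = "(a - 1 / a) / z"
  have len: "length ?xs = m" and setxs: "set ?xs = {1..m}" and dist: "distinct ?xs" by auto
  have nth: "?xs ! p = Suc p" if "p < m" for p using that by (simp del: upt_Suc)
  have "Q m w = (\<Sum>S\<in>Pow (fst ` set (tag 0 w)). E S m m [] (tag 0 w))"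
    using Q_state[of "[]" "tag 0 w" m m] m w by (simp add: tag_props)
  also have "\<dots> = (\<Sum>S\<in>Pow {..<length w}. E S m m [] (tag 0 w))"
    by (simp add: tag_props atLeast0LessThan)
  also have "\<dots> = (\<Sum>S\<in>Pow {..<length w}. if valid m w S then 
     of_int (\<Prod>t\<in>S. gd_sign w t) * z ^ card S * inverse a ^ (m - ncyc m w S) * ?d ^ (ncyc m w S - 1) else 0)"
  proof (intro sum.cong refl)
    fix S assume S: "S \<in> Pow {..<length w}"
    define \<sigma> where "\<sigma> = strand_end S 0 w"
    interpret perm_upto \<sigma> m unfolding \<sigma>_def by (rule perm_upto_sp[OF w])
    define es where "es = smoothing_data S ?xs (tag 0 w)"
    obtain css where css: "map (orb \<sigma>) (mx_reps \<sigma> m) = orb \<sigma> m # css" "Suc (length css) = ncyc m w S"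
      using hd_mx_reps[OF m] by (cases "mx_reps \<sigma> m") (auto simp: ncyc_def \<sigma>_def)
    have mA: "m \<in> {1..m}" using m by simp
    have L: "ordl \<sigma> m = orb \<sigma> m @ concat css" by (simp add: ordl_def css)
    have lenL: "length (ordl \<sigma> m) = m" using distinct_card[OF ordl_props(1)] ordl_props(2) by simp
    have mx: "path_to \<sigma> m (orb \<sigma> m)" "\<forall>v\<in>set (tl (orb \<sigma> m) @ concat css). v < m" "max_led \<sigma> css"
      using ordl_props(3) hd_orb[OF mA] by (auto simp: css)
    \<comment> \<open>\<open>top_config_sp\<close> finds the label of the strand at the top position
      where it ends; since the labels are distinct, this is the only position carrying it.\<close>
    have \<sigma>f: "\<sigma> (top_config S ?xs (tag 0 w) ! p) = Suc p" if "p < m" for p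
    proof -
      let ?f = "top_config S ?xs (tag 0 w)"
      have f: "length ?f = m" "set ?f = {1..m}" "distinct ?f"
        using top_config_props[of ?xs "tag 0 w" S] w len setxs dist by (simp_all add: tag_props del: upt_Suc)
      then have x: "?f ! p \<in> {1..m}" using that nth_mem by metis
      then have "?f ! (\<sigma> (?f ! p) - 1) = ?xs ! (?f ! p - 1)"
        unfolding \<sigma>_def using w len by (intro top_config_sp) (auto simp del: upt_Suc)
      also have "\<dots> = ?f ! p" using nth[of "?f ! p - 1"] x by (auto simp del: upt_Suc)
      finally have e: "?f ! (\<sigma> (?f ! p) - 1) = ?f ! p" .
      have "\<sigma> (?f ! p) \<in> {1..m}" using pow_in[OF x, of 1] by (simp del: upt_Suc)
      then obtain k where k: "\<sigma> (?f ! p) = Suc k" "k < m"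
        by (cases "\<sigma> (?f ! p)") (auto simp del: upt_Suc)
      then have "?f ! k = ?f ! p" using e by simp
      then show ?thesis using k that f nth_eq_iff_index_eq[OF f(3), of k p] by (simp del: upt_Suc)
    qed
    have "idx {1..m} ?xs m = m"
    proof -
      have "idx {1..m} ([1..<m] @ m # []) m = Suc (length (filter (\<lambda>y. y \<in> {1..m}) [1..<m]))"
        by (rule idx_append) simp
      also have "filter (\<lambda>y. y \<in> {1..m}) [1..<m] = [1..<m]" by (intro filter_True) auto
      finally show ?thesis using m by simp
    qed
    moreover have "restrict_word {1..m} S ?xs (tag 0 w) = tag 0 w"
      using w setxs len by (intro restrict_word_all) (simp_all add: tag_props del: upt_Suc)
    moreover have "E S (length (ordl \<sigma> m)) (idx (set (ordl \<sigma> m)) ?xs (hd (orb \<sigma> m))) []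
        (restrict_word (set (ordl \<sigma> m)) S ?xs (tag 0 w))
      = run_weight z (ordl \<sigma> m) es * inverse a ^ (length (ordl \<sigma> m) - Suc (length css)) * ?d ^ length css"
      unfolding L es_def
      by (rule E_run[OF refl, of m _ \<sigma>]) (use w \<sigma>f mx ordl_props L in \<open>auto simp: tag_props simp del: upt_Suc\<close>)
    ultimately have "E S m m [] (tag 0 w)
      = run_weight z (ordl \<sigma> m) es * inverse a ^ (m - ncyc m w S) * ?d ^ (ncyc m w S - 1)"
      unfolding lenL ordl_props(2) hd_orb[OF mA] css(2) using css(2)
      by (metis diff_Suc_1)
    also have "run_weight z (ordl \<sigma> m) es = (if valid m w S then \<Prod>e\<leftarrow>es. if fst e then z else - z else 0)"
      unfolding valid_def \<sigma>_def[symmetric] es_def[symmetric] 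
    proof (rule run_weight_eq[OF ordl_props(1)])
      show "u \<noteq> v \<and> u \<in> set (ordl \<sigma> m) \<and> v \<in> set (ordl \<sigma> m)" if "(b, u, v) \<in> set es" for b u v
        using smoothing_data_labels[OF dist, of "tag 0 w" b u v S] that w
        unfolding es_def len setxs ordl_props(2) by (simp add: tag_props del: upt_Suc)
    qed
    also have "(\<Prod>e\<leftarrow>es. if fst e then z else - z)
        = (\<Prod>s<length w. if s \<in> S then (if snd (w ! s) then z else - z) else 1)"
      unfolding es_def smoothing_data_prod by simp
    also have "\<dots> = (\<Prod>s\<in>S. if snd (w ! s) then z else - z)"
      using S by (intro prod.mono_neutral_cong_right) (auto)
    also have "\<dots> = (\<Prod>s\<in>S. of_int (gd_sign w s) * z)"
      by (intro prod.cong) (auto simp: gd_sign_def)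
    also have "\<dots> = of_int (\<Prod>t\<in>S. gd_sign w t) * z ^ card S"
      by (simp add: prod.distrib)
    finally show "E S m m [] (tag 0 w) = (if valid m w S then 
     of_int (\<Prod>t\<in>S. gd_sign w t) * z ^ card S * inverse a ^ (m - ncyc m w S) * ?d ^ (ncyc m w S - 1) else 0)"
      by simp
  qed
  also have "\<dots> = (\<Sum>S | S \<subseteq> {..<length w} \<and> valid m w S.
     of_int (\<Prod>t\<in>S. gd_sign w t) * z ^ card S * inverse a ^ (m - ncyc m w S) * ?d ^ (ncyc m w S - 1))"
    by (intro sum.mono_neutral_cong_right) auto
  finally show ?thesis .
qed

end

section \<open>Sub-diagrams and homomorphisms\<close>

lemma concat_nth_disjoint:
  "distinct (concat D) \<Longrightarrow> c < length D \<Longrightarrow> c' < length D \<Longrightarrow> e \<in> set (D ! c) \<Longrightarrow> e \<in> set (D ! c') \<Longrightarrow> c = c'"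
proof (induction D arbitrary: c c')
  case (Cons x D)
  show ?case
  proof (cases c; cases c')
    fix d d' assume "c = Suc d" "c' = Suc d'"
    with Cons.prems Cons.IH[of d d'] show ?thesis by simp
  next
    fix d assume "c = 0" "c' = Suc d"
    with Cons.prems have "e \<in> set x" "e \<in> set (concat D)" by (auto intro: nth_mem)
    with Cons.prems(1) show ?thesis by auto
  next
    fix d assume "c = Suc d" "c' = 0"
    with Cons.prems have "e \<in> set x" "e \<in> set (concat D)" by (auto intro: nth_mem)
    with Cons.prems(1) show ?thesis by auto
  qed simp
qed simp

lemma distinct_concat_nth: "distinct (concat D) \<Longrightarrow> c < length D \<Longrightarrow> distinct (D ! c)"
  by (induction D arbitrary: c) (auto simp: nth_Cons split: nat.splits)

lemma concat_nth_inj: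
  assumes "distinct (concat D)" "c < length D" "c' < length D" "p < length (D ! c)" "p' < length (D ! c')"
    "D ! c ! p = D ! c' ! p'"
  shows "c = c' \<and> p = p'"
proof -
  have "c = c'" using assms concat_nth_disjoint[of D c c' "D ! c ! p"] by (metis nth_mem)
  then show ?thesis using assms distinct_concat_nth[of D c] by (auto simp: nth_eq_iff_index_eq)
qed

lemma loc_nth:
  assumes "distinct (concat D)" "c < length D" "p < length (D ! c)"
  shows "loc D (D ! c ! p) = (c, p)"
  unfolding loc_def
proof (rule some_equality)
  show "fst (c, p) < length D \<and> snd (c, p) < length (D ! fst (c, p)) \<and> D ! fst (c, p) ! snd (c, p) = D ! c ! p"
    using assms by simp
  show "x = (c, p)" if "fst x < length D \<and> snd x < length (D ! fst x) \<and> D ! fst x ! snd x = D ! c ! p" for x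
    using concat_nth_inj[of D "fst x" c "snd x" p] assms that by (cases x) auto
qed

lemma arcs_iff: "(c, p) \<in> arcs D \<longleftrightarrow> c < length D \<and> (if D ! c = [] then p = 0 else p < length (D ! c))"
  by (simp add: arcs_def)

lemma in_concat_nth: "e \<in> set (concat D) \<longleftrightarrow> (\<exists>c p. c < length D \<and> p < length (D ! c) \<and> e = D ! c ! p)"
  by (auto simp: in_set_conv_nth) (metis in_set_conv_nth)+

lemma loc_arcs:
  assumes "distinct (concat D)" "e \<in> set (concat D)"
  shows "loc D e \<in> arcs D" "D ! fst (loc D e) \<noteq> []" "D ! fst (loc D e) ! snd (loc D e) = e"
proof -
  obtain c p where "c < length D" "p < length (D ! c)" "e = D ! c ! p"
    using assms(2) unfolding in_concat_nth by blast
  then show "loc D e \<in> arcs D" "D ! fst (loc D e) \<noteq> []" "D ! fst (loc D e) ! snd (loc D e) = e"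
    using loc_nth[OF assms(1)] by (auto simp: arcs_iff)
qed

lemma endp_in: "x \<in> arcs D \<Longrightarrow> D ! fst x \<noteq> [] \<Longrightarrow> endp D x \<in> set (concat D)"
proof -
  assume x: "x \<in> arcs D" "D ! fst x \<noteq> []"
  obtain c p where cp: "x = (c, p)" by force
  have "Suc p mod length (D ! c) < length (D ! c)" using x by (simp add: cp)
  then show ?thesis using x unfolding in_concat_nth cp arcs_iff endp_def Let_def fst_conv snd_conv by blast
qed

lemma Suc_mod_inj: "p < L \<Longrightarrow> q < L \<Longrightarrow> Suc p mod L = Suc q mod L \<Longrightarrow> p = q"
  by (auto simp: mod_Suc split: if_splits)

lemma endp_inj:
  assumes "distinct (concat D)" "x \<in> arcs D" "y \<in> arcs D" "D ! fst x \<noteq> []" "D ! fst y \<noteq> []" "endp D x = endp D y"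
  shows "x = y"
proof -
  obtain c p d q where xy: "x = (c, p)" "y = (d, q)" by force
  have "c = d \<and> Suc p mod length (D ! c) = Suc q mod length (D ! d)"
    using assms by (intro concat_nth_inj[OF assms(1)]) (auto simp: xy arcs_iff endp_def Let_def)
  then show ?thesis using assms Suc_mod_inj by (auto simp: xy arcs_iff)
qed

text \<open>Weaker than \<open>arrow_diagram\<close>: the arrow names need not be an initial
  segment, so sub-diagrams of a Gauss diagram are included.\<close>

definition wfd :: "adiag \<Rightarrow> bool" where
  "wfd D \<longleftrightarrow> distinct (concat D) \<and> (\<forall>e\<in>set (concat D). (fst e, \<not> snd e) \<in> set (concat D))"

lemma finite_arcs: "finite (arcs D)"
proof -
  have "arcs D \<subseteq> (SIGMA c:{..<length D}. {..<Suc (length (D ! c))})"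
    by (auto simp: arcs_def)
  then show ?thesis by (rule finite_subset) auto
qed

text \<open>An arc on a nonempty circle is determined by its end, and passing to the other end of
  the arrow and then to the arc starting there is injective too; empty circles are fixed. Boundary
  components thus become orbits of a permutation.\<close>

lemma next_arc_perm: assumes "wfd D" shows "finite_perm (next_arc D) (arcs D)"
proof
  have d: "distinct (concat D)" using assms by (simp add: wfd_def)
  have fl: "(fst e, \<not> snd e) \<in> set (concat D)" if "e \<in> set (concat D)" for e
    using assms that unfolding wfd_def by blast
  have next_loc: "next_arc D x \<in> arcs D" if "x \<in> arcs D" for x
    using that loc_arcs[OF d fl[OF endp_in]] by (auto simp: next_arc_def)
  have "inj_on (next_arc D) (arcs D)"
  proof (rule inj_onI)
    fix x y assume xy: "x \<in> arcs D" "y \<in> arcs D" "next_arc D x = next_arc D y"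
    have ne: "D ! fst (next_arc D x) = [] \<longleftrightarrow> D ! fst x = []" if "x \<in> arcs D" for x
      using that loc_arcs[OF d fl[OF endp_in]] by (auto simp: next_arc_def)
    show "x = y"
    proof (cases "D ! fst x = []")
      case True
      then have "D ! fst y = []" using ne xy by metis
      with True xy show ?thesis by (simp add: next_arc_def)
    next
      case False
      then have F: "D ! fst y \<noteq> []" using ne xy by metis
      let ?f = "\<lambda>x. (fst (endp D x), \<not> snd (endp D x))"
      have "loc D (?f x) = loc D (?f y)" using xy False F by (simp add: next_arc_def)
      then have "?f x = ?f y"
        using loc_arcs(3)[OF d fl[OF endp_in[OF xy(1) False]]] loc_arcs(3)[OF d fl[OF endp_in[OF xy(2) F]]] by metis
      then have "endp D x = endp D y" by (auto simp: prod_eq_iff)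
      then show ?thesis using endp_inj[OF d xy(1,2) False F] by simp
    qed
  qed
  then show "bij_betw (next_arc D) (arcs D) (arcs D)"
    using next_loc finite_arcs by (metis bij_betw_def endo_inj_surj image_subsetI)
qed (rule finite_arcs)

lemma bcomp_orb: assumes "wfd D" "x \<in> arcs D"
  shows "bcomp D x = set (orb (next_arc D) x)" "trav D x = orb (next_arc D) x"
proof -
  interpret finite_perm "next_arc D" "arcs D" by (rule next_arc_perm[OF assms(1)])
  show b: "bcomp D x = set (orb (next_arc D) x)"
    unfolding set_orb[OF assms(2)] bcomp_def by auto
  have "card (bcomp D x) = clen (next_arc D) x"
    using distinct_card[OF distinct_orb[OF assms(2)]] by (simp add: b) (simp add: orb_def)
  then show "trav D x = orb (next_arc D) x" by (simp add: trav_def orb_def)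
qed

definition Sub :: "nat set \<Rightarrow> adiag \<Rightarrow> adiag" where
  "Sub S D = map (filter (\<lambda>e. fst e \<in> S)) D"

text \<open>The arc of \<open>Sub S D\<close> that contains a given arc of \<open>D\<close>.\<close>
definition coarse :: "nat set \<Rightarrow> adiag \<Rightarrow> arc \<Rightarrow> arc" where
  "coarse S D y = (let L = length (filter (\<lambda>e. fst e \<in> S) (D ! fst y)) in
     (fst y, if L = 0 then 0
             else (length (filter (\<lambda>e. fst e \<in> S) (take (Suc (snd y)) (D ! fst y))) + L - 1) mod L))"

definition diso :: "adiag \<Rightarrow> adiag \<Rightarrow> (nat \<Rightarrow> nat) \<Rightarrow> (nat \<Rightarrow> nat) \<Rightarrow> bool" where
  "diso D D' \<pi> \<alpha> \<longleftrightarrow> bij_betw \<pi> {..<length D} {..<length D'} \<and> inj_on \<alpha> (arrs D) \<and> \<alpha> ` arrs D = arrs D' \<and>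
     (\<forall>c<length D. \<exists>r. rotate r (D' ! \<pi> c) = map (amap \<alpha>) (D ! c))"

text \<open>Corresponding arcs are recognised by their final endpoints. An empty circle has a single
  arc, so there it suffices that the circles correspond.\<close>

definition arel :: "adiag \<Rightarrow> adiag \<Rightarrow> (nat \<Rightarrow> nat) \<Rightarrow> (nat \<Rightarrow> nat) \<Rightarrow> arc \<Rightarrow> arc \<Rightarrow> bool" where
  "arel D D' \<pi> \<alpha> x y \<longleftrightarrow> fst y = \<pi> (fst x) \<and> (D ! fst x = [] \<or> endp D' y = amap \<alpha> (endp D x))"

lemma Sub_concat: "concat (Sub S D) = filter (\<lambda>e. fst e \<in> S) (concat D)"
  by (simp add: Sub_def filter_concat)

lemma Sub_nth: "c < length D \<Longrightarrow> Sub S D ! c = filter (\<lambda>e. fst e \<in> S) (D ! c)"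
  and length_Sub [simp]: "length (Sub S D) = length D"
  by (simp_all add: Sub_def)

lemma arrs_Sub: "arrs (Sub S D) = S \<inter> arrs D"
  by (auto simp: arrs_def Sub_concat)

lemma wfd_Sub: "wfd D \<Longrightarrow> wfd (Sub S D)"
  by (auto simp: wfd_def Sub_concat simp del: set_concat)

lemma sidx_nth: "distinct xs \<Longrightarrow> q < length xs \<Longrightarrow> sidx xs (xs ! q) = q"
  unfolding sidx_def by (rule some_equality) (auto simp: nth_eq_iff_index_eq)

lemma count_take_mono: "i \<le> j \<Longrightarrow> length (filter P (take i xs)) \<le> length (filter P (take j xs))"
  using take_add[of i "j - i" xs] by simp

lemma filter_pos:
  assumes "distinct ys" "k < length (filter P ys)"
  defines "q \<equiv> sidx ys (filter P ys ! k)"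
  shows "q < length ys" "ys ! q = filter P ys ! k"
    "\<And>j. j \<le> length ys \<Longrightarrow> q < j \<longleftrightarrow> k < length (filter P (take j ys))"
proof -
  have "filter P ys ! k \<in> set (filter P ys)" using assms(2) nth_mem by blast
  then obtain q' where q': "q' < length ys" "ys ! q' = filter P ys ! k" "P (ys ! q')"
    unfolding set_filter mem_Collect_eq in_set_conv_nth by metis
  have q: "q = q'" using sidx_nth[OF assms(1) q'(1)] q'(2) by (simp add: q_def)
  show "q < length ys" "ys ! q = filter P ys ! k" using q q' by auto
  define c where "c = length (filter P (take q ys))"
  have ys: "ys = take q ys @ ys ! q # drop (Suc q) ys" using id_take_nth_drop q q' by metis
  have f: "filter P ys = filter P (take q ys) @ ys ! q # filter P (drop (Suc q) ys)"
    by (subst ys) (use q q' in simp)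
  then have "filter P ys ! c = ys ! q" "c < length (filter P ys)" by (simp_all add: c_def nth_append)
  then have ck: "c = k" using assms(1,2) q q' nth_eq_iff_index_eq[of "filter P ys" c k] by auto
  fix j assume j: "j \<le> length ys"
  have "take (Suc q) ys = take q ys @ [ys ! q]" using q q' take_Suc_conv_app_nth by metis
  then have "length (filter P (take (Suc q) ys)) = Suc k" using q q' ck c_def by simp
  then show "q < j \<longleftrightarrow> k < length (filter P (take j ys))"
    using count_take_mono[of "Suc q" j P ys] count_take_mono[of j q P ys] ck c_def by (cases "q < j") auto
qed

text \<open>The modular inequality of \<open>inimg\<close> says that \<open>y\<close> lies in the
  cyclic interval from survivor \<open>s\<close> up to the next survivor; equivalently, the
  survivors up to and including \<open>y\<close> number s + 1 modulo \<open>L\<close>. If there is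
  only one survivor then \<open>d = 0\<close>, and the interval is the whole circle.\<close>

lemma cyclic_between:
  assumes "distinct ys" "s < length (filter P ys)" "y < length ys"
  defines "L \<equiv> length (filter P ys)" and "B \<equiv> length ys"
  defines "q1 \<equiv> sidx ys (filter P ys ! s)" and "q2 \<equiv> sidx ys (filter P ys ! (Suc s mod L))"
  defines "d \<equiv> (q2 + B - q1) mod B"
  shows "(y + B - q1) mod B < (if d = 0 then B else d)
     \<longleftrightarrow> (length (filter P (take (Suc y) ys)) + L - 1) mod L = s"
proof -
  define C where "C = length (filter P (take (Suc y) ys))"
  have CL: "C \<le> L" using count_take_mono[of "Suc y" B P ys] assms(3) by (simp add: C_def L_def B_def)
  have s2: "Suc s mod L < L" using assms(2) unfolding L_def by (intro mod_less_divisor) auto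
  note f1 = filter_pos[OF assms(1,2), folded q1_def] and f2 = filter_pos[OF assms(1) s2[unfolded L_def], folded L_def, folded q2_def]
  have y1: "q1 \<le> y \<longleftrightarrow> s < C" using f1(3)[of "Suc y"] assms(3) by (simp add: C_def less_Suc_eq_le)
  have y2: "q2 \<le> y \<longleftrightarrow> Suc s mod L < C" using f2(3)[of "Suc y"] assms(3) by (simp add: C_def less_Suc_eq_le)
  have qB: "q1 < B" "q2 < B" using f1(1) f2(1) by (simp_all add: B_def)
  have q12: "q1 < q2 \<longleftrightarrow> s < Suc s mod L"
  proof -
    have "length (filter P (take (Suc q2) ys)) = Suc (length (filter P (take q2 ys)))"
    proof -
      have "P (ys ! q2)" using f2(2) s2 nth_mem[of "Suc s mod L" "filter P ys"] by (simp add: L_def)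
      moreover have "take (Suc q2) ys = take q2 ys @ [ys ! q2]" using f2(1) take_Suc_conv_app_nth by metis
      ultimately show ?thesis by simp
    qed
    moreover have "Suc s mod L < length (filter P (take (Suc q2) ys))" using f2(3)[of "Suc q2"] f2(1) by simp
    moreover have "\<not> Suc s mod L < length (filter P (take q2 ys))" using f2(3)[of q2] f2(1) by simp
    ultimately have "length (filter P (take q2 ys)) = Suc s mod L" by simp
    then show ?thesis using f1(3)[of q2] f2(1) by simp
  qed
  have ym: "(y + B - q1) mod B = (if q1 \<le> y then y - q1 else y + B - q1)"
    using qB assms(3) by (auto simp: B_def mod_if)
  have dm: "d = (if q1 \<le> q2 then q2 - q1 else q2 + B - q1)"
    using qB by (auto simp: d_def mod_if)
  have yB: "y < B" using assms(3) by (simp add: B_def)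
  show ?thesis unfolding C_def[symmetric]
  proof (cases "Suc s < L")
    case True
    then have "q1 < q2" using q12 by simp
    then have "(y + B - q1) mod B < (if d = 0 then B else d) \<longleftrightarrow> q1 \<le> y \<and> \<not> q2 \<le> y"
      using ym dm qB yB by auto
    also have "\<dots> \<longleftrightarrow> C = Suc s" using y1 y2 True by auto
    also have "\<dots> \<longleftrightarrow> (C + L - 1) mod L = s"
      using True CL by (cases C) (auto simp: mod_if)
    finally show "(y + B - q1) mod B < (if d = 0 then B else d) \<longleftrightarrow> (C + L - 1) mod L = s" .
  next
    case False
    \<comment> \<open>The arc after the last survivor wraps around, so it also contains the places
      before the first survivor; the counts \<open>L\<close> and 0 name the same arc.\<close>
    then have L: "L = Suc s" using assms(2) by (simp add: L_def)
    show "(y + B - q1) mod B < (if d = 0 then B else d) \<longleftrightarrow> (C + L - 1) mod L = s"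
    proof (cases "s = 0")
      case True
      then have "q1 = q2" using L by (simp add: q1_def q2_def)
      then have "d = 0" using dm by simp
      then show ?thesis using L True ym yB qB by auto
    next
      case F: False
      then have n: "\<not> q1 < q2" using q12 L by simp
      have "q1 \<noteq> q2"
      proof
        assume "q1 = q2"
        then have "filter P ys ! s = filter P ys ! (Suc s mod L)" using f1(2) f2(2) by simp
        then show False using F L assms(1,2) s2 nth_eq_iff_index_eq[of "filter P ys" s 0] by (auto simp: L_def)
      qed
      then have "(y + B - q1) mod B < (if d = 0 then B else d) \<longleftrightarrow> q1 \<le> y \<or> \<not> q2 \<le> y"
        using ym dm qB yB n by auto
      also have "\<dots> \<longleftrightarrow> C = L \<or> C = 0" using y1 y2 L CL by auto
      also have "\<dots> \<longleftrightarrow> (C + L - 1) mod L = s"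
        using L CL F by (cases C) (auto simp: mod_if)
      finally show ?thesis .
    qed
  qed
qed

lemma rotate_nth_map:
  assumes "rotate r ys = map f xs" "p < length xs"
  shows "ys ! ((p + r) mod length ys) = f (xs ! p)"
proof -
  have "length ys = length xs" using arg_cong[OF assms(1), of length] by simp
  then have "rotate r ys ! p = ys ! ((r + p) mod length ys)" using assms(2) by (intro nth_rotate) simp
  then show ?thesis using assms by (simp add: add.commute)
qed

text \<open>Containment of an arc of the large diagram in an image arc becomes correspondence of
  arcs in the sub-diagram, so that only isomorphisms remain to be studied.\<close>

lemma inimg_iff:
  assumes d: "distinct (concat DB)" and iso: "diso DA (Sub S DB) \<pi> \<alpha>"
    and x: "x \<in> arcs DA" and y: "y \<in> arcs DB"
  shows "inimg DA DB \<pi> \<alpha> x y \<longleftrightarrow> arel DA (Sub S DB) \<pi> \<alpha> x (coarse S DB y)"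
proof -
  obtain c s where xc: "x = (c, s)" by force
  obtain c' p where yc: "y = (c', p)" by force
  show ?thesis
  proof (cases "c' = \<pi> c \<and> DA ! c \<noteq> []")
    case False
    then show ?thesis by (auto simp: inimg_def arel_def coarse_def Let_def xc yc)
  next
    case True
    define xs ys P where "xs = DA ! c" and "ys = DB ! \<pi> c" and P: "P = (\<lambda>e :: endpt. fst e \<in> S)"
    define L where "L = length (filter P ys)"
    have c: "c < length DA" and sx: "s < length xs" using x True by (auto simp: xc arcs_iff xs_def)
    have pc: "\<pi> c < length DB" using iso c by (auto simp: diso_def bij_betw_def)
    then have dys: "distinct ys" using distinct_concat_nth[OF d] by (simp add: ys_def)
    obtain r where r: "rotate r (filter P ys) = map (amap \<alpha>) xs"
      using iso c pc unfolding diso_def by (auto simp: Sub_nth xs_def ys_def P)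
    have L: "L = length xs" using arg_cong[OF r, of length] by (simp add: L_def)
    have L0: "0 < L" using sx L by auto
    define s' where "s' = (s + r) mod L"
    have s'L: "s' < L" using L0 by (simp add: s'_def)
    have e1: "amap \<alpha> (xs ! s) = filter P ys ! s'"
      using rotate_nth_map[OF r sx] by (simp add: s'_def L_def)
    have "amap \<alpha> (xs ! (Suc s mod L)) = filter P ys ! ((Suc s mod L + r) mod L)"
      using rotate_nth_map[OF r, of "Suc s mod L"] mod_less_divisor[OF L0, of "Suc s"] L by (simp flip: L_def)
    also have "(Suc s mod L + r) mod L = Suc s' mod L" by (simp add: s'_def mod_simps)
    finally have e2: "amap \<alpha> (xs ! (Suc s mod L)) = filter P ys ! (Suc s' mod L)" .
    have pL: "p < length ys"
    proof -
      have "ys \<noteq> []" using L0 by (auto simp: L_def)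
      then show ?thesis using y True by (auto simp: yc arcs_iff ys_def)
    qed
    define k where "k = (length (filter P (take (Suc p) ys)) + L - 1) mod L"
    have kL: "k < L" using L0 by (simp add: k_def)
    define q1 q2 where "q1 = sidx ys (filter P ys ! s')" and "q2 = sidx ys (filter P ys ! (Suc s' mod L))"
    have "inimg DA DB \<pi> \<alpha> x y \<longleftrightarrow> (p + length ys - q1) mod length ys <
       (if (q2 + length ys - q1) mod length ys = 0 then length ys else (q2 + length ys - q1) mod length ys)"
      using True e1 e2 unfolding inimg_def xc yc endp_def Let_def fst_conv snd_conv q1_def q2_def
      by (simp flip: xs_def ys_def L)
    also have "\<dots> \<longleftrightarrow> k = s'"
      using cyclic_between[OF dys s'L[unfolded L_def] pL] unfolding k_def q1_def q2_def L_def by simp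
    \<comment> \<open>Equality of arc indices is rewritten as equality of the endpoints that follow,
      the form in which \<open>arel\<close> compares arcs.\<close>
    also have "k = s' \<longleftrightarrow> filter P ys ! (Suc k mod L) = filter P ys ! (Suc s' mod L)"
    proof -
      have "Suc k mod L < length (filter P ys)" "Suc s' mod L < length (filter P ys)"
        using L0 by (simp_all flip: L_def)
      then show ?thesis
        using Suc_mod_inj[OF kL s'L] dys by (auto simp: nth_eq_iff_index_eq)
    qed
    also have "\<dots> \<longleftrightarrow> arel DA (Sub S DB) \<pi> \<alpha> x (coarse S DB y)"
    proof -
      have "coarse S DB y = (\<pi> c, k)"
        using True L0 by (simp add: coarse_def yc Let_def k_def P L_def ys_def)
      moreover have "endp (Sub S DB) (\<pi> c, k) = filter P ys ! (Suc k mod L)"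
        by (simp add: endp_def Let_def Sub_nth[OF pc] L_def ys_def P)
      moreover have "endp DA x = xs ! (Suc s mod L)" by (simp add: endp_def Let_def xc xs_def L)
      ultimately show ?thesis using True e2 by (simp add: arel_def xc)
    qed
    finally show ?thesis .
  qed
qed

text \<open>A homomorphism is an isomorphism onto the sub-diagram spanned by its image, with every
  base point read on the coarser arc containing it.\<close>

lemma hom_iff:
  assumes d: "distinct (concat DB)" and A: "set bsA \<subseteq> arcs DA" and B: "set bsB \<subseteq> arcs DB"
  shows "hom DA bsA DB bsB \<pi> \<alpha> \<longleftrightarrow> \<alpha> ` arrs DA \<subseteq> arrs DB \<and> diso DA (Sub (\<alpha> ` arrs DA) DB) \<pi> \<alpha> \<and>
    length bsA = length bsB \<and>
    (\<forall>i<length bsA. arel DA (Sub (\<alpha> ` arrs DA) DB) \<pi> \<alpha> (bsA ! i) (coarse (\<alpha> ` arrs DA) DB (bsB ! i)))"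
    (is "?l \<longleftrightarrow> ?r")
proof -
  let ?S = "\<alpha> ` arrs DA"
  have iso: "?S \<subseteq> arrs DB \<and> diso DA (Sub ?S DB) \<pi> \<alpha> \<longleftrightarrow>
     bij_betw \<pi> {..<length DA} {..<length DB} \<and> inj_on \<alpha> (arrs DA) \<and> ?S \<subseteq> arrs DB \<and>
     (\<forall>c<length DA. \<exists>r. rotate r (filter (\<lambda>e. fst e \<in> ?S) (DB ! \<pi> c)) = map (amap \<alpha>) (DA ! c))"
    (is "?a \<longleftrightarrow> ?b")
  proof -
    have "Sub ?S DB ! \<pi> c = filter (\<lambda>e. fst e \<in> ?S) (DB ! \<pi> c)"
      if "bij_betw \<pi> {..<length DA} {..<length DB}" "c < length DA" for c
      using that by (intro Sub_nth) (auto simp: bij_betw_def)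
    then have "bij_betw \<pi> {..<length DA} {..<length DB} \<Longrightarrow>
        (\<forall>c<length DA. \<exists>r. rotate r (Sub ?S DB ! \<pi> c) = map (amap \<alpha>) (DA ! c)) \<longleftrightarrow>
        (\<forall>c<length DA. \<exists>r. rotate r (filter (\<lambda>e. fst e \<in> ?S) (DB ! \<pi> c)) = map (amap \<alpha>) (DA ! c))"
      by simp
    then show ?thesis unfolding diso_def arrs_Sub length_Sub by blast
  qed
  have "inimg DA DB \<pi> \<alpha> (bsA ! i) (bsB ! i) \<longleftrightarrow>
      arel DA (Sub ?S DB) \<pi> \<alpha> (bsA ! i) (coarse ?S DB (bsB ! i))"
    if "diso DA (Sub ?S DB) \<pi> \<alpha>" "length bsA = length bsB" "i < length bsA" for i
    using that A B by (intro inimg_iff[OF d]) (auto dest: nth_mem)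
  then have X: "diso DA (Sub ?S DB) \<pi> \<alpha> \<Longrightarrow> length bsA = length bsB \<Longrightarrow>
      (\<forall>i<length bsA. inimg DA DB \<pi> \<alpha> (bsA ! i) (bsB ! i)) \<longleftrightarrow>
      (\<forall>i<length bsA. arel DA (Sub ?S DB) \<pi> \<alpha> (bsA ! i) (coarse ?S DB (bsB ! i)))"
    by simp
  have "?l \<longleftrightarrow> (?S \<subseteq> arrs DB \<and> diso DA (Sub ?S DB) \<pi> \<alpha>) \<and> length bsA = length bsB \<and>
      (\<forall>i<length bsA. inimg DA DB \<pi> \<alpha> (bsA ! i) (bsB ! i))"
    unfolding iso by (simp only: hom_def conj_assoc)
  also have "\<dots> \<longleftrightarrow> ?r" using X by (simp only: conj_assoc cong: conj_cong)
  finally show ?thesis .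
qed

lemma endp_exc:
  assumes "c < length D" "e \<in> set (D ! c)"
  obtains x where "x \<in> arcs D" "fst x = c" "endp D x = e"
proof -
  obtain p where c: "p < length (D ! c)" "e = D ! c ! p"
    using assms(2) unfolding in_set_conv_nth by blast
  let ?L = "length (D ! c)"
  let ?q = "(p + ?L - 1) mod ?L"
  have "Suc ?q mod ?L = p"
    using c(1) by (cases p) (simp_all add: mod_Suc_eq)
  moreover have "D ! c \<noteq> []" using c(1) by auto
  ultimately show thesis using c assms that[of "(c, ?q)"] by (simp add: arcs_iff endp_def Let_def)
qed

lemma in_arrs: "e \<in> set (concat D) \<Longrightarrow> fst e \<in> arrs D"
  unfolding arrs_def by (rule imageI)

lemma diso_circle: 
  assumes "diso D D' \<pi> \<alpha>" "c < length D"
  shows "\<pi> c < length D'" "set (D' ! \<pi> c) = amap \<alpha> ` set (D ! c)" "length (D' ! \<pi> c) = length (D ! c)"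
proof -
  show "\<pi> c < length D'" using assms by (auto simp: diso_def bij_betw_def)
  obtain r where r: "rotate r (D' ! \<pi> c) = map (amap \<alpha>) (D ! c)" using assms by (auto simp: diso_def)
  show "set (D' ! \<pi> c) = amap \<alpha> ` set (D ! c)" using arg_cong[OF r, of set] by simp
  show "length (D' ! \<pi> c) = length (D ! c)" using arg_cong[OF r, of length] by simp
qed

lemma set_nth_concat: "c < length D \<Longrightarrow> e \<in> set (D ! c) \<Longrightarrow> e \<in> set (concat D)"
  by (auto intro: nth_mem)

lemma endp_in_nth: "x \<in> arcs D \<Longrightarrow> D ! fst x \<noteq> [] \<Longrightarrow> endp D x \<in> set (D ! fst x) \<and> fst x < length D"
  by (cases x) (auto simp: arcs_iff endp_def Let_def)

section \<open>Isomorphisms acting on arcs and boundary components\<close>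

locale diag_iso =
  fixes D D' :: adiag and \<pi> \<alpha> :: "nat \<Rightarrow> nat"
  assumes wf: "wfd D" and wf': "wfd D'" and iso: "diso D D' \<pi> \<alpha>"
begin

lemma dist: "distinct (concat D)" "distinct (concat D')"
  using wf wf' by (auto simp: wfd_def)

lemma amap_inj: "e \<in> set (concat D) \<Longrightarrow> f \<in> set (concat D) \<Longrightarrow> amap \<alpha> e = amap \<alpha> f \<Longrightarrow> e = f"
proof (rule prod_eqI)
  assume e: "e \<in> set (concat D)" "f \<in> set (concat D)" and eq: "amap \<alpha> e = amap \<alpha> f"
  have "inj_on \<alpha> (arrs D)" using iso by (simp add: diso_def)
  moreover have "\<alpha> (fst e) = \<alpha> (fst f)" using eq by (simp add: amap_def)
  ultimately show "fst e = fst f" using in_arrs[OF e(1)] in_arrs[OF e(2)] by (rule inj_onD)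
  show "snd e = snd f" using eq by (simp add: amap_def)
qed

lemma pi_inj: "c < length D \<Longrightarrow> c' < length D \<Longrightarrow> \<pi> c = \<pi> c' \<Longrightarrow> c = c'"
  using iso by (auto simp: diso_def bij_betw_def dest: inj_onD)

lemma empty_iff: "c < length D \<Longrightarrow> D' ! \<pi> c = [] \<longleftrightarrow> D ! c = []"
  using diso_circle(3)[OF iso] by (metis length_0_conv)

lemma arel_ex1: assumes x: "x \<in> arcs D" shows "\<exists>!y. y \<in> arcs D' \<and> arel D D' \<pi> \<alpha> x y"
proof -
  obtain c p where xc: "x = (c, p)" by force
  have c: "c < length D" using x by (auto simp: xc arcs_iff)
  note pc = diso_circle[OF iso c]
  show ?thesis
  proof (cases "D ! c = []")
    case True
    then have "D' ! \<pi> c = []" using empty_iff[OF c] by simp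
    then show ?thesis using True pc(1)
      by (intro ex1I[of _ "(\<pi> c, 0)"]) (auto simp: arel_def xc arcs_iff)
  next
    case False
    then have ne: "D' ! \<pi> c \<noteq> []" using empty_iff[OF c] by simp
    have "amap \<alpha> (endp D x) \<in> set (D' ! \<pi> c)"
      using endp_in_nth[OF x] False pc(2) by (simp add: xc)
    from endp_exc[OF pc(1) this] obtain y where y: "y \<in> arcs D'" "fst y = \<pi> c" "endp D' y = amap \<alpha> (endp D x)" .
    show ?thesis
    proof (rule ex1I[of _ y])
      show "y \<in> arcs D' \<and> arel D D' \<pi> \<alpha> x y" using y by (simp add: arel_def xc)
      show "y' = y" if "y' \<in> arcs D' \<and> arel D D' \<pi> \<alpha> x y'" for y'
        using that y ne False by (intro endp_inj[OF dist(2)]) (auto simp: arel_def xc)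
    qed
  qed
qed

definition g :: "arc \<Rightarrow> arc" where
  "g x = (THE y. y \<in> arcs D' \<and> arel D D' \<pi> \<alpha> x y)"

lemma g: assumes "x \<in> arcs D" shows "g x \<in> arcs D'" "fst (g x) = \<pi> (fst x)"
    "D ! fst x \<noteq> [] \<Longrightarrow> endp D' (g x) = amap \<alpha> (endp D x)" "D' ! fst (g x) = [] \<longleftrightarrow> D ! fst x = []"
    "\<And>y. y \<in> arcs D' \<Longrightarrow> arel D D' \<pi> \<alpha> x y \<longleftrightarrow> y = g x"
proof -
  have *: "g x \<in> arcs D' \<and> arel D D' \<pi> \<alpha> x (g x)"
    unfolding g_def by (rule theI'[OF arel_ex1[OF assms]])
  then show "g x \<in> arcs D'" "fst (g x) = \<pi> (fst x)" "D ! fst x \<noteq> [] \<Longrightarrow> endp D' (g x) = amap \<alpha> (endp D x)"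
    by (auto simp: arel_def)
  then show "D' ! fst (g x) = [] \<longleftrightarrow> D ! fst x = []" using empty_iff assms by (auto simp: arcs_def)
  show "arel D D' \<pi> \<alpha> x y \<longleftrightarrow> y = g x" if "y \<in> arcs D'" for y
    using arel_ex1[OF assms] * that by blast
qed

lemma g_bij: "bij_betw g (arcs D) (arcs D')"
proof (rule bij_betw_imageI)
  show "inj_on g (arcs D)"
  proof (rule inj_onI)
    fix x y assume xy: "x \<in> arcs D" "y \<in> arcs D" "g x = g y"
    then have "\<pi> (fst x) = \<pi> (fst y)" using g(2) by metis
    then have f: "fst x = fst y" using xy pi_inj by (auto simp: arcs_def)
    show "x = y"
    proof (cases "D ! fst x = []")
      case True then show ?thesis using xy f by (auto simp: arcs_def prod_eq_iff)
    next
      case False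
      then have "amap \<alpha> (endp D x) = amap \<alpha> (endp D y)" using g(3)[OF xy(1)] g(3)[OF xy(2)] f xy(3) by simp
      then have "endp D x = endp D y" using amap_inj endp_in xy False f by simp
      then show ?thesis using endp_inj[OF dist(1) xy(1,2)] False f by simp
    qed
  qed
  show "g ` arcs D = arcs D'"
  proof
    show "g ` arcs D \<subseteq> arcs D'" using g(1) by blast
    show "arcs D' \<subseteq> g ` arcs D"
    proof
      fix y assume y: "y \<in> arcs D'"
      then have "fst y \<in> \<pi> ` {..<length D}" using iso by (auto simp: diso_def bij_betw_def arcs_def)
      then obtain c where c: "c < length D" "fst y = \<pi> c" by auto
      show "y \<in> g ` arcs D"
      proof (cases "D ! c = []")
        case True
        then have "(c, 0) \<in> arcs D" "arel D D' \<pi> \<alpha> (c, 0) y" using c by (auto simp: arcs_iff arel_def)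
        then show ?thesis using g(5) y by blast
      next
        case False
        then have "endp D' y \<in> set (D' ! \<pi> c)" using endp_in_nth[OF y] c empty_iff by auto
        then obtain e where e: "e \<in> set (D ! c)" "endp D' y = amap \<alpha> e"
          using diso_circle(2)[OF iso c(1)] by auto
        from endp_exc[OF c(1) e(1)] obtain x where "x \<in> arcs D" "fst x = c" "endp D x = e" .
        then have "x \<in> arcs D" "arel D D' \<pi> \<alpha> x y" using e c by (auto simp: arel_def)
        then show ?thesis using g(5) y by blast
      qed
    qed
  qed
qed

lemma g_loc: assumes "e \<in> set (concat D)" shows "g (loc D e) = loc D' (amap \<alpha> e)"
proof -
  obtain c p where c: "c < length D" "p < length (D ! c)" "e = D ! c ! p"
    using assms unfolding in_concat_nth by blast
  obtain r where r: "rotate r (D' ! \<pi> c) = map (amap \<alpha>) (D ! c)" using iso c by (auto simp: diso_def)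
  let ?L = "length (D ! c)" let ?q = "(p + r) mod ?L"
  note pc = diso_circle[OF iso c(1)]
  have q: "?q < length (D' ! \<pi> c)" using c(2) unfolding pc(3) by (intro mod_less_divisor) auto
  have "D' ! \<pi> c ! ?q = amap \<alpha> e" using rotate_nth_map[OF r c(2)] c(3) pc(3) by simp
  then have l: "loc D' (amap \<alpha> e) = (\<pi> c, ?q)" using loc_nth[OF dist(2) pc(1) q] by simp
  have s: "Suc p mod ?L < ?L" using c(2) by (intro mod_less_divisor) auto
  have "D' ! \<pi> c ! ((Suc p mod ?L + r) mod ?L) = amap \<alpha> (D ! c ! (Suc p mod ?L))"
    using rotate_nth_map[OF r s] pc(3) by simp
  moreover have "(Suc p mod ?L + r) mod ?L = Suc ?q mod ?L" by (simp add: mod_simps)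
  ultimately have "arel D D' \<pi> \<alpha> (c, p) (\<pi> c, ?q)"
    by (simp add: arel_def endp_def Let_def pc(3))
  moreover have "(c, p) \<in> arcs D" "(\<pi> c, ?q) \<in> arcs D'"
    using c pc(1) q by (auto simp: arcs_iff)
  ultimately have "(\<pi> c, ?q) = g (c, p)" using g(5) by blast
  then show ?thesis using l loc_nth[OF dist(1) c(1,2)] c(3) by simp
qed

text \<open>The map of arcs commutes with the boundary walk; hence it carries boundary components,
  their number and their traversals over.\<close>

lemma g_next: assumes "x \<in> arcs D" shows "g (next_arc D x) = next_arc D' (g x)"
proof (cases "D ! fst x = []")
  case True then show ?thesis using g(4)[OF assms] by (simp add: next_arc_def)
next
  case False
  have "(fst (endp D x), \<not> snd (endp D x)) \<in> set (concat D)"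
    using endp_in[OF assms False] wf unfolding wfd_def by blast
  from g_loc[OF this] show ?thesis using False g(3,4)[OF assms] by (simp add: next_arc_def amap_def)
qed

lemma next_in: "x \<in> arcs D \<Longrightarrow> (next_arc D ^^ j) x \<in> arcs D"
  by (rule finite_perm.pow_in[OF next_arc_perm[OF wf]])

lemma g_pow: "x \<in> arcs D \<Longrightarrow> g ((next_arc D ^^ j) x) = (next_arc D' ^^ j) (g x)"
  by (induction j) (simp_all add: g_next next_in)

lemma g_bcomp: "x \<in> arcs D \<Longrightarrow> bcomp D' (g x) = g ` bcomp D x"
  by (auto simp: bcomp_def g_pow[symmetric])

lemma bcomp_subset: "x \<in> arcs D \<Longrightarrow> bcomp D x \<subseteq> arcs D"
proof -
  assume "x \<in> arcs D"
  from next_in[OF this] show ?thesis unfolding bcomp_def by blast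
qed

lemma g_bcomp_eq: "x \<in> arcs D \<Longrightarrow> y \<in> arcs D \<Longrightarrow> bcomp D' (g x) = bcomp D' (g y) \<longleftrightarrow> bcomp D x = bcomp D y"
  using inj_on_image_eq_iff[OF bij_betw_imp_inj_on[OF g_bij]] bcomp_subset g_bcomp by metis

lemma g_nbcomp: "nbcomp D' = nbcomp D"
proof -
  have "bcomp D' ` arcs D' = (\<lambda>x. bcomp D' (g x)) ` arcs D"
    using bij_betw_imp_surj_on[OF g_bij] by (metis image_image)
  also have "\<dots> = (`) g ` (bcomp D ` arcs D)" using g_bcomp by (auto simp: image_image)
  finally have "nbcomp D' = card ((`) g ` (bcomp D ` arcs D))" by (simp add: nbcomp_def)
  also have "\<dots> = nbcomp D" unfolding nbcomp_def
  proof (rule card_image, rule inj_onI)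
    fix X Y assume "X \<in> bcomp D ` arcs D" "Y \<in> bcomp D ` arcs D" "g ` X = g ` Y"
    then show "X = Y" using inj_on_image_eq_iff[OF bij_betw_imp_inj_on[OF g_bij]] bcomp_subset by blast
  qed
  finally show ?thesis .
qed

lemma g_trav: assumes "x \<in> arcs D" shows "trav D' (g x) = map g (trav D x)"
proof -
  have "card (bcomp D' (g x)) = card (bcomp D x)"
    using g_bcomp[OF assms] card_image inj_on_subset[OF bij_betw_imp_inj_on[OF g_bij] bcomp_subset[OF assms]] by metis
  then show ?thesis using assms by (simp add: trav_def g_pow)
qed

lemma g_multibased: assumes "set bs \<subseteq> arcs D"
  shows "multibased k D' (map g bs) \<longleftrightarrow> multibased k D bs"
proof -
  have "bs ! i \<in> arcs D" if "i < length bs" for i using that assms nth_mem by blast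
  then have "bcomp D' (map g bs ! i) = bcomp D' (map g bs ! j) \<longleftrightarrow> bcomp D (bs ! i) = bcomp D (bs ! j)"
    if "i < length bs" "j < length bs" for i j using that g_bcomp_eq by simp
  moreover have "set (map g bs) \<subseteq> arcs D'" using g(1) assms by auto
  ultimately show ?thesis unfolding multibased_def using g_nbcomp assms by auto
qed

text \<open>The condition mentions only whether an end is a head and whether two ends belong to the
  same arrow; \<open>amap\<close> keeps the former, and injectivity of \<alpha> the latter.\<close>

lemma g_ascending: assumes "set bs \<subseteq> arcs D"
  shows "ascending D' (map g bs) \<longleftrightarrow> ascending D bs"
proof -
  define T where "T = filter (\<lambda>y. D ! fst y \<noteq> []) (concat (map (trav D) bs))"
  have tr: "set (trav D x) \<subseteq> arcs D" if "x \<in> arcs D" for x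
    using next_in[OF that] by (auto simp: trav_def)
  have sub: "set (concat (map (trav D) bs)) \<subseteq> arcs D" using tr assms by fastforce
  have "map (trav D') (map g bs) = map (map g) (map (trav D) bs)"
    using assms g_trav by (auto simp: subset_iff)
  then have cc: "concat (map (trav D') (map g bs)) = map g (concat (map (trav D) bs))"
    by (simp only: map_concat)
  have T': "filter (\<lambda>y. D' ! fst y \<noteq> []) (concat (map (trav D') (map g bs))) = map g T"
  proof -
    have "filter (\<lambda>y. D' ! fst (g y) \<noteq> []) (concat (map (trav D) bs)) = T"
      unfolding T_def using g(4) sub by (intro filter_cong) auto
    then show ?thesis unfolding cc by (simp only: filter_map o_def)
  qed
  have T: "T ! i \<in> arcs D" "D ! fst (T ! i) \<noteq> []" if "i < length T" for i
    using nth_mem[OF that] sub unfolding T_def by auto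
  have e: "endp D' (map g T ! i) = amap \<alpha> (endp D (T ! i))" if "i < length T" for i
    using g(3)[OF T[OF that]] that by simp
  have ea: "fst (endp D (T ! i)) \<in> arrs D" if "i < length T" for i
    using in_arrs[OF endp_in[OF T[OF that]]] .
  have inj: "inj_on \<alpha> (arrs D)" using iso by (simp add: diso_def)
  have fe: "fst (endp D' (map g T ! i)) = \<alpha> (fst (endp D (T ! i)))"
    "snd (endp D' (map g T ! i)) = snd (endp D (T ! i))" if "i < length T" for i
    by (simp_all only: e[OF that] amap_def fst_conv snd_conv)
  have eq: "fst (endp D' (map g T ! i)) = fst (endp D' (map g T ! j)) \<longleftrightarrow> fst (endp D (T ! i)) = fst (endp D (T ! j))"
    if "i < length T" "j < length T" for i j
    unfolding fe(1)[OF that(1)] fe(1)[OF that(2)] by (rule inj_on_eq_iff[OF inj ea[OF that(1)] ea[OF that(2)]])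
  have "(\<not> snd (endp D' (map g T ! i)) \<longrightarrow> (\<exists>j<i. fst (endp D' (map g T ! j)) = fst (endp D' (map g T ! i)))) \<longleftrightarrow>
     (\<not> snd (endp D (T ! i)) \<longrightarrow> (\<exists>j<i. fst (endp D (T ! j)) = fst (endp D (T ! i))))" if "i < length T" for i
    using eq[OF _ that] unfolding fe(2)[OF that] by (meson less_trans that)
  then have "(\<forall>i<length (map g T). \<not> snd (endp D' (map g T ! i)) \<longrightarrow>
         (\<exists>j<i. fst (endp D' (map g T ! j)) = fst (endp D' (map g T ! i)))) \<longleftrightarrow>
     (\<forall>i<length T. \<not> snd (endp D (T ! i)) \<longrightarrow> (\<exists>j<i. fst (endp D (T ! j)) = fst (endp D (T ! i))))"
    unfolding length_map by blast
  then show ?thesis unfolding ascending_def Let_def T' T_def[symmetric] .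
qed

end

definition biso :: "adiag \<Rightarrow> arc list \<Rightarrow> adiag \<Rightarrow> arc list \<Rightarrow> bool" where
  "biso D bs D' bs' \<longleftrightarrow> (\<exists>\<pi> \<alpha>. diso D D' \<pi> \<alpha> \<and> length bs = length bs' \<and>
     (\<forall>i<length bs. arel D D' \<pi> \<alpha> (bs ! i) (bs' ! i)))"

lemma amap_id [simp]: "amap id = id" "amap (\<lambda>x. x) = id"
  by (auto simp: amap_def fun_eq_iff)

lemma biso_refl: "biso D bs D bs"
  unfolding biso_def by (intro exI[of _ id] conjI) (auto simp: diso_def arel_def intro: exI[of _ 0])

lemma diso_comp:
  assumes "diso D D' \<pi> \<alpha>" "diso D' D'' \<pi>' \<alpha>'"
  shows "diso D D'' (\<pi>' \<circ> \<pi>) (\<alpha>' \<circ> \<alpha>)"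
proof -
  have "\<exists>r. rotate r (D'' ! \<pi>' (\<pi> c)) = map (amap (\<alpha>' \<circ> \<alpha>)) (D ! c)" if c: "c < length D" for c
  proof -
    obtain r where r: "rotate r (D' ! \<pi> c) = map (amap \<alpha>) (D ! c)" using assms(1) c by (auto simp: diso_def)
    obtain r' where r': "rotate r' (D'' ! \<pi>' (\<pi> c)) = map (amap \<alpha>') (D' ! \<pi> c)"
      using assms(2) diso_circle(1)[OF assms(1) c] by (auto simp: diso_def)
    have "rotate (r + r') (D'' ! \<pi>' (\<pi> c)) = rotate r (map (amap \<alpha>') (D' ! \<pi> c))"
      by (simp add: r' flip: rotate_rotate)
    also have "\<dots> = map (amap \<alpha>') (map (amap \<alpha>) (D ! c))" by (simp only: rotate_map r)
    also have "\<dots> = map (amap (\<alpha>' \<circ> \<alpha>)) (D ! c)" by (simp add: amap_def)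
    finally show ?thesis by blast
  qed
  moreover have "(\<alpha>' \<circ> \<alpha>) ` arrs D = arrs D''"
    unfolding image_comp[symmetric] using assms by (simp add: diso_def)
  moreover have "inj_on (\<alpha>' \<circ> \<alpha>) (arrs D)"
    using assms unfolding diso_def by (metis comp_inj_on)
  moreover have "bij_betw (\<pi>' \<circ> \<pi>) {..<length D} {..<length D''}"
    using assms by (auto simp: diso_def intro: bij_betw_trans)
  ultimately show ?thesis unfolding diso_def by simp
qed

lemma biso_trans:
  assumes "biso D bs D' bs'" "biso D' bs' D'' bs''" "set bs \<subseteq> arcs D"
  shows "biso D bs D'' bs''"
proof -
  obtain \<pi> \<alpha> \<pi>' \<alpha>' where 1: "diso D D' \<pi> \<alpha>" "length bs = length bs'" "\<forall>i<length bs. arel D D' \<pi> \<alpha> (bs ! i) (bs' ! i)"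
    and 2: "diso D' D'' \<pi>' \<alpha>'" "length bs' = length bs''" "\<forall>i<length bs'. arel D' D'' \<pi>' \<alpha>' (bs' ! i) (bs'' ! i)"
    using assms(1,2) unfolding biso_def by blast
  have "arel D D'' (\<pi>' \<circ> \<pi>) (\<alpha>' \<circ> \<alpha>) (bs ! i) (bs'' ! i)" if i: "i < length bs" for i
  proof -
    have "fst (bs ! i) < length D" using assms(3) nth_mem[OF i] by (auto simp: arcs_def)
    then have "D' ! \<pi> (fst (bs ! i)) = [] \<longleftrightarrow> D ! fst (bs ! i) = []"
      using diso_circle(3)[OF 1(1)] by (metis length_0_conv)
    then show ?thesis using 1(3)[rule_format, OF i] 2(3)[rule_format, of i] 1(2) i
      by (auto simp: arel_def amap_def)
  qed
  then show ?thesis unfolding biso_def using diso_comp[OF 1(1) 2(1)] 1(2) 2(2) by auto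
qed

lemma biso_sym:
  assumes "biso D bs D' bs'" "set bs \<subseteq> arcs D"
  shows "biso D' bs' D bs"
proof -
  obtain \<pi> \<alpha> where 1: "diso D D' \<pi> \<alpha>" "length bs = length bs'" "\<forall>i<length bs. arel D D' \<pi> \<alpha> (bs ! i) (bs' ! i)"
    using assms(1) unfolding biso_def by blast
  define p' where "p' = inv_into {..<length D} \<pi>"
  define a' where "a' = inv_into (arrs D) \<alpha>"
  have bp: "bij_betw \<pi> {..<length D} {..<length D'}" and ba: "bij_betw \<alpha> (arrs D) (arrs D')"
    using 1(1) by (auto simp: diso_def bij_betw_def)
  have a': "amap a' (amap \<alpha> e) = e" if "e \<in> set (concat D)" for e
    using in_arrs[OF that] bij_betw_inv_into_left[OF ba] by (simp add: a'_def amap_def)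
  have p': "p' (\<pi> c) = c" if "c < length D" for c
    using bij_betw_inv_into_left[OF bp] that by (simp add: p'_def)
  have rot: "\<exists>r. rotate r (D ! p' c') = map (amap a') (D' ! c')" if "c' < length D'" for c'
  proof -
    have "c' \<in> \<pi> ` {..<length D}" using bp that by (auto simp: bij_betw_def)
    then obtain c where c: "c < length D" "c' = \<pi> c" by auto
    obtain r where r: "rotate r (D' ! \<pi> c) = map (amap \<alpha>) (D ! c)" using 1(1) c by (auto simp: diso_def)
    let ?L = "length (D' ! \<pi> c)"
    have "map (amap a') (rotate r (D' ! \<pi> c)) = map (\<lambda>e. amap a' (amap \<alpha> e)) (D ! c)"
      unfolding r by simp
    also have "\<dots> = D ! c" using a' set_nth_concat[OF c(1)] by (intro map_idI) blast
    finally have "rotate r (map (amap a') (D' ! \<pi> c)) = D ! c" by (simp only: rotate_map)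
    \<comment> \<open>Rotating by the complement of \<open>r\<close> modulo the length undoes the
      rotation.\<close>
    then have "rotate (?L - r mod ?L) (D ! c) = rotate (?L - r mod ?L + r) (map (amap a') (D' ! \<pi> c))"
      by (simp flip: rotate_rotate)
    also have "\<dots> = map (amap a') (D' ! \<pi> c)"
    proof (cases "?L = 0")
      case False
      then have "(?L - r mod ?L + r) mod ?L = (?L - r mod ?L + r mod ?L) mod ?L" by (simp only: mod_simps)
      also have "\<dots> = 0" using False by (simp add: less_imp_le)
      finally show ?thesis by (intro rotate_id) simp
    qed simp
    finally show ?thesis using p' c by metis
  qed
  have "arel D' D p' a' (bs' ! i) (bs ! i)" if i: "i < length bs" for i
  proof -
    have b: "bs ! i \<in> arcs D" using assms(2) nth_mem[OF i] by auto
    then have c: "fst (bs ! i) < length D" by (auto simp: arcs_def)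
    then have "D' ! \<pi> (fst (bs ! i)) = [] \<longleftrightarrow> D ! fst (bs ! i) = []"
      using diso_circle(3)[OF 1(1)] by (metis length_0_conv)
    then show ?thesis using 1(3) i p'[OF c] a'[OF endp_in[OF b]] by (auto simp: arel_def)
  qed
  moreover have "diso D' D p' a'"
    unfolding diso_def using rot bij_betw_inv_into[OF bp] bij_betw_inv_into[OF ba]
    by (auto simp: p'_def a'_def bij_betw_def)
  ultimately show ?thesis unfolding biso_def using 1(2) by auto
qed

lemma biso_transport:
  assumes b: "biso D bs D' bs'" and wf: "wfd D" "wfd D'" and bs: "set bs \<subseteq> arcs D" "set bs' \<subseteq> arcs D'"
  shows "multibased k D' bs' \<longleftrightarrow> multibased k D bs" "ascending D' bs' \<longleftrightarrow> ascending D bs"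
    "\<exists>\<alpha>. inj_on \<alpha> (arrs D) \<and> \<alpha> ` arrs D = arrs D'"
proof -
  obtain \<pi> \<alpha> where 1: "diso D D' \<pi> \<alpha>" "length bs = length bs'" "\<forall>i<length bs. arel D D' \<pi> \<alpha> (bs ! i) (bs' ! i)"
    using b unfolding biso_def by blast
  interpret diag_iso D D' \<pi> \<alpha> using wf 1(1) by unfold_locales
  have "bs' ! i = g (bs ! i)" if "i < length bs" for i
    using g(5)[of "bs ! i" "bs' ! i"] 1(2,3) bs that nth_mem by (metis subsetD)
  then have "bs' = map g bs" using 1(2) by (intro nth_equalityI) auto
  then show "multibased k D' bs' \<longleftrightarrow> multibased k D bs" "ascending D' bs' \<longleftrightarrow> ascending D bs"
    using g_multibased[OF bs(1)] g_ascending[OF bs(1)] by auto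
  show "\<exists>\<alpha>. inj_on \<alpha> (arrs D) \<and> \<alpha> ` arrs D = arrs D'" using 1(1) by (auto simp: diso_def)
qed

section \<open>The Gauss diagram of a closed braid and its smoothings\<close>

lemma strand_end_empty: "strand_end {} t w p = foldl (\<lambda>q l. swp (fst l) q) p w"
proof (induction w arbitrary: t p)
  case (Cons x w)
  show ?case by (cases x) (simp add: Cons)
qed simp

lemma bperm_sp: "bperm w = strand_end {} 0 w"
  by (simp add: fun_eq_iff bperm_def strand_end_empty)

lemma strand_end_snoc: "strand_end S t (u @ [l]) p = (if t + length u \<in> S then strand_end S t u p else swp (fst l) (strand_end S t u p))"
proof (induction u arbitrary: t p)
  case Nil
  show ?case by (cases l) simp
next
  case (Cons x u)
  show ?case by (cases x) (simp add: Cons)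
qed

lemma bpass_append: "bpass t (u @ v) q = bpass t u q @ bpass (t + length u) v (strand_end {} t u q)"
proof (induction u arbitrary: t q)
  case (Cons x u)
  show ?case by (cases x) (simp add: Cons)
qed simp

lemma shift_mod: "0 < k \<Longrightarrow> k \<le> L \<Longrightarrow> (k + L - Suc 0) mod L = k - Suc (0 :: nat)"
  by (cases k) simp_all

locale closed_braid =
  fixes m :: nat and w :: "letter list"
  assumes m: "1 \<le> m" and w: "braid_word m w"
begin

abbreviation n where "n \<equiv> length w"

definition pos_at :: "nat set \<Rightarrow> nat \<Rightarrow> nat \<Rightarrow> nat" where
  "pos_at T t = strand_end T 0 (take t w)"

lemma pos_at_0 [simp]: "pos_at T 0 x = x"
  by (simp add: pos_at_def)

lemma pos_at_n: "pos_at T n = strand_end T 0 w"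
  by (simp add: pos_at_def)

lemma pos_at_Suc: "t < n \<Longrightarrow> pos_at T (Suc t) x = (if t \<in> T then pos_at T t x else swp (fst (w ! t)) (pos_at T t x))"
  by (simp add: pos_at_def take_Suc_conv_app_nth strand_end_snoc)

lemma braid_word_take: "braid_word m (take t w)"
  using w set_take_subset[of t w] unfolding braid_word_def by blast

lemma pos_at_permutes: "pos_at T t permutes {1..m}"
  unfolding pos_at_def by (rule strand_end_permutes[OF braid_word_take])

lemma pos_at_in: "pos_at T t x \<in> {1..m} \<longleftrightarrow> x \<in> {1..m}"
  by (rule permutes_in_image[OF pos_at_permutes])

lemma pos_at_inj: "pos_at T t x = pos_at T t y \<longleftrightarrow> x = y"
  using permutes_inj[OF pos_at_permutes] by (metis injD)

text \<open>The position, just below the crossing, of the strand carrying endpoint \<open>e\<close>.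
  The head lies on the lower strand, which comes from the right at a positive letter and from the
  left at a negative one.\<close>

definition epos :: "endpt \<Rightarrow> nat" where
  "epos e = (if snd e = snd (w ! fst e) then Suc (fst (w ! fst e)) else fst (w ! fst e))"

definition hit :: "nat \<Rightarrow> nat \<Rightarrow> endpt list" where
  "hit t q = (if q = epos (t, True) then [(t, True)] else if q = epos (t, False) then [(t, False)] else [])"

lemma letter: "t < n \<Longrightarrow> 1 \<le> fst (w ! t) \<and> fst (w ! t) < m"
  using w nth_mem unfolding braid_word_def by blast

lemma epos_in: "fst e < n \<Longrightarrow> epos e \<in> {1..m}"
  using letter[of "fst e"] by (auto simp: epos_def)

lemma epos_neq: "epos (t, h) = epos (t, h') \<longleftrightarrow> h = h'"
  by (auto simp: epos_def)

text \<open>Above the crossing, the strand carrying one endpoint stands where the other came from. A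
  smoothed strand, which stays in place, therefore continues on the other real strand, just as the
  boundary follows the band.\<close>

lemma swp_epos: "swp (fst (w ! t)) (epos (t, h)) = epos (t, \<not> h)"
  by (auto simp: epos_def swp_def)

lemma swp_other: "q \<noteq> epos (t, True) \<Longrightarrow> q \<noteq> epos (t, False) \<Longrightarrow> swp (fst (w ! t)) q = q"
  by (auto simp: epos_def swp_def split: if_splits)

lemma set_hit: "e \<in> set (hit t q) \<longleftrightarrow> fst e = t \<and> q = epos e"
  by (cases e; cases "snd e") (auto simp: hit_def epos_neq)

lemma hit_cases:
  obtains "hit t q = []" "q \<noteq> epos (t, True)" "q \<noteq> epos (t, False)"
  | h where "hit t q = [(t, h)]" "q = epos (t, h)"
  by (cases "q = epos (t, True)"; cases "q = epos (t, False)") (auto simp: hit_def epos_neq)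

definition pre :: "nat \<Rightarrow> nat \<Rightarrow> endpt list" where
  "pre t p = bpass 0 (take t w) p"

lemma pre_0 [simp]: "pre 0 p = []"
  by (simp add: pre_def)

lemma pre_n: "pre n p = bpass 0 w p"
  by (simp add: pre_def)

lemma pre_Suc: assumes "t < n" shows "pre (Suc t) p = pre t p @ hit t (pos_at {} t p)"
proof -
  obtain i b where l: "w ! t = (i, b)" by force
  have "bpass t [w ! t] q = hit t q" for q
    by (auto simp: l hit_def epos_def)
  then show ?thesis using assms by (simp add: pre_def pos_at_def take_Suc_conv_app_nth bpass_append)
qed

lemma pre_append: "t \<le> t' \<Longrightarrow> t' \<le> n \<Longrightarrow> \<exists>r. pre t' p = pre t p @ r"
proof (induction t' rule: dec_induct)
  case (step k) then show ?case by (auto simp: pre_Suc)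
qed simp

lemma set_pre: "t \<le> n \<Longrightarrow> e \<in> set (pre t p) \<longleftrightarrow> fst e < t \<and> pos_at {} (fst e) p = epos e"
  by (induction t) (auto simp: pre_Suc set_hit less_Suc_eq)

lemma distinct_pre: "t \<le> n \<Longrightarrow> distinct (pre t p)"
  by (induction t) (auto simp: pre_Suc set_pre hit_def)

definition \<beta> :: "nat \<Rightarrow> nat" where "\<beta> = bperm w"

lemma \<beta>_st: "\<beta> = pos_at {} n"
  by (simp add: \<beta>_def bperm_sp pos_at_n)

lemma perm_\<beta>: "perm_upto \<beta> m"
  unfolding \<beta>_def bperm_sp by (rule perm_upto_sp[OF w])

sublocale B: perm_upto \<beta> m by (rule perm_\<beta>)

lemma reps_props: "set (reps m w) = {r \<in> {1..m}. \<forall>j. r \<le> (\<beta> ^^ j) r}" "distinct (reps m w)"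
  by (simp_all add: reps_def \<beta>_def)

lemma cyc_orb: "cyc w r = orb \<beta> r"
  by (simp add: cyc_eq_orb \<beta>_def)

lemma repsD: "r \<in> set (reps m w) \<Longrightarrow> r \<in> {1..m}"
  unfolding reps_props by blast

lemma repsD2: "r \<in> set (reps m w) \<Longrightarrow> v \<in> set (orb \<beta> r) \<Longrightarrow> r \<le> v"
proof -
  assume "r \<in> set (reps m w)"
  then have *: "r \<in> {1..m}" "\<forall>j. r \<le> (\<beta> ^^ j) r" unfolding reps_props by blast+
  assume "v \<in> set (orb \<beta> r)"
  then show "r \<le> v" using * B.set_orb by auto
qed

lemma reps_disjoint:
  assumes "r \<in> set (reps m w)" "s \<in> set (reps m w)" "v \<in> set (orb \<beta> r)" "v \<in> set (orb \<beta> s)"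
  shows "r = s"
proof -
  have "set (orb \<beta> r) = set (orb \<beta> s)"
    using B.orb_sym[OF repsD[OF assms(1)] assms(3)] B.orb_sym[OF repsD[OF assms(2)] assms(4)] by simp
  then have "r \<in> set (orb \<beta> s)" "s \<in> set (orb \<beta> r)"
    using B.self_in_orb repsD assms(1,2) by blast+
  then show ?thesis using repsD2 assms(1,2) by (meson le_antisym)
qed

lemma reps_cover: assumes x: "x \<in> {1..m}" shows "\<exists>r\<in>set (reps m w). x \<in> set (orb \<beta> r)"
proof -
  let ?r = "Min (set (orb \<beta> x))"
  have r: "?r \<in> set (orb \<beta> x)" using B.orb_ne[OF x] by (intro Min_in) auto
  then have r': "?r \<in> {1..m}" using B.orb_subset[OF x] by blast
  have e: "set (orb \<beta> ?r) = set (orb \<beta> x)" by (rule B.orb_sym[OF x r])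
  have "?r \<le> (\<beta> ^^ j) ?r" for j
  proof -
    have "(\<beta> ^^ j) ?r \<in> set (orb \<beta> x)" using e B.set_orb[OF r'] by blast
    then show ?thesis by simp
  qed
  then have "?r \<in> set (reps m w)" unfolding reps_props using r' by blast
  then show ?thesis using e B.self_in_orb[OF x] by blast
qed

lemma distinct_concat_map:
  assumes "distinct xs" "\<And>x. x \<in> set xs \<Longrightarrow> distinct (f x)"
    "\<And>x y e. x \<in> set xs \<Longrightarrow> y \<in> set xs \<Longrightarrow> e \<in> set (f x) \<Longrightarrow> e \<in> set (f y) \<Longrightarrow> x = y"
  shows "distinct (concat (map f xs))"
  using assms
proof (induction xs)
  case (Cons x xs)
  have "set (f x) \<inter> set (concat (map f xs)) = {}"
  proof (rule ccontr)
    assume "\<not> ?thesis"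
    then obtain e y where "e \<in> set (f x)" "y \<in> set xs" "e \<in> set (f y)" by auto
    then show False using Cons.prems(1) Cons.prems(3)[of x y e] by auto
  qed
  moreover have "distinct (concat (map f xs))"
    using Cons.prems by (intro Cons.IH) auto
  ultimately show ?case using Cons.prems(2)[of x] by simp
qed simp

lemma in_concat_map: "e \<in> set (concat (map f xs)) \<longleftrightarrow> (\<exists>x\<in>set xs. e \<in> set (f x))"
  by auto

abbreviation strands :: "nat list" where "strands \<equiv> concat (map (orb \<beta>) (reps m w))"

lemma strands: "distinct strands" "set strands = {1..m}"
proof -
  show "distinct strands"
    using reps_props(2) B.distinct_orb repsD reps_disjoint by (intro distinct_concat_map) auto
  show "set strands = {1..m}"
  proof
    show "set strands \<subseteq> {1..m}" using B.orb_subset repsD by fastforce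
    show "{1..m} \<subseteq> set strands" using reps_cover by fastforce
  qed
qed

abbreviation G :: adiag where "G \<equiv> gd_circles m w"

lemma concat_G: "concat G = concat (map (bpass 0 w) strands)"
proof -
  have "concat (map (\<lambda>r. concat (map f (orb \<beta> r))) rs) = concat (map f (concat (map (orb \<beta>) rs)))"
    for f :: "nat \<Rightarrow> endpt list" and rs by (induction rs) simp_all
  then show ?thesis by (simp add: gd_circles_def cyc_orb)
qed

lemma in_bpass: "e \<in> set (bpass 0 w p) \<longleftrightarrow> fst e < n \<and> pos_at {} (fst e) p = epos e"
  using set_pre[of n] by (simp add: pre_n)

lemma pos_at_ex: assumes "q \<in> {1..m}" obtains p where "p \<in> {1..m}" "pos_at T t p = q"
  using permutes_image[OF pos_at_permutes, of T t] assms by (metis imageE)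

text \<open>At the level of a crossing the positions are a permutation of the strands, so some
  strand passes through each of its two ends.\<close>

lemma set_G: "set (concat G) = {..<n} \<times> UNIV"
proof -
  have "(t, h) \<in> set (concat G)" if t: "t < n" for t h
  proof -
    obtain p where p: "p \<in> {1..m}" "pos_at {} t p = epos (t, h)" 
      using pos_at_ex[of "epos (t, h)"] epos_in[of "(t, h)"] t by auto
    then have "(t, h) \<in> set (bpass 0 w p)" using t by (simp add: in_bpass)
    then show ?thesis unfolding concat_G in_concat_map strands(2) using p(1) by blast
  qed
  moreover have "fst e < n" if "e \<in> set (concat G)" for e
    using that unfolding concat_G in_concat_map in_bpass by blast
  ultimately show ?thesis by (auto simp del: set_concat)
qed

lemma wfd_G: "wfd G"
proof -
  have "distinct (concat G)" unfolding concat_G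
  proof (rule distinct_concat_map[OF strands(1)])
    show "distinct (bpass 0 w p)" for p using distinct_pre[of n p] by (simp add: pre_n)
    show "p = q" if "e \<in> set (bpass 0 w p)" "e \<in> set (bpass 0 w q)" for p q e
      using that pos_at_inj[of "{}" "fst e" p q] by (simp add: in_bpass)
  qed
  then show ?thesis unfolding wfd_def set_G by auto
qed

lemma arrs_G: "arrs G = {..<n}"
  unfolding arrs_def set_G by force

section \<open>Labelled arcs on the circles of the Gauss diagram\<close>

definition circle_index :: "nat \<Rightarrow> nat" where
  "circle_index p = (SOME c. c < length (reps m w) \<and> p \<in> set (cyc w (reps m w ! c)))"

definition circle_strands :: "nat \<Rightarrow> nat list" where "circle_strands p = orb \<beta> (reps m w ! circle_index p)"

definition circle_pos :: "nat \<Rightarrow> nat" where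
  "circle_pos p = (SOME j. j < length (circle_strands p) \<and> circle_strands p ! j = p)"

definition before :: "nat \<Rightarrow> endpt list" where
  "before p = concat (map (bpass 0 w) (take (circle_pos p) (circle_strands p)))"

lemma length_G: "length G = length (reps m w)"
  by (simp add: gd_circles_def)

lemma gd_label_eq: "gd_label m w p = (circle_index p, if length (G ! circle_index p) = 0 then 0
    else (length (before p) + length (G ! circle_index p) - 1) mod length (G ! circle_index p))"
  by (simp add: gd_label_def Let_def circle_index_def circle_strands_def circle_pos_def before_def cyc_orb)

context
  fixes p assumes p: "p \<in> {1..m}"
begin

lemma circle_index: "circle_index p < length (reps m w)" "p \<in> set (circle_strands p)" "reps m w ! circle_index p \<in> {1..m}"
proof -
  have "\<exists>c. c < length (reps m w) \<and> p \<in> set (cyc w (reps m w ! c))"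
    using reps_cover[OF p] by (metis cyc_orb in_set_conv_nth)
  from someI_ex[OF this] show *: "circle_index p < length (reps m w)" and "p \<in> set (circle_strands p)"
    by (simp_all add: circle_index_def circle_strands_def cyc_orb)
  show "reps m w ! circle_index p \<in> {1..m}" using repsD[OF nth_mem[OF *]] .
qed

lemma circle_pos: "circle_pos p < length (circle_strands p)" "circle_strands p ! circle_pos p = p"
proof -
  have "\<exists>j. j < length (circle_strands p) \<and> circle_strands p ! j = p" using circle_index(2) by (simp add: in_set_conv_nth)
  from someI_ex[OF this] show "circle_pos p < length (circle_strands p)" "circle_strands p ! circle_pos p = p" by (simp_all add: circle_pos_def)
qed

lemma circle_strands_orb: "set (circle_strands p) = set (orb \<beta> p)"
  using B.orb_sym[OF circle_index(3)] circle_index(2) unfolding circle_strands_def by metis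

lemma distinct_cl: "distinct (circle_strands p)"
  unfolding circle_strands_def by (rule B.distinct_orb[OF circle_index(3)])

lemma circle_index_unique: "c < length (reps m w) \<Longrightarrow> p \<in> set (orb \<beta> (reps m w ! c)) \<Longrightarrow> circle_index p = c"
  using reps_disjoint[of "reps m w ! c" "reps m w ! circle_index p" p] circle_index(1,2) reps_props(2)
  by (auto simp: circle_strands_def nth_eq_iff_index_eq)

lemma circle_pos_unique: "j < length (circle_strands p) \<Longrightarrow> circle_strands p ! j = p \<Longrightarrow> circle_pos p = j"
  using circle_pos nth_eq_iff_index_eq[OF distinct_cl, of j "circle_pos p"] by simp

lemma G_nth: "G ! circle_index p = concat (map (bpass 0 w) (circle_strands p))"
  using circle_index(1) by (simp add: gd_circles_def circle_strands_def cyc_orb)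

lemma G_split: "\<exists>r. G ! circle_index p = before p @ bpass 0 w p @ r"
proof -
  have "circle_strands p = take (circle_pos p) (circle_strands p) @ p # drop (Suc (circle_pos p)) (circle_strands p)"
    using id_take_nth_drop[OF circle_pos(1)] circle_pos(2) by simp
  then have "map (bpass 0 w) (circle_strands p) = map (bpass 0 w) (take (circle_pos p) (circle_strands p)) @ bpass 0 w p # map (bpass 0 w) (drop (Suc (circle_pos p)) (circle_strands p))"
    by (metis list.simps(9) map_append)
  then show ?thesis unfolding G_nth before_def by simp
qed

lemma gd_label_arcs: "gd_label m w p \<in> arcs G"
  using circle_index(1) by (simp add: gd_label_eq arcs_iff length_G)

end

lemma \<beta>_in: "p \<in> {1..m} \<Longrightarrow> \<beta> p \<in> {1..m}"
  using B.pow_in[of p 1] by simp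

lemma cix_\<beta>: assumes p: "p \<in> {1..m}" shows "circle_index (\<beta> p) = circle_index p"
  using circle_index_unique[OF \<beta>_in[OF p] circle_index(1)[OF p]] B.orb_closed[OF circle_index(3)[OF p]] circle_index(2)[OF p] by (simp add: circle_strands_def)

text \<open>Through the closing strand one either reaches the next strand in the list of the same
  circle, or, after the last one, the representative at which the list of endpoints starts
  afresh.\<close>

lemma before_\<beta>:
  assumes p: "p \<in> {1..m}"
  shows "before (\<beta> p) = before p @ bpass 0 w p \<or> before (\<beta> p) = [] \<and> before p @ bpass 0 w p = G ! circle_index p"
proof -
  let ?r = "reps m w ! circle_index p"
  have circle_strands: "circle_strands (\<beta> p) = circle_strands p" by (simp add: circle_strands_def cix_\<beta>[OF p])
  have len: "length (circle_strands p) = clen \<beta> ?r" by (simp add: circle_strands_def orb_def)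
  have nth: "circle_strands p ! j = (\<beta> ^^ j) ?r" if "j < length (circle_strands p)" for j
    using that unfolding len by (simp add: circle_strands_def orb_def)
  note j = circle_pos[OF p]
  have take: "take (Suc (circle_pos p)) (circle_strands p) = take (circle_pos p) (circle_strands p) @ [p]"
    using take_Suc_conv_app_nth[OF j(1)] j(2) by simp
  have \<beta>p: "\<beta> p = (\<beta> ^^ Suc (circle_pos p)) ?r" using nth[OF j(1)] j(2) by simp
  show ?thesis
  proof (cases "Suc (circle_pos p) < length (circle_strands p)")
    case True
    have "circle_pos (\<beta> p) = Suc (circle_pos p)"
      by (rule circle_pos_unique[OF \<beta>_in[OF p], unfolded circle_strands, OF True]) (simp only: nth[OF True] \<beta>p)
    then show ?thesis by (simp add: before_def circle_strands take)
  next
    case False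
    then have s: "Suc (circle_pos p) = length (circle_strands p)" using j(1) by simp
    then have r: "\<beta> p = ?r" using \<beta>p B.clen(2)[OF circle_index(3)[OF p]] len by simp
    have z: "0 < length (circle_strands p)" using j(1) by linarith
    have "circle_pos (\<beta> p) = 0"
      by (rule circle_pos_unique[OF \<beta>_in[OF p], unfolded circle_strands, OF z]) (simp only: nth[OF z] r funpow_0)
    moreover have "take (circle_pos p) (circle_strands p) @ [p] = circle_strands p" using take s by simp
    then have "before p @ bpass 0 w p = G ! circle_index p"
      unfolding before_def G_nth[OF p] by (metis concat.simps concat_append list.simps(8,9) map_append append_Nil2)
    ultimately show ?thesis by (simp add: before_def circle_strands)
  qed
qed

end

locale smoothing = closed_braid +
  fixes S :: "nat set"
  assumes S: "S \<subseteq> {..<length w}"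
begin

abbreviation D :: adiag where "D \<equiv> Sub S G"
abbreviation fS :: "endpt list \<Rightarrow> endpt list" where "fS \<equiv> filter (\<lambda>e. fst e \<in> S)"

lemma wfd_D: "wfd D" and dist_D: "distinct (concat D)"
  using wfd_Sub[OF wfd_G] by (auto simp: wfd_def)

lemma set_D: "set (concat D) = S \<times> UNIV"
  unfolding Sub_concat set_filter set_G using S by auto

lemma D_nth: "p \<in> {1..m} \<Longrightarrow> D ! circle_index p = fS (G ! circle_index p)"
  using circle_index(1) by (simp add: Sub_nth length_G)

text \<open>The arc of the sub-diagram containing the point where the unsmoothed strand with bottom
  position \<open>p\<close> enters level \<open>t\<close>.\<close>
definition point_arc :: "nat \<Rightarrow> nat \<Rightarrow> arc" where
  "point_arc t p = (let L = length (D ! circle_index p) in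
     (circle_index p, if L = 0 then 0 else (length (fS (before p @ pre t p)) + L - 1) mod L))"

lemma point_arc_arcs: "p \<in> {1..m} \<Longrightarrow> point_arc t p \<in> arcs D"
  using circle_index(1) by (auto simp: point_arc_def Let_def arcs_iff length_G)

lemma point_arc_next_same: "t < n \<Longrightarrow> fS (hit t (pos_at {} t p)) = [] \<Longrightarrow> point_arc (Suc t) p = point_arc t p"
  by (simp add: point_arc_def pre_Suc Let_def)

text \<open>If N surviving endpoints come before the crossing, the current arc has index N - 1
  modulo the length, so its end is entry N of the circle, which is \<open>(t, h)\<close>; beyond it
  begins the arc with index N.\<close>

lemma point_arc_hit:
  assumes p: "p \<in> {1..m}" and t: "t < n" "t \<in> S" and h: "pos_at {} t p = epos (t, h)"
  shows "D ! fst (point_arc t p) \<noteq> []" "endp D (point_arc t p) = (t, h)" "point_arc (Suc t) p = loc D (t, h)"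
proof -
  have hit: "hit t (pos_at {} t p) = [(t, h)]" using h epos_neq by (cases h) (auto simp: hit_def)
  obtain r where r: "G ! circle_index p = before p @ bpass 0 w p @ r" using G_split[OF p] by blast
  obtain r' where r': "bpass 0 w p = pre (Suc t) p @ r'"
    using pre_append[of "Suc t" n p] t by (auto simp: pre_n)
  let ?N = "length (fS (before p @ pre t p))" and ?L = "length (D ! circle_index p)"
  have D: "D ! circle_index p = fS (before p @ pre t p) @ (t, h) # fS (r' @ r)"
    using t by (simp add: D_nth[OF p] r r' pre_Suc hit)
  then have N: "?N < ?L" by simp
  have e: "D ! circle_index p ! ?N = (t, h)" unfolding D by simp
  show "D ! fst (point_arc t p) \<noteq> []" using N by (auto simp: point_arc_def Let_def)
  have "Suc ((?N + ?L - 1) mod ?L) mod ?L = ?N"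
    using N by (cases ?N) (simp_all add: mod_Suc_eq)
  then show "endp D (point_arc t p) = (t, h)" using e N by (auto simp: point_arc_def Let_def endp_def)
  have "point_arc (Suc t) p = (circle_index p, ?N)"
    using N t by (auto simp: point_arc_def Let_def pre_Suc hit)
  also have "\<dots> = loc D (t, h)"
    using loc_nth[OF dist_D, of "circle_index p" ?N] e N circle_index(1)[OF p] by (simp add: length_G)
  finally show "point_arc (Suc t) p = loc D (t, h)" .
qed

text \<open>When the circle closes, the count jumps from its full length to 0; both give the last
  index, which is the purpose of the term \<open>L - 1\<close> in \<open>point_arc\<close>.\<close>

lemma point_arc_close: assumes p: "p \<in> {1..m}" shows "point_arc n p = point_arc 0 (\<beta> p)"
  using before_\<beta>[OF p] cix_\<beta>[OF p]
proof (elim disjE)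
  assume b: "before (\<beta> p) = [] \<and> before p @ bpass 0 w p = G ! circle_index p"
  then have "fS (before p @ bpass 0 w p) = D ! circle_index p" by (simp add: D_nth[OF p])
  then show ?thesis using b cix_\<beta>[OF p]
    by (cases "D ! circle_index p = []") (simp_all add: point_arc_def Let_def pre_n shift_mod del: filter_append)
qed (simp add: point_arc_def pre_n Let_def)

definition lab :: "nat \<Rightarrow> arc" where "lab p = point_arc 0 p"

lemma lab_arcs: "p \<in> {1..m} \<Longrightarrow> lab p \<in> arcs D"
  by (simp add: lab_def point_arc_arcs)

lemma coarse_label: assumes p: "p \<in> {1..m}" shows "coarse S G (gd_label m w p) = lab p"
proof -
  let ?C = "G ! circle_index p"
  obtain r where r: "?C = before p @ bpass 0 w p @ r" using G_split[OF p] by blast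
  have D: "D ! circle_index p = fS ?C" by (rule D_nth[OF p])
  show ?thesis
  proof (cases "fS ?C = []")
    case True then show ?thesis by (simp add: coarse_def lab_def point_arc_def gd_label_eq D)
  next
    case False
    then have C: "?C \<noteq> []" by auto
    show ?thesis
    proof (cases "before p = []")
      case True
      then have "gd_label m w p = (circle_index p, length ?C - 1)" using C by (simp add: gd_label_eq)
      then show ?thesis using False C True by (simp add: coarse_def lab_def point_arc_def D Let_def shift_mod)
    next
      case F: False
      have "length (before p) \<le> length ?C" by (simp add: r)
      then have "gd_label m w p = (circle_index p, length (before p) - 1)"
        using C F by (simp add: gd_label_eq shift_mod)
      moreover have "take (Suc (length (before p) - 1)) ?C = before p" using F by (simp add: r)
      ultimately show ?thesis using False by (simp add: coarse_def lab_def point_arc_def D Let_def)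
    qed
  qed
qed

end

section \<open>Boundary components as cycles of the smoothed braid\<close>

context smoothing
begin

abbreviation \<sigma> :: "nat \<Rightarrow> nat" where "\<sigma> \<equiv> strand_end S 0 w"
abbreviation nx :: "arc \<Rightarrow> arc" where "nx \<equiv> next_arc D"

sublocale R: perm_upto \<sigma> m by (rule perm_upto_sp[OF w])
sublocale N: finite_perm nx "arcs D" by (rule next_arc_perm[OF wfd_D])

text \<open>The strand of the original braid on which the smoothed strand \<open>x\<close> runs at
  level \<open>t\<close>; it changes at smoothed crossings.\<close>

definition real_strand :: "nat \<Rightarrow> nat \<Rightarrow> nat" where "real_strand t x = inv (pos_at {} t) (pos_at S t x)"

lemma real_strand_eqI: "pos_at {} t p = pos_at S t x \<Longrightarrow> real_strand t x = p"
  using permutes_inverses(2)[OF pos_at_permutes] by (metis real_strand_def)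

lemma pos_at_rl: "pos_at {} t (real_strand t x) = pos_at S t x"
  unfolding real_strand_def by (rule permutes_inverses(1)[OF pos_at_permutes])

lemma real_strand_in: "x \<in> {1..m} \<Longrightarrow> real_strand t x \<in> {1..m}"
  using pos_at_in[of "{}" t "real_strand t x"] pos_at_in[of S t x] pos_at_rl by metis

text \<open>The boundary walk from \<open>x\<close> passes exactly the ends in \<open>L\<close>, in
  this order, and then stands on \<open>y\<close>.\<close>

definition reads :: "arc \<Rightarrow> endpt list \<Rightarrow> arc \<Rightarrow> bool" where
  "reads x L y \<longleftrightarrow> (nx ^^ length L) x = y \<and>
     (\<forall>k<length L. D ! fst ((nx ^^ k) x) \<noteq> [] \<and> endp D ((nx ^^ k) x) = L ! k)"

lemma reads_Nil [simp]: "reads x [] y \<longleftrightarrow> x = y"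
  by (simp add: reads_def)

lemma reads_append:
  assumes "reads x L y" "reads y M z" shows "reads x (L @ M) z"
proof -
  have y: "y = (nx ^^ length L) x" using assms(1) by (simp add: reads_def)
  have shift: "(nx ^^ (length L + k)) x = (nx ^^ k) y" for k
    by (simp add: y add.commute[of "length L"] funpow_add)
  have "D ! fst ((nx ^^ k) x) \<noteq> [] \<and> endp D ((nx ^^ k) x) = (L @ M) ! k" if "k < length (L @ M)" for k
  proof (cases "k < length L")
    case True then show ?thesis using assms(1) by (simp add: reads_def nth_append)
  next
    case False
    then obtain k' where k: "k = length L + k'" using le_Suc_ex by (metis linorder_not_less)
    with that have "k' < length M" by simp
    then show ?thesis using assms(2) shift[of k'] by (simp add: reads_def k)
  qed
  moreover have "(nx ^^ length (L @ M)) x = z" using shift[of "length M"] assms(2) by (simp add: reads_def)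
  ultimately show ?thesis unfolding reads_def by blast
qed

lemma reads_single: "D ! fst x \<noteq> [] \<Longrightarrow> endp D x = e \<Longrightarrow> reads x [e] (nx x)"
  by (simp add: reads_def)

definition met_at :: "nat \<Rightarrow> nat \<Rightarrow> endpt list" where
  "met_at t x = (if t \<in> S then hit t (pos_at S t x) else [])"

definition met :: "nat \<Rightarrow> nat \<Rightarrow> endpt list" where
  "met t x = concat (map (\<lambda>s. met_at s x) [0..<t])"

abbreviation met_all :: "nat \<Rightarrow> endpt list" where "met_all \<equiv> met n"

lemma met_Suc: "met (Suc t) x = met t x @ met_at t x"
  by (simp add: met_def)

lemma set_sbs: "e \<in> set (met_at t x) \<longleftrightarrow> t \<in> S \<and> fst e = t \<and> pos_at S t x = epos e"
  by (simp add: met_at_def set_hit)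

lemma set_sb: "e \<in> set (met t x) \<longleftrightarrow> fst e < t \<and> fst e \<in> S \<and> pos_at S (fst e) x = epos e"
  unfolding met_def in_concat_map set_sbs by auto

lemma distinct_sb: "distinct (met t x)"
  unfolding met_def
proof (rule distinct_concat_map)
  show "distinct (met_at s x)" for s by (simp add: met_at_def hit_def)
qed (auto simp: set_sbs)

text \<open>At an unsmoothed crossing the smoothed and the real strand move alike and no boundary
  step occurs. At a smoothed crossing the two part: the walk changes to the other real strand, which
  is one application of \<open>next_arc\<close>.\<close>

lemma walk_step:
  assumes x: "x \<in> {1..m}" and t: "t < n"
  shows "reads (point_arc t (real_strand t x)) (met_at t x) (point_arc (Suc t) (real_strand (Suc t) x))"
proof -
  define p where "p = real_strand t x"
  have p: "p \<in> {1..m}" and stp: "pos_at {} t p = pos_at S t x" using real_strand_in[OF x] pos_at_rl by (simp_all add: p_def)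
  have e: "pos_at {} (Suc t) p = swp (fst (w ! t)) (pos_at S t x)" using t stp by (simp add: pos_at_Suc)
  have S': "pos_at S (Suc t) x = (if t \<in> S then pos_at S t x else swp (fst (w ! t)) (pos_at S t x))" using t by (simp add: pos_at_Suc)
  show ?thesis
  proof (cases "met_at t x = []")
    case True
    then have "pos_at {} (Suc t) p = pos_at S (Suc t) x"
    proof (cases "t \<in> S")
      case tS: True
      then have "hit t (pos_at S t x) = []" using True by (simp add: met_at_def)
      then have "swp (fst (w ! t)) (pos_at S t x) = pos_at S t x"
        by (cases rule: hit_cases[of t "pos_at S t x"]) (auto intro: swp_other)
      then show ?thesis unfolding e S' using tS by simp
    qed (simp add: e S')
    then have "real_strand (Suc t) x = p" by (rule real_strand_eqI)
    moreover have "point_arc (Suc t) p = point_arc t p"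
    proof (rule point_arc_next_same[OF t])
      show "fS (hit t (pos_at {} t p)) = []"
        using True set_hit[of _ t "pos_at S t x"] unfolding stp by (auto simp: met_at_def filter_empty_conv split: if_splits)
    qed
    ultimately show ?thesis using True by (simp add: p_def)
  next
    case False
    then have tS: "t \<in> S" by (auto simp: met_at_def split: if_splits)
    with False obtain h where h: "met_at t x = [(t, h)]" "pos_at S t x = epos (t, h)"
      using hit_cases[of t "pos_at S t x"] by (auto simp: met_at_def)
    have hp: "pos_at {} t p = epos (t, h)" using stp h by simp
    note a = point_arc_hit[OF p t tS hp]
    \<comment> \<open>The other real strand of the crossing: it leaves at the position where the
      smoothed strand stays.\<close>
    obtain p' where p': "p' \<in> {1..m}" "pos_at {} t p' = epos (t, \<not> h)"
      using pos_at_ex[OF epos_in, of "(t, \<not> h)"] t by auto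
    have "pos_at {} (Suc t) p' = pos_at S (Suc t) x"
      using t tS h p' swp_epos[of t "\<not> h"] by (simp add: pos_at_Suc)
    then have r: "real_strand (Suc t) x = p'" by (rule real_strand_eqI)
    have "nx (point_arc t p) = point_arc (Suc t) p'"
      using a(1,2) point_arc_hit(3)[OF p'(1) t tS p'(2)] by (simp add: next_arc_def)
    then show ?thesis using reads_single[OF a(1,2)] h(1) r by (simp add: p_def)
  qed
qed

lemma walk: "x \<in> {1..m} \<Longrightarrow> t \<le> n \<Longrightarrow> reads (lab x) (met t x) (point_arc t (real_strand t x))"
proof (induction t)
  case 0
  have "real_strand 0 x = x" by (rule real_strand_eqI) simp
  then show ?case by (simp add: met_def lab_def)
next
  case (Suc t)
  then show ?case unfolding met_Suc by (intro reads_append[OF _ walk_step]) auto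
qed

lemma walk_strand: assumes x: "x \<in> {1..m}" shows "reads (lab x) (met_all x) (lab (\<sigma> x))"
proof -
  have "point_arc n (real_strand n x) = lab (\<beta> (real_strand n x))" unfolding lab_def by (rule point_arc_close[OF real_strand_in[OF x]])
  also have "\<beta> (real_strand n x) = \<sigma> x" unfolding \<beta>_st pos_at_rl by (simp only: pos_at_n)
  finally show ?thesis using walk[OF x, of n] by simp
qed

lemma walk_orbit:
  "x \<in> {1..m} \<Longrightarrow> reads (lab x) (concat (map met_all (map (\<lambda>i. (\<sigma> ^^ i) x) [0..<j]))) (lab ((\<sigma> ^^ j) x))"
proof (induction j)
  case (Suc j)
  have "reads (lab ((\<sigma> ^^ j) x)) (met_all ((\<sigma> ^^ j) x)) (lab (\<sigma> ((\<sigma> ^^ j) x)))"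
    by (rule walk_strand[OF R.pow_in[OF Suc.prems]])
  from reads_append[OF Suc.IH[OF Suc.prems] this] show ?case by simp
qed simp

definition orbit_ends :: "nat \<Rightarrow> endpt list" where "orbit_ends x = concat (map met_all (orb \<sigma> x))"

lemma reads_El: "x \<in> {1..m} \<Longrightarrow> reads (lab x) (orbit_ends x) (lab x)"
  using walk_orbit[of x "clen \<sigma> x"] R.clen(2)[of x] by (simp add: orbit_ends_def orb_def)

lemma distinct_sbf_list: "distinct xs \<Longrightarrow> distinct (concat (map met_all xs))"
proof (rule distinct_concat_map)
  show "x = y" if "e \<in> set (met_all x)" "e \<in> set (met_all y)" for x y e
    using that pos_at_inj[of S "fst e" x y] by (simp add: set_sb)
qed (auto intro: distinct_sb)

lemma distinct_El: "x \<in> {1..m} \<Longrightarrow> distinct (orbit_ends x)"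
  unfolding orbit_ends_def by (intro distinct_sbf_list R.distinct_orb)

text \<open>The walk is back after reading all ends of the cycle, and not earlier, because these
  ends are distinct and a return would repeat the one read at the start.\<close>

lemma clen_nx: assumes x: "x \<in> {1..m}" and ne: "orbit_ends x \<noteq> []" shows "clen nx (lab x) = length (orbit_ends x)"
proof -
  let ?l = "length (orbit_ends x)" and ?c = "clen nx (lab x)"
  note r = reads_El[OF x, unfolded reads_def]
  have l: "0 < ?l" using ne by simp
  have c: "0 < ?c" "(nx ^^ ?c) (lab x) = lab x" using N.clen[OF lab_arcs[OF x]] by auto
  have "?c \<le> ?l" using r l by (intro N.clen_min) auto
  moreover have False if "?c < ?l"
  proof -
    have "endp D ((nx ^^ ?c) (lab x)) = orbit_ends x ! ?c" "endp D ((nx ^^ 0) (lab x)) = orbit_ends x ! 0"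
      using r that l by blast+
    then have "orbit_ends x ! ?c = orbit_ends x ! 0" using c(2) by simp
    then show False using nth_eq_iff_index_eq[OF distinct_El[OF x] that l] c(1) by simp
  qed
  ultimately show ?thesis by fastforce
qed

lemma trav_lab:
  assumes x: "x \<in> {1..m}" and ne: "orbit_ends x \<noteq> []"
  shows "map (endp D) (trav D (lab x)) = orbit_ends x" "\<forall>y\<in>set (trav D (lab x)). D ! fst y \<noteq> []"
proof -
  note r = reads_El[OF x, unfolded reads_def]
  have t: "trav D (lab x) = map (\<lambda>j. (nx ^^ j) (lab x)) [0..<length (orbit_ends x)]"
    unfolding bcomp_orb(2)[OF wfd_D lab_arcs[OF x]] orb_def clen_nx[OF x ne] ..
  show "map (endp D) (trav D (lab x)) = orbit_ends x"
    unfolding t by (rule nth_equalityI) (use r in auto)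
  show "\<forall>y\<in>set (trav D (lab x)). D ! fst y \<noteq> []" unfolding t using r by auto
qed

lemma unhit_strand:
  assumes "met_all y = []"
  shows "t \<le> n \<Longrightarrow> pos_at S t y = pos_at {} t y" "\<sigma> y = \<beta> y" "fS (bpass 0 w y) = []"
proof -
  have nh: "pos_at S t y \<noteq> epos (t, h)" if "t < n" "t \<in> S" for t h
    using that assms set_sb[of "(t, h)" n y] by auto
  have st: "pos_at S t y = pos_at {} t y" if "t \<le> n" for t
    using that
  proof (induction t)
    case (Suc t)
    then have "swp (fst (w ! t)) (pos_at S t y) = pos_at S t y" if "t \<in> S" using nh that by (intro swp_other) auto
    then show ?case using Suc by (simp add: pos_at_Suc)
  qed simp
  then show "t \<le> n \<Longrightarrow> pos_at S t y = pos_at {} t y" .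
  show "\<sigma> y = \<beta> y" using st[of n] by (simp add: \<beta>_st pos_at_n)
  have "\<not> (e \<in> set (bpass 0 w y) \<and> fst e \<in> S)" for e
    using nh[of "fst e" "snd e"] st[of "fst e"] by (auto simp: in_bpass)
  then show "fS (bpass 0 w y) = []" by (auto simp: filter_empty_conv)
qed

text \<open>A cycle meeting no smoothed crossing follows the real strands all the way round, so it
  covers a whole circle, left without arrows in \<open>D\<close>. Such cycles read no ends and have
  to be treated through their circle.\<close>

lemma orbit_ends_empty:
  assumes x: "x \<in> {1..m}" and e: "orbit_ends x = []"
  shows "D ! fst (lab x) = []" "set (circle_strands x) \<subseteq> set (orb \<sigma> x)"
proof -
  have sbe: "met_all y = []" if "y \<in> set (orb \<sigma> x)" for y using e that by (auto simp: orbit_ends_def)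
  have "(\<beta> ^^ j) x = (\<sigma> ^^ j) x" for j
  proof (induction j)
    case (Suc j)
    have "(\<sigma> ^^ j) x \<in> set (orb \<sigma> x)" using R.set_orb[OF x] by blast
    then show ?case using Suc unhit_strand(2)[OF sbe] by simp
  qed simp
  then have sub: "set (orb \<beta> x) \<subseteq> set (orb \<sigma> x)" using R.set_orb[OF x] B.set_orb[OF x] by auto
  then show "set (circle_strands x) \<subseteq> set (orb \<sigma> x)" using circle_strands_orb[OF x] by simp
  then have "fS (bpass 0 w y) = []" if "y \<in> set (circle_strands x)" for y using unhit_strand(3)[OF sbe] that by blast
  then have "fS (G ! circle_index x) = []" unfolding G_nth[OF x] filter_concat by simp
  then show "D ! fst (lab x) = []" by (simp add: lab_def point_arc_def Let_def D_nth[OF x])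
qed

lemma orbit_ends_nonempty: "x \<in> {1..m} \<Longrightarrow> orbit_ends x \<noteq> [] \<Longrightarrow> D ! fst (lab x) \<noteq> [] \<and> endp D (lab x) = orbit_ends x ! 0"
  using reads_El[of x] by (auto simp: reads_def dest: spec[of _ 0])

lemma bcomp_lab: "x \<in> {1..m} \<Longrightarrow> bcomp D (lab x) = set (orb nx (lab x))"
  by (rule bcomp_orb(1)[OF wfd_D lab_arcs])

lemma bcomp_eqI: "x \<in> {1..m} \<Longrightarrow> y \<in> bcomp D (lab x) \<Longrightarrow> bcomp D y = bcomp D (lab x)"
proof -
  assume x: "x \<in> {1..m}" "y \<in> bcomp D (lab x)"
  then have "y \<in> arcs D" using bcomp_lab N.orb_subset[OF lab_arcs] by blast
  from bcomp_orb(1)[OF wfd_D this] show ?thesis using x N.orb_sym[OF lab_arcs] bcomp_lab by metis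
qed

lemma bcomp_empty: "x \<in> {1..m} \<Longrightarrow> orbit_ends x = [] \<Longrightarrow> bcomp D (lab x) = {lab x}"
proof -
  assume "x \<in> {1..m}" "orbit_ends x = []"
  then have "nx (lab x) = lab x" using orbit_ends_empty(1) by (simp add: next_arc_def)
  then have "(nx ^^ j) (lab x) = lab x" for j by (induction j) auto
  then show ?thesis by (auto simp: bcomp_def)
qed

lemma lab_in_bcomp: "x \<in> {1..m} \<Longrightarrow> lab x \<in> bcomp D (lab x)"
  unfolding bcomp_def by (auto intro: exI[of _ 0])

text \<open>From cycles to components by walking along the orbit. Conversely, two cycles on one
  component read a common end, and each end is met by only one smoothed strand; cycles that read
  nothing are told apart by their circles.\<close>

lemma bcomp_lab_eq:
  assumes x: "x \<in> {1..m}" and y: "y \<in> {1..m}"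
  shows "bcomp D (lab x) = bcomp D (lab y) \<longleftrightarrow> set (orb \<sigma> x) = set (orb \<sigma> y)"
proof
  assume "set (orb \<sigma> x) = set (orb \<sigma> y)"
  then have "y \<in> set (orb \<sigma> x)" using R.self_in_orb[OF y] by simp
  then obtain j where j: "y = (\<sigma> ^^ j) x" using R.set_orb[OF x] by auto
  have "\<exists>k. (nx ^^ k) (lab x) = lab y" using walk_orbit[OF x, of j] unfolding reads_def j by blast
  then obtain k where "lab y = (nx ^^ k) (lab x)" by metis
  then have "lab y \<in> bcomp D (lab x)" by (auto simp: bcomp_def)
  then show "bcomp D (lab x) = bcomp D (lab y)" using bcomp_eqI[OF x] by simp
next
  assume eq: "bcomp D (lab x) = bcomp D (lab y)"
  have key: "set (orb \<sigma> x) = set (orb \<sigma> y)"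
    if x: "x \<in> {1..m}" and y: "y \<in> {1..m}" and eq: "bcomp D (lab x) = bcomp D (lab y)" and e: "orbit_ends x = []" for x y
  proof -
    have "lab y = lab x" using bcomp_empty[OF x e] lab_in_bcomp[OF y] eq by simp
    then have "circle_index y = circle_index x" by (simp add: lab_def point_arc_def Let_def)
    then have "y \<in> set (circle_strands x)" using circle_index(2)[OF y] by (simp add: circle_strands_def)
    then have "y \<in> set (orb \<sigma> x)" using orbit_ends_empty(2)[OF x e] by blast
    then show ?thesis using R.orb_sym[OF x] by simp
  qed
  show "set (orb \<sigma> x) = set (orb \<sigma> y)"
  proof (cases "orbit_ends x = [] \<or> orbit_ends y = []")
    case True then show ?thesis using key[OF x y eq] key[OF y x] eq by auto
  next
    case False
    obtain k where "lab y = (nx ^^ k) (lab x)" using lab_in_bcomp[OF y] eq[symmetric] by (auto simp: bcomp_def)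
    then have k: "lab y = (nx ^^ (k mod length (orbit_ends x))) (lab x)"
      using N.pow_mod[OF lab_arcs[OF x]] clen_nx[OF x] False by metis
    have kl: "k mod length (orbit_ends x) < length (orbit_ends x)" using False by (intro mod_less_divisor) auto
    then have "endp D (lab y) = orbit_ends x ! (k mod length (orbit_ends x))"
      using reads_El[OF x] unfolding reads_def k by blast
    then have "orbit_ends y ! 0 \<in> set (orbit_ends x)" using orbit_ends_nonempty[OF y] False nth_mem[OF kl] by simp
    moreover have "orbit_ends y ! 0 \<in> set (orbit_ends y)" using False by simp
    ultimately obtain x' y' where *: "x' \<in> set (orb \<sigma> x)" "y' \<in> set (orb \<sigma> y)"
        "orbit_ends y ! 0 \<in> set (met_all x')" "orbit_ends y ! 0 \<in> set (met_all y')"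
      unfolding orbit_ends_def in_concat_map by blast
    then have "x' = y'" using pos_at_inj[of S "fst (orbit_ends y ! 0)" x' y'] by (simp add: set_sb)
    then show ?thesis using R.orb_sym[OF x *(1)] R.orb_sym[OF y *(2)] by simp
  qed
qed

text \<open>Every component passes a labelled arc: the end of any arc is met by some smoothed
  strand, whose cycle walks through that arc, and an empty circle carries the label of its
  representative.\<close>

lemma bcomp_cover: assumes y: "y \<in> arcs D" shows "\<exists>x\<in>{1..m}. bcomp D y = bcomp D (lab x)"
proof (cases "D ! fst y = []")
  case True
  then obtain c where yc: "y = (c, 0)" "c < length (reps m w)" "D ! c = []"
    using y by (cases y) (auto simp: arcs_iff length_G)
  let ?x = "reps m w ! c"
  have x: "?x \<in> {1..m}" using repsD yc(2) by simp
  have "circle_index ?x = c" using B.self_in_orb[OF x] yc(2) by (intro circle_index_unique[OF x]) auto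
  then have "lab ?x = y" using yc by (simp add: lab_def point_arc_def)
  then show ?thesis using x by metis
next
  case False
  obtain t h where e: "endp D y = (t, h)" by force
  have t: "t \<in> S" "t < n" using endp_in[OF y False] S unfolding e set_D by auto
  obtain x where x: "x \<in> {1..m}" "pos_at S t x = epos (t, h)" using pos_at_ex[OF epos_in, of "(t, h)"] t by auto
  then have "(t, h) \<in> set (met_all x)" using t by (simp add: set_sb)
  then have "(t, h) \<in> set (orbit_ends x)" using R.self_in_orb[OF x(1)] unfolding orbit_ends_def in_concat_map by blast
  then obtain k where k: "k < length (orbit_ends x)" "orbit_ends x ! k = (t, h)" by (metis in_set_conv_nth)
  then have "D ! fst ((nx ^^ k) (lab x)) \<noteq> []" "endp D ((nx ^^ k) (lab x)) = (t, h)"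
    using reads_El[OF x(1)] by (auto simp: reads_def)
  then have "y = (nx ^^ k) (lab x)"
    using e False N.pow_in[OF lab_arcs[OF x(1)]] by (intro endp_inj[OF dist_D y]) auto
  then have "y \<in> bcomp D (lab x)" by (auto simp: bcomp_def)
  then show ?thesis using bcomp_eqI[OF x(1)] x(1) by blast
qed

abbreviation base_labels :: "nat list" where "base_labels \<equiv> mx_reps \<sigma> m"

lemma distinct_mr: "distinct base_labels"
  using mx_reps_props(2)[of \<sigma> m] by (induction "mx_reps \<sigma> m") (auto simp: mx_reps_def)

lemma base_labels_cover: assumes x: "x \<in> {1..m}" shows "\<exists>r\<in>set base_labels. set (orb \<sigma> r) = set (orb \<sigma> x)"
proof -
  have "x \<in> set (ordl \<sigma> m)" using R.ordl_props(2) x by simp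
  then obtain r where r: "r \<in> set base_labels" "x \<in> set (orb \<sigma> r)" unfolding ordl_def in_concat_map by blast
  then show ?thesis using R.orb_sym[OF R.mx_repsD(1)[OF r(1)] r(2)] by auto
qed

lemma base_labels_inj: "r \<in> set base_labels \<Longrightarrow> s \<in> set base_labels \<Longrightarrow> set (orb \<sigma> r) = set (orb \<sigma> s) \<Longrightarrow> r = s"
  using R.orb_disjoint[of r s r] R.self_in_orb R.mx_repsD(1) by blast

lemma nbcomp_D: "nbcomp D = ncyc m w S"
proof -
  have "bcomp D ` arcs D = (\<lambda>r. bcomp D (lab r)) ` set base_labels"
  proof (intro equalityI subsetI)
    fix X assume "X \<in> bcomp D ` arcs D"
    then obtain x where x: "x \<in> {1..m}" "X = bcomp D (lab x)" using bcomp_cover by blast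
    obtain r where r: "r \<in> set base_labels" "set (orb \<sigma> r) = set (orb \<sigma> x)" using base_labels_cover[OF x(1)] by blast
    then have "X = bcomp D (lab r)" using bcomp_lab_eq[OF R.mx_repsD(1)[OF r(1)] x(1)] x(2) by simp
    then show "X \<in> (\<lambda>r. bcomp D (lab r)) ` set base_labels" using r(1) by blast
  next
    fix X assume "X \<in> (\<lambda>r. bcomp D (lab r)) ` set base_labels"
    then show "X \<in> bcomp D ` arcs D" using lab_arcs R.mx_repsD(1) by blast
  qed
  moreover have "inj_on (\<lambda>r. bcomp D (lab r)) (set base_labels)"
  proof (rule inj_onI)
    fix r s assume rs: "r \<in> set base_labels" "s \<in> set base_labels" "bcomp D (lab r) = bcomp D (lab s)"
    then have "set (orb \<sigma> r) = set (orb \<sigma> s)"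
      using bcomp_lab_eq[OF R.mx_repsD(1)[OF rs(1)] R.mx_repsD(1)[OF rs(2)]] by simp
    then show "r = s" by (rule base_labels_inj[OF rs(1,2)])
  qed
  ultimately show ?thesis unfolding nbcomp_def ncyc_def
    by (simp add: card_image distinct_card[OF distinct_mr])
qed

end

section \<open>Ascending diagrams and the forced base points\<close>

lemma precedes_nth:
  assumes "distinct L" "e' \<in> set L" "e \<noteq> e'"
  shows "(\<forall>i<length L. L ! i = e' \<longrightarrow> (\<exists>j<i. L ! j = e)) \<longleftrightarrow> precedes L e e'"
  using assms
proof (induction L)
  case (Cons x L)
  have split: "(\<forall>i<length (x # L). (x # L) ! i = e' \<longrightarrow> (\<exists>j<i. (x # L) ! j = e)) \<longleftrightarrow>
      x \<noteq> e' \<and> (\<forall>i<length L. L ! i = e' \<longrightarrow> x = e \<or> (\<exists>j<i. L ! j = e))"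
    by (simp add: All_less_Suc2 Ex_less_Suc2)
  show ?case
  proof (cases "x = e \<or> x = e'")
    case True then show ?thesis unfolding split using Cons.prems(3) by auto
  next
    case False
    then show ?thesis unfolding split using Cons.IH Cons.prems by auto
  qed
qed simp

lemma precedes_append: "precedes (xs @ ys) e e' \<longleftrightarrow> (if e \<in> set xs \<or> e' \<in> set xs then precedes xs e e' else precedes ys e e')"
  by (induction xs) auto

lemma precedes_mem: "e \<in> set xs \<Longrightarrow> e' \<notin> set xs \<Longrightarrow> precedes xs e e'" "e \<notin> set xs \<Longrightarrow> \<not> precedes xs e e'"
  by (induction xs) auto

lemma precedes_concat_map:
  assumes "u \<in> set xs" "v \<in> set xs" "u \<noteq> v"
    "\<And>x. x \<in> set xs \<Longrightarrow> e \<in> set (f x) \<longleftrightarrow> x = u" "\<And>x. x \<in> set xs \<Longrightarrow> e' \<in> set (f x) \<longleftrightarrow> x = v"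
  shows "precedes (concat (map f xs)) e e' \<longleftrightarrow> precedes xs u v"
  using assms
proof (induction xs)
  case (Cons x xs)
  consider "x = u" | "x = v" | "x \<noteq> u" "x \<noteq> v" by blast
  then show ?case
  proof cases
    case 1
    then have "e \<in> set (f x)" "e' \<notin> set (f x)" using Cons.prems by auto
    then show ?thesis using precedes_mem(1) 1 by (simp add: precedes_append)
  next
    case 2
    then have "e \<notin> set (f x)" "e' \<in> set (f x)" using Cons.prems by auto
    then show ?thesis using precedes_mem(2) 2 Cons.prems(3) by (simp add: precedes_append)
  next
    case 3
    then have "e \<notin> set (f x)" "e' \<notin> set (f x)" using Cons.prems by auto
    moreover have "precedes (concat (map f xs)) e e' \<longleftrightarrow> precedes xs u v"
      using 3 Cons.prems by (intro Cons.IH) auto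
    ultimately show ?thesis using 3 by (simp add: precedes_append)
  qed
qed simp

lemma set_ent:
  "(b, u, v) \<in> set (smoothing_data S xs (tag t w)) \<longleftrightarrow> (\<exists>s<length w. t + s \<in> S \<and> b = snd (w ! s) \<and>
     u = top_config S xs (tag t (take s w)) ! (if snd (w ! s) then fst (w ! s) else fst (w ! s) - 1) \<and>
     v = top_config S xs (tag t (take s w)) ! (if snd (w ! s) then fst (w ! s) - 1 else fst (w ! s)))"
proof (induction w arbitrary: t xs)
  case (Cons l w)
  obtain i c where l: "l = (i, c)" by force
  show ?case by (simp add: l Ex_less_Suc2 Cons)
qed simp

text \<open>As \<open>js\<close> decreases, the bound on colours means that the base label of the
  chosen colour exceeds the coloured label. This is the inequality that makes base points cycle
  maxima.\<close>

lemma lmax_iff: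
  assumes "sorted_wrt (>) js" "js \<noteq> []" "l < hd js" "1 \<le> c"
  shows "c \<le> lmax js l \<longleftrightarrow> c \<le> length js \<and> l < js ! (c - 1)"
proof -
  let ?M = "{i \<in> {1..length js}. l < js ! (i - 1)}"
  have fin: "finite ?M" by simp
  have "1 \<in> ?M" using assms(2,3) by (cases js) auto
  then have max: "Max ?M \<in> ?M" using fin by (intro Max_in) auto
  show ?thesis unfolding lmax_def
  proof
    assume c: "c \<le> Max ?M"
    have "js ! (Max ?M - 1) \<le> js ! (c - 1)"
    proof (cases "c = Max ?M")
      case False
      then show ?thesis using c max assms(4)
        by (intro less_imp_le sorted_wrt_nth_less[OF assms(1)]) auto
    qed simp
    then show "c \<le> length js \<and> l < js ! (c - 1)" using c max by auto
  next
    assume "c \<le> length js \<and> l < js ! (c - 1)"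
    then show "c \<le> Max ?M" using fin assms(4) by (intro Max_ge) auto
  qed
qed

lemma sorted_gt_unique:
  assumes "sorted_wrt (>) xs" "sorted_wrt (>) ys" "set xs = set ys" shows "xs = (ys :: nat list)"
proof -
  have "sorted_wrt (<) (rev xs)" "sorted_wrt (<) (rev ys)" using assms by (simp_all add: sorted_wrt_rev)
  then have "rev xs = rev ys" using strict_sorted_equal[of "rev xs" "rev ys"] assms(3) by simp
  then show ?thesis by simp
qed

context smoothing
begin

text \<open>The smoothed strand that arrives at crossing \<open>t\<close> in the position of the end
  \<open>(t, h)\<close>.\<close>

definition strand_at :: "nat \<Rightarrow> bool \<Rightarrow> nat" where "strand_at t h = inv (pos_at S t) (epos (t, h))"

lemma pos_at_ul: "pos_at S t (strand_at t h) = epos (t, h)"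
  unfolding strand_at_def by (rule permutes_inverses(1)[OF pos_at_permutes])

lemma strand_at_in: "t < n \<Longrightarrow> strand_at t h \<in> {1..m}"
  using pos_at_in[of S t "strand_at t h"] epos_in[of "(t, h)"] by (simp add: pos_at_ul)

lemma in_sbf_ul: "t \<in> S \<Longrightarrow> (t, h) \<in> set (met_all x) \<longleftrightarrow> x = strand_at t h"
  using S pos_at_inj[of S t x "strand_at t h"] by (auto simp: set_sb pos_at_ul)

lemma strand_at_neq: "strand_at t True \<noteq> strand_at t False"
  using pos_at_ul[of t True] pos_at_ul[of t False] epos_neq[of t True False] by auto

lemma config_nth: assumes t: "t < n" shows "top_config S [1..<Suc m] (tag 0 (take t w)) ! (epos (t, h) - 1) = strand_at t h"
proof -
  have u: "strand_at t h \<in> {1..m}" by (rule strand_at_in[OF t])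
  have "top_config S [1..<Suc m] (tag 0 (take t w)) ! (strand_end S 0 (take t w) (strand_at t h) - 1) = [1..<Suc m] ! (strand_at t h - 1)"
    using u braid_word_take by (intro top_config_sp) auto
  also have "[1..<Suc m] ! (strand_at t h - 1) = strand_at t h" using u by (simp del: upt_Suc)
  also have "strand_end S 0 (take t w) (strand_at t h) = epos (t, h)" using pos_at_ul by (simp add: pos_at_def)
  finally show ?thesis .
qed

lemma valid_iff: "valid m w S \<longleftrightarrow> (\<forall>t\<in>S. precedes (ordl \<sigma> m) (strand_at t True) (strand_at t False))"
proof -
  have e: "(b, u, v) \<in> set (smoothing_data S [1..<Suc m] (tag 0 w)) \<longleftrightarrow>
     (\<exists>t\<in>S. b = snd (w ! t) \<and> u = strand_at t True \<and> v = strand_at t False)" for b u v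
  proof -
    have c: "top_config S [1..<Suc m] (tag 0 (take t w)) ! (if snd (w ! t) then fst (w ! t) else fst (w ! t) - 1) = strand_at t True"
      "top_config S [1..<Suc m] (tag 0 (take t w)) ! (if snd (w ! t) then fst (w ! t) - 1 else fst (w ! t)) = strand_at t False"
      if "t < n" for t
      using config_nth[OF that, of True] config_nth[OF that, of False] by (auto simp: epos_def simp del: upt_Suc)
    have "(b, u, v) \<in> set (smoothing_data S [1..<Suc m] (tag 0 w)) \<longleftrightarrow>
       (\<exists>t<n. t \<in> S \<and> b = snd (w ! t) \<and> u = strand_at t True \<and> v = strand_at t False)"
      unfolding set_ent add_0 using c by (simp del: upt_Suc cong: conj_cong)
    then show ?thesis using S by blast
  qed
  have "valid m w S \<longleftrightarrow> (\<forall>b u v. (b, u, v) \<in> set (smoothing_data S [1..<Suc m] (tag 0 w)) \<longrightarrow> precedes (ordl \<sigma> m) u v)"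
    unfolding valid_def by (auto simp del: upt_Suc)
  then show ?thesis unfolding e by blast
qed

lemma trav_ends:
  assumes x: "x \<in> {1..m}"
  shows "map (endp D) (filter (\<lambda>y. D ! fst y \<noteq> []) (trav D (lab x))) = orbit_ends x"
proof (cases "orbit_ends x = []")
  case True
  have "set (trav D (lab x)) = {lab x}"
    using bcomp_empty[OF x True] bcomp_lab[OF x] bcomp_orb(2)[OF wfd_D lab_arcs[OF x]] by simp
  then show ?thesis using orbit_ends_empty(1)[OF x True] True by (simp add: filter_empty_conv)
next
  case False
  then have "filter (\<lambda>y. D ! fst y \<noteq> []) (trav D (lab x)) = trav D (lab x)"
    using trav_lab(2)[OF x] by (intro filter_True) auto
  then show ?thesis using trav_lab(1)[OF x False] by simp
qed

text \<open>The traversal from the cycle maxima reads the ends strand by strand in the order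
  \<open>ordl\<close>. Every arrow of \<open>D\<close> has both ends read exactly once, so ascending
  means that its head is read before its tail, that is, that the lower strand is travelled
  first.\<close>

lemma ascending_D: "ascending D (map lab base_labels) \<longleftrightarrow> valid m w S"
proof -
  define T where "T = filter (\<lambda>y. D ! fst y \<noteq> []) (concat (map (trav D) (map lab base_labels)))"
  define EL where "EL = concat (map met_all (ordl \<sigma> m))"
  have "map (endp D) T = concat (map (\<lambda>x. map (endp D) (filter (\<lambda>y. D ! fst y \<noteq> []) (trav D (lab x)))) base_labels)"
    unfolding T_def filter_concat map_concat map_map o_def ..
  also have "\<dots> = concat (map orbit_ends base_labels)"
    using trav_ends R.mx_repsD(1) by (intro arg_cong[where f = concat] map_cong) auto
  also have "\<dots> = EL"
  proof -
    have "concat (map (\<lambda>x. concat (map f (orb \<sigma> x))) rs) = concat (map f (concat (map (orb \<sigma>) rs)))"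
      for f :: "nat \<Rightarrow> endpt list" and rs by (induction rs) simp_all
    moreover have "orbit_ends = (\<lambda>x. concat (map met_all (orb \<sigma> x)))" by (simp add: fun_eq_iff orbit_ends_def)
    ultimately show ?thesis unfolding EL_def ordl_def by simp
  qed
  finally have EL: "map (endp D) T = EL" .
  have dEL: "distinct EL" unfolding EL_def by (rule distinct_sbf_list[OF R.ordl_props(1)])
  have inEL: "(t, h) \<in> set EL" if t: "t \<in> S" for t h
    unfolding EL_def in_concat_map R.ordl_props(2) in_sbf_ul[OF t] using strand_at_in t S by auto
  have S_EL: "fst e \<in> S" if "e \<in> set EL" for e
    using that unfolding EL_def in_concat_map by (auto simp: set_sb)
  have "ascending D (map lab base_labels) \<longleftrightarrow>
     (\<forall>i<length EL. \<not> snd (EL ! i) \<longrightarrow> (\<exists>j<i. fst (EL ! j) = fst (EL ! i)))"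
  proof -
    have "(\<exists>j<i. fst (map (endp D) T ! j) = fst (map (endp D) T ! i)) \<longleftrightarrow> (\<exists>j<i. fst (endp D (T ! j)) = fst (endp D (T ! i)))"
      if "i < length T" for i using that by (intro ex_cong1) auto
    then show ?thesis unfolding ascending_def Let_def T_def[symmetric] EL[symmetric] by simp
  qed
  also have "\<dots> \<longleftrightarrow> (\<forall>t\<in>S. \<forall>i<length EL. EL ! i = (t, False) \<longrightarrow> (\<exists>j<i. EL ! j = (t, True)))"
  proof (intro iffI ballI allI impI)
    fix t i assume h: "\<forall>i<length EL. \<not> snd (EL ! i) \<longrightarrow> (\<exists>j<i. fst (EL ! j) = fst (EL ! i))"
      and i: "i < length EL" "EL ! i = (t, False)"
    then obtain j where j: "j < i" "fst (EL ! j) = t" by fastforce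
    \<comment> \<open>No end is read twice, so an earlier visit to the same arrow must have been at
      its other end.\<close>
    then have "EL ! j \<noteq> EL ! i" using nth_eq_iff_index_eq[OF dEL, of j i] i by auto
    then have "EL ! j = (t, True)" using j i by (metis prod.collapse)
    then show "\<exists>j<i. EL ! j = (t, True)" using j by blast
  next
    fix i assume h: "\<forall>t\<in>S. \<forall>i<length EL. EL ! i = (t, False) \<longrightarrow> (\<exists>j<i. EL ! j = (t, True))"
      and i: "i < length EL" "\<not> snd (EL ! i)"
    then have "fst (EL ! i) \<in> S" "EL ! i = (fst (EL ! i), False)" using S_EL[OF nth_mem] by (auto simp: prod_eq_iff)
    then obtain j where "j < i" "EL ! j = (fst (EL ! i), True)" using h i(1) by metis
    then show "\<exists>j<i. fst (EL ! j) = fst (EL ! i)" by (metis fst_conv)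
  qed
  also have "\<dots> \<longleftrightarrow> (\<forall>t\<in>S. precedes EL (t, True) (t, False))"
    using precedes_nth[OF dEL] inEL by (intro ball_cong) auto
  also have "\<dots> \<longleftrightarrow> (\<forall>t\<in>S. precedes (ordl \<sigma> m) (strand_at t True) (strand_at t False))"
  proof (rule ball_cong[OF refl])
    fix t assume t: "t \<in> S"
    then have "t < n" using S by auto
    then have "strand_at t h \<in> set (ordl \<sigma> m)" for h using strand_at_in R.ordl_props(2) by blast
    then show "precedes EL (t, True) (t, False) \<longleftrightarrow> precedes (ordl \<sigma> m) (strand_at t True) (strand_at t False)"
      unfolding EL_def by (intro precedes_concat_map strand_at_neq in_sbf_ul[OF t])
  qed
  finally show ?thesis unfolding valid_iff .
qed

lemma multibased_lab:
  assumes "set js \<subseteq> {1..m}"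
  shows "multibased k D (map lab js) \<longleftrightarrow> ncyc m w S = k \<and> length js = k \<and>
    (\<forall>i<k. \<forall>j<k. i \<noteq> j \<longrightarrow> set (orb \<sigma> (js ! i)) \<noteq> set (orb \<sigma> (js ! j)))"
proof -
  have "bcomp D (map lab js ! i) = bcomp D (map lab js ! j) \<longleftrightarrow> set (orb \<sigma> (js ! i)) = set (orb \<sigma> (js ! j))"
    if "i < length js" "j < length js" for i j
  proof -
    have "js ! i \<in> {1..m}" "js ! j \<in> {1..m}" using assms that nth_mem by blast+
    then show ?thesis using bcomp_lab_eq that by simp
  qed
  moreover have "set (map lab js) \<subseteq> arcs D" using lab_arcs assms by auto
  ultimately show ?thesis unfolding multibased_def nbcomp_D by auto
qed

text \<open>The forced colouring: the number of the base point on the cycle of \<open>l\<close>.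
  Base points are numbered from 1, hence \<open>Suc\<close>; the value 0 elsewhere is the default
  required by \<open>Gstar\<close>.\<close>

definition colS :: "nat \<Rightarrow> nat" where
  "colS l = (if l \<in> {1..m} - set base_labels then Suc (SOME i. i < length base_labels \<and> l \<in> set (orb \<sigma> (base_labels ! i))) else 0)"

lemma base_labels_index: assumes l: "l \<in> {1..m}" shows "\<exists>!i. i < length base_labels \<and> l \<in> set (orb \<sigma> (base_labels ! i))"
proof -
  obtain r where r: "r \<in> set base_labels" "set (orb \<sigma> r) = set (orb \<sigma> l)" using base_labels_cover[OF l] by blast
  then obtain i where i: "i < length base_labels" "base_labels ! i = r" by (auto simp: in_set_conv_nth)
  show ?thesis
  proof (rule ex1I[of _ i])
    show "i < length base_labels \<and> l \<in> set (orb \<sigma> (base_labels ! i))" using i r R.self_in_orb[OF l] by simp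
    show "i' = i" if i': "i' < length base_labels \<and> l \<in> set (orb \<sigma> (base_labels ! i'))" for i'
    proof -
      have "base_labels ! i' = r" using R.orb_disjoint[of "base_labels ! i'" r l] i' r R.self_in_orb[OF l] nth_mem by auto
      then show ?thesis using nth_eq_iff_index_eq[OF distinct_mr, of i' i] i i' by simp
    qed
  qed
qed

definition starred :: "nat \<Rightarrow> nat list \<times> (nat \<Rightarrow> nat) \<Rightarrow> bool" where
  "starred k Gs \<longleftrightarrow> Gs \<in> Gstar k m \<and> multibased k D (map lab (fst Gs)) \<and> ascending D (map lab (fst Gs)) \<and>
     (\<forall>l\<in>{1..m} - set (fst Gs). lab l \<in> bcomp D (lab (fst Gs ! (snd Gs l - 1))))"

lemma lab_in_bcomp_iff:
  assumes "l \<in> {1..m}" "r \<in> {1..m}"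
  shows "lab l \<in> bcomp D (lab r) \<longleftrightarrow> l \<in> set (orb \<sigma> r)"
proof -
  have "lab l \<in> bcomp D (lab r) \<longleftrightarrow> bcomp D (lab l) = bcomp D (lab r)"
    using bcomp_eqI[OF assms(2)] lab_in_bcomp[OF assms(1)] by blast
  also have "\<dots> \<longleftrightarrow> l \<in> set (orb \<sigma> r)"
    unfolding bcomp_lab_eq[OF assms] using R.self_in_orb[OF assms(1)] R.orb_sym[OF assms(2)] by blast
  finally show ?thesis .
qed

text \<open>By the colour inequality each label lies on the cycle of a base label at least as large
  as itself. So every cycle has a base label, only one since distinct base points lie on distinct
  components, and it is the maximum; order and colours are then determined.\<close>

lemma starred_iff: "starred k Gs \<longleftrightarrow> k = ncyc m w S \<and> valid m w S \<and> Gs = (base_labels, colS)"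
proof
  assume st: "starred k Gs"
  obtain js col where Gs: "Gs = (js, col)" by force
  note st = st[unfolded starred_def Gs fst_conv snd_conv]
  have js: "length js = k" "sorted_wrt (>) js" "js \<noteq> []" "hd js = m" "set js \<subseteq> {1..m}"
    and col: "\<And>l. l \<in> {1..m} - set js \<Longrightarrow> 1 \<le> col l \<and> col l \<le> lmax js l"
      "\<And>l. l \<notin> {1..m} - set js \<Longrightarrow> col l = 0"
    using st unfolding Gstar_def by auto
  have mb: "ncyc m w S = k" "\<And>i j. i < k \<Longrightarrow> j < k \<Longrightarrow> i \<noteq> j \<Longrightarrow> set (orb \<sigma> (js ! i)) \<noteq> set (orb \<sigma> (js ! j))"
    using st multibased_lab[OF js(5)] by blast+
  have c: "col l - 1 < length js" "l < js ! (col l - 1)" "l \<in> set (orb \<sigma> (js ! (col l - 1)))"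
    if l: "l \<in> {1..m} - set js" for l
  proof -
    have "m \<in> set js" using js(3,4) hd_in_set by metis
    then have "l < hd js" using l js(4) by (cases "l = m") auto
    then have "col l \<le> length js \<and> l < js ! (col l - 1)"
      using col(1)[OF l] lmax_iff[OF js(2,3), of l "col l"] by simp
    then show a: "col l - 1 < length js" "l < js ! (col l - 1)" using col(1)[OF l] by auto
    have "js ! (col l - 1) \<in> {1..m}" using js(5) nth_mem[OF a(1)] by blast
    moreover have "lab l \<in> bcomp D (lab (js ! (col l - 1)))" using st l by blast
    ultimately show "l \<in> set (orb \<sigma> (js ! (col l - 1)))" using lab_in_bcomp_iff l by simp
  qed
  have ex: "\<exists>r\<in>set js. l \<le> r \<and> l \<in> set (orb \<sigma> r)" if l: "l \<in> {1..m}" for l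
  proof (cases "l \<in> set js")
    case True then show ?thesis using R.self_in_orb[OF l] by blast
  next
    case False
    then show ?thesis using c[of l] l nth_mem[of "col l - 1" js] by (meson DiffI less_imp_le)
  qed
  have inj: "r = r'" if rr: "r \<in> set js" "r' \<in> set js" "set (orb \<sigma> r) = set (orb \<sigma> r')" for r r'
  proof -
    obtain i j where ij: "i < k" "j < k" "js ! i = r" "js ! j = r'"
      using rr(1,2) js(1) by (auto simp: in_set_conv_nth)
    show ?thesis
    proof (cases "i = j")
      case True then show ?thesis using ij by simp
    next
      case False
      from mb(2)[OF ij(1,2) this] show ?thesis unfolding ij using rr(3) by blast
    qed
  qed
  have "set js = set base_labels"
  proof
    show "set js \<subseteq> set base_labels"
    proof
      fix r assume r: "r \<in> set js"
      then have rm: "r \<in> {1..m}" using js(5) by blast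
      show "r \<in> set base_labels"
      proof (rule R.mx_repsI[OF rm])
        fix v assume v: "v \<in> set (orb \<sigma> r)"
        then have vm: "v \<in> {1..m}" using R.orb_subset[OF rm] by blast
        then obtain r' where r': "r' \<in> set js" "v \<le> r'" "v \<in> set (orb \<sigma> r')" using ex by blast
        then have "set (orb \<sigma> r) = set (orb \<sigma> r')"
          using R.orb_sym[OF rm v] R.orb_sym[of r' v] js(5) by blast
        then show "v \<le> r" using inj[OF r r'(1)] r'(2) by simp
      qed
    qed
    show "set base_labels \<subseteq> set js"
    proof
      fix s assume s: "s \<in> set base_labels"
      then have sm: "s \<in> {1..m}" by (rule R.mx_repsD(1))
      then obtain r where r: "r \<in> set js" "s \<le> r" "s \<in> set (orb \<sigma> r)" using ex by blast
      then have "r \<in> set (orb \<sigma> s)" using R.orb_sym[of r s] R.self_in_orb[of r] js(5) by blast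
      then have "r \<le> s" by (rule R.mx_repsD(2)[OF s])
      then show "s \<in> set js" using r by simp
    qed
  qed
  then have jm: "js = base_labels" using sorted_gt_unique[OF js(2) mx_reps_props(2)] by simp
  have "col = colS"
  proof
    fix l
    show "col l = colS l"
    proof (cases "l \<in> {1..m} - set base_labels")
      case True
      then have l: "l \<in> {1..m} - set js" using jm by simp
      have "(SOME i. i < length base_labels \<and> l \<in> set (orb \<sigma> (base_labels ! i))) = col l - 1"
        using c[OF l] base_labels_index[of l] True unfolding jm by (intro some1_equality) auto
      then show ?thesis using True col(1)[OF l] by (simp add: colS_def)
    next
      case False
      then show ?thesis using col(2)[of l] unfolding jm by (simp add: colS_def)
    qed
  qed
  moreover have "valid m w S" using st ascending_D jm by simp
  ultimately show "k = ncyc m w S \<and> valid m w S \<and> Gs = (base_labels, colS)" using mb(1) jm Gs by simp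
next
  assume h: "k = ncyc m w S \<and> valid m w S \<and> Gs = (base_labels, colS)"
  have len: "length base_labels = k" using h by (simp add: ncyc_def)
  have sub: "set base_labels \<subseteq> {1..m}" using R.mx_repsD(1) by blast
  note hd = R.hd_mx_reps[OF m]
  have c: "Suc i = colS l \<Longrightarrow> i < length base_labels \<and> l \<in> set (orb \<sigma> (base_labels ! i))" if "l \<in> {1..m} - set base_labels" for l i
    using that someI_ex[OF ex1_implies_ex[OF base_labels_index[of l]]] by (simp add: colS_def)
  have cb: "1 \<le> colS l \<and> colS l \<le> lmax base_labels l" "lab l \<in> bcomp D (lab (base_labels ! (colS l - 1)))"
    if l: "l \<in> {1..m} - set base_labels" for l
  proof -
    obtain i where i: "colS l = Suc i" using l by (auto simp: colS_def)
    have il: "i < length base_labels" "l \<in> set (orb \<sigma> (base_labels ! i))" using c[OF l, of i] i by auto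
    have r: "base_labels ! i \<in> set base_labels" using il by simp
    have "l \<le> base_labels ! i" by (rule R.mx_repsD(2)[OF r il(2)])
    then have "l < base_labels ! i" using r l by (cases "l = base_labels ! i") auto
    moreover have "l < hd base_labels"
    proof -
      have "m \<in> set base_labels" using hd hd_in_set by metis
      then show ?thesis unfolding hd(2) using l by (cases "l = m") auto
    qed
    ultimately show "1 \<le> colS l \<and> colS l \<le> lmax base_labels l"
      using lmax_iff[OF mx_reps_props(2) hd(1), of l "Suc i"] il i by simp
    show "lab l \<in> bcomp D (lab (base_labels ! (colS l - 1)))"
      using lab_in_bcomp_iff[of l "base_labels ! i"] l il R.mx_repsD(1)[OF r] i by simp
  qed
  have "(base_labels, colS) \<in> Gstar k m"
    unfolding Gstar_def using len mx_reps_props(2) hd sub cb(1) by (auto simp: colS_def)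
  moreover have "multibased k D (map lab base_labels)"
    unfolding multibased_lab[OF sub] using h len base_labels_inj nth_eq_iff_index_eq[OF distinct_mr] by (metis nth_mem)
  ultimately show "starred k Gs" unfolding starred_def using h ascending_D cb(2) by simp
qed

end

section \<open>Counting pairs of arrow diagrams and colourings\<close>

lemma arrow_diagram_props:
  assumes "arrow_diagram k D" shows "wfd D" "arrs D = {..<k}"
proof -
  show "wfd D" using assms by (auto simp: arrow_diagram_def wfd_def simp del: set_concat)
  show "arrs D = {..<k}" using assms unfolding arrow_diagram_def arrs_def by force
qed

lemma AD_D:
  assumes "(D, bs) \<in> AD k j"
  shows "arrow_diagram k D" "multibased j D bs" "ascending D bs" "set bs \<subseteq> arcs D" "wfd D" "arrs D = {..<k}"
  using assms arrow_diagram_props[of k D] by (auto simp: AD_def multibased_def)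

lemma Sub_all: assumes "arrs D \<subseteq> S" shows "Sub S D = D"
proof -
  have "filter (\<lambda>e. fst e \<in> S) c = c" if "c \<in> set D" for c
    using that assms by (intro filter_True) (force simp: arrs_def)
  then show ?thesis unfolding Sub_def by (intro map_idI) auto
qed

lemma coarse_all: assumes "arrs D \<subseteq> S" "y \<in> arcs D" shows "coarse S D y = y"
proof -
  obtain c p where y: "y = (c, p)" by force
  have c: "c < length D" using assms(2) by (simp add: y arcs_iff)
  have all: "\<forall>e\<in>set (D ! c). fst e \<in> S"
    using assms(1) in_arrs[OF set_nth_concat[OF c]] by blast
  then have f: "filter (\<lambda>e. fst e \<in> S) (D ! c) = D ! c"
    "filter (\<lambda>e. fst e \<in> S) (take (Suc p) (D ! c)) = take (Suc p) (D ! c)"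
    by (auto intro!: filter_True dest: in_set_takeD)
  show ?thesis
  proof (cases "D ! c = []")
    case False
    then have p: "p < length (D ! c)" using assms(2) by (simp add: y arcs_iff)
    then have "length (take (Suc p) (D ! c)) = Suc p" by simp
    then show ?thesis using False p by (simp add: y coarse_def Let_def f del: length_take)
  qed (use assms(2) in \<open>simp add: y arcs_iff coarse_def\<close>)
qed

lemma iso_iff:
  assumes A: "(D, bs) \<in> AD k j" and B: "(D', bs') \<in> AD k j"
  shows "iso (D, bs) (D', bs') \<longleftrightarrow> biso D bs D' bs'"
proof -
  have d: "distinct (concat D')" using AD_D(5)[OF B] by (simp add: wfd_def)
  have arcs: "bs' ! i \<in> arcs D'" if "i < length bs'" for i using AD_D(4)[OF B] that nth_mem by blast
  have "hom D bs D' bs' \<pi> \<alpha> \<and> \<alpha> ` arrs D = arrs D' \<longleftrightarrow>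
     diso D D' \<pi> \<alpha> \<and> length bs = length bs' \<and> (\<forall>i<length bs. arel D D' \<pi> \<alpha> (bs ! i) (bs' ! i))" for \<pi> \<alpha>
  proof (cases "\<alpha> ` arrs D = arrs D'")
    case True
    have "hom D bs D' bs' \<pi> \<alpha> \<longleftrightarrow> diso D D' \<pi> \<alpha> \<and> length bs = length bs' \<and>
      (\<forall>i<length bs. arel D D' \<pi> \<alpha> (bs ! i) (coarse (arrs D') D' (bs' ! i)))"
      unfolding hom_iff[OF d AD_D(4)[OF A] AD_D(4)[OF B]] True Sub_all[OF order_refl] by simp
    then show ?thesis using True coarse_all[OF order_refl arcs] by auto
  next
    case False
    then show ?thesis by (auto simp: diso_def)
  qed
  then show ?thesis unfolding iso_def biso_def fst_conv snd_conv by blast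
qed

definition isoR :: "nat \<Rightarrow> nat \<Rightarrow> ((adiag \<times> arc list) \<times> (adiag \<times> arc list)) set" where
  "isoR k j = {(A, B). A \<in> AD k j \<and> B \<in> AD k j \<and> iso A B}"

lemma isoR_iff: "((D, bs), (D', bs')) \<in> isoR k j \<longleftrightarrow>
    (D, bs) \<in> AD k j \<and> (D', bs') \<in> AD k j \<and> biso D bs D' bs'"
  using iso_iff by (auto simp: isoR_def)

lemma equiv_isoR: "equiv (AD k j) (isoR k j)"
proof (rule equivI)
  show "isoR k j \<subseteq> AD k j \<times> AD k j" by (auto simp: isoR_def)
  show "refl_on (AD k j) (isoR k j)"
    by (rule refl_onI) (use isoR_iff biso_refl in auto)
  show "sym (isoR k j)"
  proof (rule symI)
    fix A B assume h: "(A, B) \<in> isoR k j"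
    obtain D1 b1 D2 b2 where e: "A = (D1, b1)" "B = (D2, b2)" by (metis surj_pair)
    show "(B, A) \<in> isoR k j"
      using h biso_sym[of D1 b1 D2 b2] AD_D(4)[of D1 b1 k j] unfolding e isoR_iff by blast
  qed
  show "trans (isoR k j)"
  proof (rule transI)
    fix A B C assume h: "(A, B) \<in> isoR k j" "(B, C) \<in> isoR k j"
    obtain D1 b1 D2 b2 D3 b3 where e: "A = (D1, b1)" "B = (D2, b2)" "C = (D3, b3)" by (metis surj_pair)
    show "(A, C) \<in> isoR k j"
      using h biso_trans[of D1 b1 D2 b2 D3 b3] AD_D(4)[of D1 b1 k j] unfolding e isoR_iff by blast
  qed
qed

lemma Acal_eq: "Acal k j = AD k j // isoR k j"
  by (simp add: Acal_def isoR_def)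

lemma Acal_rep: assumes "C \<in> Acal k j" shows "(SOME A. A \<in> C) \<in> C" "(SOME A. A \<in> C) \<in> AD k j"
proof -
  have "C \<noteq> {}" using in_quotient_imp_non_empty[OF equiv_isoR] assms unfolding Acal_eq by blast
  then show *: "(SOME A. A \<in> C) \<in> C" by (simp add: some_in_eq)
  have "C \<subseteq> AD k j" using in_quotient_imp_subset[OF equiv_isoR] assms unfolding Acal_eq by blast
  then show "(SOME A. A \<in> C) \<in> AD k j" using * by blast
qed

text \<open>Nonempty circles inject into the endpoints, and each empty circle is a boundary
  component of its own, so there are at most \<open>card E + j\<close> circles. Finiteness matters
  because a sum over an infinite set is 0 by convention.\<close>

lemma finite_AD: "finite (AD k j)"
proof -
  define E where "E = {..<k} \<times> (UNIV :: bool set)"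
  define X where "X = {ys. set ys \<subseteq> E \<and> length ys \<le> card E}"
  define Y where "Y = {D. set D \<subseteq> X \<and> length D \<le> card E + j}"
  have fE: "finite E" by (simp add: E_def)
  have fX: "finite X" unfolding X_def by (rule finite_lists_length_le[OF fE])
  have fY: "finite Y" unfolding Y_def by (rule finite_lists_length_le[OF fX])
  have "AD k j \<subseteq> (SIGMA D:Y. {bs. set bs \<subseteq> arcs D \<and> length bs = j})"
  proof
    fix A assume "A \<in> AD k j"
    then obtain D bs where A: "A = (D, bs)" "(D, bs) \<in> AD k j" by (cases A) auto
    have D: "distinct (concat D)" "set (concat D) = E" "nbcomp D = j"
      using AD_D[OF A(2)] by (auto simp: arrow_diagram_def multibased_def E_def simp del: set_concat)
    have sub: "ys \<in> X" if ys: "ys \<in> set D" for ys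
    proof -
      have "set ys \<subseteq> E" using ys unfolding D(2)[symmetric] by auto
      moreover have "distinct ys" using D(1) ys by (auto simp: distinct_concat_iff)
      ultimately show ?thesis using distinct_card[of ys] card_mono[OF fE, of "set ys"] by (simp add: X_def)
    qed
    let ?e = "{c. c < length D \<and> D ! c = []}" and ?f = "{c. c < length D \<and> D ! c \<noteq> []}"
    have "card ?f \<le> card E"
    proof (rule card_inj_on_le[OF _ _ fE])
      show "(\<lambda>c. D ! c ! 0) ` ?f \<subseteq> E"
      proof (rule image_subsetI)
        show "D ! c ! 0 \<in> E" if "c \<in> ?f" for c
          using that set_nth_concat[of c D "D ! c ! 0"] unfolding D(2)[symmetric] by simp
      qed
      show "inj_on (\<lambda>c. D ! c ! 0) ?f"
        using concat_nth_inj[OF D(1), of _ _ 0 0] by (intro inj_onI) auto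
    qed
    moreover have "card ?e \<le> card (bcomp D ` arcs D)"
    proof (rule card_inj_on_le)
      have b: "bcomp D (c, 0) = {(c, 0)}" if "D ! c = []" for c
      proof -
        have "(next_arc D ^^ i) (c, 0) = (c, 0)" for i by (induction i) (auto simp: next_arc_def that)
        then show ?thesis by (auto simp: bcomp_def)
      qed
      show "inj_on (\<lambda>c. bcomp D (c, 0)) ?e" by (rule inj_onI) (auto simp: b)
      show "(\<lambda>c. bcomp D (c, 0)) ` ?e \<subseteq> bcomp D ` arcs D" by (auto simp: arcs_iff)
      show "finite (bcomp D ` arcs D)" using finite_arcs by simp
    qed
    moreover have "length D = card ?e + card ?f"
    proof -
      have "card (?e \<union> ?f) = card ?e + card ?f" by (rule card_Un_disjoint) auto
      moreover have "?e \<union> ?f = {..<length D}" by auto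
      ultimately show ?thesis by simp
    qed
    ultimately have "length D \<le> card E + j" using D(3) by (simp add: nbcomp_def)
    then have "D \<in> Y" using sub by (auto simp: Y_def)
    then show "A \<in> (SIGMA D:Y. {bs. set bs \<subseteq> arcs D \<and> length bs = j})"
      using AD_D[OF A(2)] A(1) by (auto simp: multibased_def)
  qed
  moreover have "finite (SIGMA D:Y. {bs. set bs \<subseteq> arcs D \<and> length bs = j})"
    using fY finite_lists_length_eq[OF finite_arcs] by (intro finite_SigmaI) auto
  ultimately show ?thesis by (rule finite_subset)
qed

lemma finite_Acal: "finite (Acal k j)"
  unfolding Acal_eq by (rule finite_quotient[OF finite_AD]) (auto simp: isoR_def)

lemma Gstar_col:
  assumes "(js, col) \<in> Gstar j m" "l \<in> {1..m} - set js"
  shows "1 \<le> col l" "col l \<le> length js"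
proof -
  have js: "sorted_wrt (>) js" "js \<noteq> []" "hd js = m" "1 \<le> col l" "col l \<le> lmax js l"
    using assms by (auto simp: Gstar_def)
  have "m \<in> set js" using js(2,3) hd_in_set by metis
  then have "l < hd js" using assms(2) js(3) by (cases "l = m") auto
  then show "1 \<le> col l" "col l \<le> length js" using lmax_iff[OF js(1,2), of l "col l"] js by auto
qed

lemma finite_Gstar: "finite (Gstar j m)"
proof -
  have "Gstar j m \<subseteq> {js. set js \<subseteq> {1..m} \<and> length js = j} \<times>
     {col. \<forall>l. (l \<in> {1..m} \<longrightarrow> col l \<in> {0..j}) \<and> (l \<notin> {1..m} \<longrightarrow> col l = 0)}"
  proof
    fix Gs assume G: "Gs \<in> Gstar j m"
    obtain js col where Gs: "Gs = (js, col)" by force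
    have "col l \<le> j" for l
      using Gstar_col(2)[OF G[unfolded Gs], of l] G unfolding Gs Gstar_def by (cases "l \<in> {1..m} - set js") auto
    then show "Gs \<in> {js. set js \<subseteq> {1..m} \<and> length js = j} \<times>
     {col. \<forall>l. (l \<in> {1..m} \<longrightarrow> col l \<in> {0..j}) \<and> (l \<notin> {1..m} \<longrightarrow> col l = 0)}"
      using G unfolding Gs Gstar_def by auto
  qed
  moreover have "finite ({js. set js \<subseteq> {1..m} \<and> length js = j} \<times>
     {col. \<forall>l. (l \<in> {1..m} \<longrightarrow> col l \<in> {0..j}) \<and> (l \<notin> {1..m} \<longrightarrow> col l = (0 :: nat))})"
    by (intro finite_cartesian_product finite_lists_length_eq finite_set_of_finite_funs) auto
  ultimately show ?thesis by (rule finite_subset)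
qed

definition images :: "nat \<Rightarrow> letter list \<Rightarrow> adiag \<times> arc list \<Rightarrow> nat list \<times> (nat \<Rightarrow> nat) \<Rightarrow> nat set set" where
  "images m w A Gs = {\<alpha> ` arrs (fst A) | \<pi> \<alpha>.
     hom (fst A) (snd A) (gd_circles m w) (map (gd_label m w) (fst Gs)) \<pi> \<alpha> \<and>
     (\<forall>j \<in> {1..m} - set (fst Gs). \<exists>x \<in> arcs (fst A).
        x \<in> bcomp (fst A) (snd A ! (snd Gs j - 1)) \<and> inimg (fst A) (gd_circles m w) \<pi> \<alpha> x (gd_label m w j))}"

lemma pairing_images: "pairing A m w Gs = (\<Sum>S\<in>images m w A Gs. \<Prod>t\<in>S. gd_sign w t)"
  by (simp add: pairing_def images_def Let_def)

lemma (in closed_braid) images_subset: "S \<in> images m w A Gs \<Longrightarrow> S \<subseteq> {..<n}"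
  unfolding images_def hom_def arrs_G by blast

context smoothing
begin

text \<open>A set of crossings is an image exactly when the based diagram is isomorphic to the
  sub-diagram spanned by \<open>S\<close>, based at the labels \<open>js\<close>, and the coloured
  labels lie on the components named by their colours.\<close>

lemma images_iff:
  assumes A: "(DA, bsA) \<in> AD N k" and Gs: "(js, col) \<in> Gstar k m"
  shows "S \<in> images m w (DA, bsA) (js, col) \<longleftrightarrow> biso DA bsA D (map lab js) \<and>
    (\<forall>l\<in>{1..m} - set js. lab l \<in> bcomp D (lab (js ! (col l - 1))))"
proof -
  have js: "set js \<subseteq> {1..m}" "length js = k" using Gs by (auto simp: Gstar_def)
  note ad = AD_D[OF A]
  have len: "length bsA = k" using ad(2) by (simp add: multibased_def)
  have jl: "js ! i \<in> {1..m}" if "i < k" for i using js that nth_mem by blast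
  have distG: "distinct (concat G)" using wfd_G by (simp add: wfd_def)
  have labG: "set (map (gd_label m w) js) \<subseteq> arcs G" using gd_label_arcs js(1) by auto
  have homeq: "hom DA bsA G (map (gd_label m w) js) \<pi> \<alpha> \<longleftrightarrow>
      diso DA D \<pi> \<alpha> \<and> length bsA = length (map lab js) \<and>
      (\<forall>i<length bsA. arel DA D \<pi> \<alpha> (bsA ! i) (map lab js ! i))" if "\<alpha> ` arrs DA = S" for \<pi> \<alpha>
  proof -
    have "S \<subseteq> arrs G" using S by (simp add: arrs_G)
    then show ?thesis
      unfolding hom_iff[OF distG ad(4) labG] that using js(2) len coarse_label[OF jl] by auto
  qed
  have col: "(\<exists>x\<in>arcs DA. x \<in> bcomp DA (bsA ! (col l - 1)) \<and> inimg DA G \<pi> \<alpha> x (gd_label m w l))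
      \<longleftrightarrow> lab l \<in> bcomp D (lab (js ! (col l - 1)))"
    if l: "l \<in> {1..m} - set js" and d: "diso DA D \<pi> \<alpha>"
      and bs: "\<forall>i<length bsA. arel DA D \<pi> \<alpha> (bsA ! i) (map lab js ! i)" for l \<pi> \<alpha>
  proof -
    interpret I: diag_iso DA D \<pi> \<alpha> using ad(5) wfd_D d by unfold_locales
    have c: "col l - 1 < k" using Gstar_col[OF Gs l] js(2) by auto
    let ?b = "bsA ! (col l - 1)"
    have b: "?b \<in> arcs DA" using ad(4) c len nth_mem by blast
    have "arel DA D \<pi> \<alpha> ?b (lab (js ! (col l - 1)))" using bs c len js(2) by auto
    then have gb: "I.g ?b = lab (js ! (col l - 1))" using I.g(5)[OF b lab_arcs[OF jl[OF c]]] by simp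
    have lm: "l \<in> {1..m}" using l by simp
    have "inimg DA G \<pi> \<alpha> x (gd_label m w l) \<longleftrightarrow> lab l = I.g x" if x: "x \<in> arcs DA" for x
      using inimg_iff[OF distG d x gd_label_arcs[OF lm]] coarse_label[OF lm] I.g(5)[OF x lab_arcs[OF lm]] by simp
    then have "(\<exists>x\<in>arcs DA. x \<in> bcomp DA ?b \<and> inimg DA G \<pi> \<alpha> x (gd_label m w l)) \<longleftrightarrow> lab l \<in> I.g ` bcomp DA ?b"
      using I.bcomp_subset[OF b] by blast
    then show ?thesis using I.g_bcomp[OF b] gb by simp
  qed
  show ?thesis
  proof
    assume "S \<in> images m w (DA, bsA) (js, col)"
    then obtain \<pi> \<alpha> where *: "\<alpha> ` arrs DA = S" "hom DA bsA G (map (gd_label m w) js) \<pi> \<alpha>"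
      "\<forall>l\<in>{1..m} - set js. \<exists>x\<in>arcs DA. x \<in> bcomp DA (bsA ! (col l - 1)) \<and> inimg DA G \<pi> \<alpha> x (gd_label m w l)"
      unfolding images_def by auto
    have d: "diso DA D \<pi> \<alpha>" "length bsA = length (map lab js)"
      "\<forall>i<length bsA. arel DA D \<pi> \<alpha> (bsA ! i) (map lab js ! i)"
      using *(2)[unfolded homeq[OF *(1)]] by blast+
    have "lab l \<in> bcomp D (lab (js ! (col l - 1)))" if l: "l \<in> {1..m} - set js" for l
      using *(3)[rule_format, OF l] unfolding col[OF l d(1,3)] .
    then show "biso DA bsA D (map lab js) \<and> (\<forall>l\<in>{1..m} - set js. lab l \<in> bcomp D (lab (js ! (col l - 1))))"
      unfolding biso_def using d by blast
  next
    assume h: "biso DA bsA D (map lab js) \<and> (\<forall>l\<in>{1..m} - set js. lab l \<in> bcomp D (lab (js ! (col l - 1))))"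
    then obtain \<pi> \<alpha> where *: "diso DA D \<pi> \<alpha>" "length bsA = length (map lab js)"
      "\<forall>i<length bsA. arel DA D \<pi> \<alpha> (bsA ! i) (map lab js ! i)" unfolding biso_def by blast
    have aS: "\<alpha> ` arrs DA = S" using *(1) S by (auto simp: diso_def arrs_Sub arrs_G)
    have "hom DA bsA G (map (gd_label m w) js) \<pi> \<alpha>"
      unfolding homeq[OF aS] using * by blast
    moreover have "\<exists>x\<in>arcs DA. x \<in> bcomp DA (bsA ! (col l - 1)) \<and> inimg DA G \<pi> \<alpha> x (gd_label m w l)"
      if l: "l \<in> {1..m} - set js" for l
      unfolding col[OF l *(1,3)] using h l by blast
    ultimately show "S \<in> images m w (DA, bsA) (js, col)"
      unfolding images_def fst_conv snd_conv using aS by blast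
  qed
qed

lemma images_starred:
  assumes A: "(DA, bsA) \<in> AD N k" and Gs: "(js, col) \<in> Gstar k m"
    and im: "S \<in> images m w (DA, bsA) (js, col)"
  shows "starred k (js, col)" "card S = N" "biso DA bsA D (map lab js)"
proof -
  note ad = AD_D[OF A]
  show b: "biso DA bsA D (map lab js)" using im images_iff[OF A Gs] by simp
  have "set js \<subseteq> {1..m}" using Gs by (auto simp: Gstar_def)
  then have sub: "set (map lab js) \<subseteq> arcs D" using lab_arcs by auto
  note tr = biso_transport[OF b ad(5) wfd_D ad(4) sub]
  show "starred k (js, col)" unfolding starred_def using tr(1,2) ad(2,3) im images_iff[OF A Gs] Gs by auto
  obtain \<alpha> where "inj_on \<alpha> (arrs DA)" "\<alpha> ` arrs DA = arrs D" using tr(3) by blast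
  then have "card (arrs D) = N" using card_image[of \<alpha> "arrs DA"] ad(6) by simp
  moreover have "arrs D = S" using S by (auto simp: arrs_Sub arrs_G)
  ultimately show "card S = N" by simp
qed

text \<open>The arrows of \<open>D\<close> are named by crossings; renaming them 0, ..., card S - 1
  produces a member of \<open>AD\<close>.\<close>

lemma diagram_ex:
  assumes bs: "set bs \<subseteq> arcs D" and mb: "multibased k D bs" and asc: "ascending D bs"
  obtains D0 bs0 where "(D0, bs0) \<in> AD (card S) k" "biso D0 bs0 D bs"
proof -
  have fS: "finite S" using S finite_subset by blast
  then obtain h where h: "bij_betw h S {..<card S}" using ex_bij_betw_finite_nat[of S] by (auto simp: atLeast0LessThan)
  define D0 where "D0 = map (map (amap h)) D"
  have c0: "concat D0 = map (amap h) (concat D)" by (simp add: D0_def map_concat)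
  have "inj_on (amap h) (set (concat D))"
    unfolding set_D using bij_betw_imp_inj_on[OF h] by (auto simp: inj_on_def amap_def)
  then have "distinct (concat D0)" unfolding c0 distinct_map using dist_D by simp
  moreover have set0: "set (concat D0) = {..<card S} \<times> UNIV"
  proof -
    have "amap h = map_prod h id" by (auto simp: amap_def fun_eq_iff)
    then show ?thesis unfolding c0 set_map set_D
      using map_prod_surj_on[OF bij_betw_imp_surj_on[OF h], of id UNIV UNIV] by simp
  qed
  ultimately have ad: "arrow_diagram (card S) D0" by (simp add: arrow_diagram_def)
  note ap = arrow_diagram_props[OF ad]
  have arrsD: "arrs D = S" using S by (auto simp: arrs_Sub arrs_G)
  have arcs0: "arcs D0 = arcs D" by (auto simp: arcs_def D0_def)
  have e0: "endp D0 x = amap h (endp D x)" if x: "x \<in> arcs D" "D ! fst x \<noteq> []" for x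
  proof -
    have "fst x < length D" using x by (auto simp: arcs_def)
    moreover have "Suc (snd x) mod length (D ! fst x) < length (D ! fst x)" using x by simp
    ultimately show ?thesis by (simp add: endp_def Let_def D0_def)
  qed
  have "arel D D0 id h (bs ! i) (bs ! i)" if "i < length bs" for i
  proof -
    have "bs ! i \<in> arcs D" using bs nth_mem[OF that] by blast
    then show ?thesis unfolding arel_def using e0[of "bs ! i"] by auto
  qed
  moreover have "diso D D0 id h"
    unfolding diso_def arrsD ap(2) using h
    by (auto simp: bij_betw_def D0_def intro!: exI[of _ 0])
  ultimately have b: "biso D bs D0 bs" unfolding biso_def by blast
  have "set bs \<subseteq> arcs D0" using bs arcs0 by simp
  note tr = biso_transport[OF b wfd_D ap(1) bs this]
  have "(D0, bs) \<in> AD (card S) k" using ad tr(1,2) mb asc by (simp add: AD_def)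
  then show thesis using biso_sym[OF b bs] that by blast
qed

text \<open>The coloured diagram is unique by \<open>starred_iff\<close>. Any two arrow diagrams
  with image \<open>S\<close> are isomorphic to the same based sub-diagram, hence in one class;
  conversely, the class of a renamed copy of \<open>D\<close> occurs.\<close>

lemma count:
  assumes k: "1 \<le> k"
  shows "card {(Gs, C). Gs \<in> Gstar k m \<and> C \<in> Acal N k \<and> S \<in> images m w (SOME A. A \<in> C) Gs}
    = (if ncyc m w S = k \<and> valid m w S \<and> card S = N then 1 else 0)"
proof (cases "ncyc m w S = k \<and> valid m w S \<and> card S = N")
  case False
  have "False" if h: "Gs \<in> Gstar k m" "C \<in> Acal N k" "S \<in> images m w (SOME A. A \<in> C) Gs" for Gs C
  proof -
    obtain DA bsA where A: "(SOME A. A \<in> C) = (DA, bsA)" by force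
    obtain js col where Gs: "Gs = (js, col)" by force
    have AD: "(DA, bsA) \<in> AD N k" using Acal_rep(2)[OF h(2)] A by simp
    from images_starred[OF AD h(1)[unfolded Gs] h(3)[unfolded A Gs]] show False
      using False starred_iff by auto
  qed
  then have "{(Gs, C). Gs \<in> Gstar k m \<and> C \<in> Acal N k \<and> S \<in> images m w (SOME A. A \<in> C) Gs} = {}" by blast
  then show ?thesis by (simp only: card.empty False if_False)
next
  case True
  then have st: "starred k (base_labels, colS)" using starred_iff by simp
  then have G0: "(base_labels, colS) \<in> Gstar k m" and mb: "multibased k D (map lab base_labels)" and asc: "ascending D (map lab base_labels)"
    and cc: "\<forall>l\<in>{1..m} - set base_labels. lab l \<in> bcomp D (lab (base_labels ! (colS l - 1)))"
    unfolding starred_def by auto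
  have sub: "set (map lab base_labels) \<subseteq> arcs D" using lab_arcs R.mx_repsD(1) by auto
  obtain D0 bs0 where A0: "(D0, bs0) \<in> AD N k" "biso D0 bs0 D (map lab base_labels)"
    using diagram_ex[OF sub mb asc] True by blast
  define C0 where "C0 = isoR N k `` {(D0, bs0)}"
  have C0: "C0 \<in> Acal N k" unfolding C0_def Acal_eq using A0(1) by (rule quotientI)
  have X: "{(Gs, C). Gs \<in> Gstar k m \<and> C \<in> Acal N k \<and> S \<in> images m w (SOME A. A \<in> C) Gs} = {((base_labels, colS), C0)}"
  proof (intro equalityI subsetI)
    fix x assume "x \<in> {(Gs, C). Gs \<in> Gstar k m \<and> C \<in> Acal N k \<and> S \<in> images m w (SOME A. A \<in> C) Gs}"
    then obtain Gs C where x: "x = (Gs, C)" and h: "Gs \<in> Gstar k m" "C \<in> Acal N k" "S \<in> images m w (SOME A. A \<in> C) Gs"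
      by blast
    obtain DA bsA where A: "(SOME A. A \<in> C) = (DA, bsA)" by force
    obtain js col where Gs: "Gs = (js, col)" by force
    have AD: "(DA, bsA) \<in> AD N k" using Acal_rep(2)[OF h(2)] A by simp
    note im = images_starred[OF AD h(1)[unfolded Gs] h(3)[unfolded A Gs]]
    have e: "(js, col) = (base_labels, colS)" using im(1) starred_iff by simp
    then have "biso DA bsA D (map lab base_labels)" using im(3) by simp
    then have "biso D (map lab base_labels) DA bsA" by (rule biso_sym[OF _ AD_D(4)[OF AD]])
    then have "biso D0 bs0 DA bsA" by (rule biso_trans[OF A0(2) _ AD_D(4)[OF A0(1)]])
    then have "((D0, bs0), (DA, bsA)) \<in> isoR N k" using isoR_iff A0(1) AD by simp
    then have "(DA, bsA) \<in> C0" by (simp add: C0_def)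
    moreover have "(DA, bsA) \<in> C" using Acal_rep(1)[OF h(2)] A by simp
    ultimately have "C = C0"
      using quotient_disj[OF equiv_isoR h(2)[unfolded Acal_eq] C0[unfolded Acal_eq]] by blast
    then show "x \<in> {((base_labels, colS), C0)}" using x Gs e by simp
  next
    fix x assume "x \<in> {((base_labels, colS), C0)}"
    then have x: "x = ((base_labels, colS), C0)" by simp
    obtain DA bsA where A: "(SOME A. A \<in> C0) = (DA, bsA)" by force
    have AD: "(DA, bsA) \<in> AD N k" using Acal_rep(2)[OF C0] A by simp
    have "((D0, bs0), (DA, bsA)) \<in> isoR N k" using Acal_rep(1)[OF C0] A by (simp add: C0_def)
    then have "biso D0 bs0 DA bsA" using isoR_iff by blast
    then have "biso DA bsA D0 bs0" by (rule biso_sym[OF _ AD_D(4)[OF A0(1)]])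
    then have "biso DA bsA D (map lab base_labels)" by (rule biso_trans[OF _ A0(2) AD_D(4)[OF AD]])
    then have "S \<in> images m w (SOME A. A \<in> C0) (base_labels, colS)" unfolding A using images_iff[OF AD G0] cc by simp
    then show "x \<in> {(Gs, C). Gs \<in> Gstar k m \<and> C \<in> Acal N k \<and> S \<in> images m w (SOME A. A \<in> C) Gs}"
      using x G0 C0 by simp
  qed
  show ?thesis unfolding X using True by simp
qed

end

context closed_braid
begin

text \<open>Double counting: instead of summing images over pairs of diagrams, sum over all
  \<open>S\<close> with the number of pairs having \<open>S\<close> as an image, which is 0 or
  1.\<close>

lemma sum_pairings:
  assumes k: "1 \<le> k"
  shows "(\<Sum>Gs\<in>Gstar k m. \<Sum>C\<in>Acal N k. pairing (SOME A. A \<in> C) m w Gs)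
    = (\<Sum>S | S \<subseteq> {..<n} \<and> valid m w S \<and> ncyc m w S = k \<and> card S = N. \<Prod>t\<in>S. gd_sign w t)"
proof -
  let ?\<epsilon> = "\<lambda>S. \<Prod>t\<in>S. gd_sign w t"
  let ?X = "Gstar k m \<times> Acal N k"
  let ?I = "\<lambda>x S. S \<in> images m w (SOME A. A \<in> snd x) (fst x)"
  have fX: "finite ?X" using finite_Gstar finite_Acal by blast
  have "(\<Sum>Gs\<in>Gstar k m. \<Sum>C\<in>Acal N k. pairing (SOME A. A \<in> C) m w Gs)
     = (\<Sum>x\<in>?X. \<Sum>S\<in>images m w (SOME A. A \<in> snd x) (fst x). ?\<epsilon> S)"
    by (simp add: sum.cartesian_product pairing_images case_prod_beta)
  also have "\<dots> = (\<Sum>x\<in>?X. \<Sum>S\<in>Pow {..<n}. if ?I x S then ?\<epsilon> S else 0)"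
    by (intro sum.cong refl sum.mono_neutral_cong_left) (auto dest: images_subset)
  also have "\<dots> = (\<Sum>S\<in>Pow {..<n}. \<Sum>x\<in>?X. if ?I x S then ?\<epsilon> S else 0)"
    by (rule sum.swap)
  also have "\<dots> = (\<Sum>S\<in>Pow {..<n}. if valid m w S \<and> ncyc m w S = k \<and> card S = N then ?\<epsilon> S else 0)"
  proof (rule sum.cong[OF refl])
    fix S assume "S \<in> Pow {..<n}"
    then interpret smoothing m w S using m w by unfold_locales auto
    have "(\<Sum>x\<in>?X. if ?I x S then ?\<epsilon> S else 0) = of_nat (card {x \<in> ?X. ?I x S}) * ?\<epsilon> S"
      using fX by (simp add: sum.If_cases Int_def)
    also have "{x \<in> ?X. ?I x S} = {(Gs, C). Gs \<in> Gstar k m \<and> C \<in> Acal N k \<and> S \<in> images m w (SOME A. A \<in> C) Gs}"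
      by auto
    finally show "(\<Sum>x\<in>?X. if ?I x S then ?\<epsilon> S else 0)
        = (if valid m w S \<and> ncyc m w S = k \<and> card S = N then ?\<epsilon> S else 0)"
      unfolding count[OF k] by simp
  qed
  also have "\<dots> = (\<Sum>S | S \<subseteq> {..<n} \<and> valid m w S \<and> ncyc m w S = k \<and> card S = N. ?\<epsilon> S)"
    by (intro sum.mono_neutral_cong_right) auto
  finally show ?thesis .
qed

end

section \<open>Derivatives of Laurent polynomials\<close>

text \<open>The state sum is used for positive a only; as the half-line is open and contains 1,
  iterated derivatives at 1 are determined by it.\<close>

lemma deriv_pow_cong:
  fixes f g :: "real \<Rightarrow> real"
  assumes "\<And>x. 0 < x \<Longrightarrow> f x = g x" "0 < x"
  shows "(deriv ^^ k) f x = (deriv ^^ k) g x"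
  using assms(2)
proof (induction k arbitrary: x)
  case 0 then show ?case using assms(1) by simp
next
  case (Suc k)
  have "eventually (\<lambda>y. y \<in> {0<..}) (nhds x)" using Suc.prems by (intro eventually_nhds_in_open) auto
  then have "eventually (\<lambda>y. (deriv ^^ k) f y = (deriv ^^ k) g y) (nhds x)"
    by eventually_elim (use Suc.IH in auto)
  then show ?case by (simp add: deriv_cong_ev)
qed

definition sq_sub_one :: "real poly" where "sq_sub_one = [:- 1, 0, 1:]"

lemma poly_uu: "poly sq_sub_one a = a\<^sup>2 - 1"
  by (simp add: sq_sub_one_def power2_eq_square)

lemma sq_sub_one_dvd_pderiv:
  assumes "sq_sub_one ^ s dvd p" shows "sq_sub_one ^ (s - 1) dvd pderiv p"
proof (cases s)
  case (Suc j)
  then obtain q where p: "p = sq_sub_one ^ Suc j * q" using assms by (auto elim: dvdE)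
  have "pderiv p = sq_sub_one ^ j * (sq_sub_one * pderiv q + smult (of_nat (Suc j)) (pderiv sq_sub_one * q))"
    unfolding p pderiv_mult pderiv_power_Suc by (simp add: algebra_simps)
  then show ?thesis using Suc by simp
qed simp

lemma laurent_has_deriv:
  fixes x :: real
  assumes "0 < x"
  shows "((\<lambda>x. poly p x / x ^ N) has_field_derivative
     poly ([:0, 1:] * pderiv p - smult (of_nat N) p) x / x ^ Suc N) (at x)"
proof -
  have "((\<lambda>x. poly p x / x ^ N) has_field_derivative
     (poly (pderiv p) x * x ^ N - poly p x * (of_nat N * x ^ (N - 1))) / (x ^ N * x ^ N)) (at x)"
    using assms by (auto intro!: derivative_eq_intros poly_DERIV)
  also have "(poly (pderiv p) x * x ^ N - poly p x * (of_nat N * x ^ (N - 1))) / (x ^ N * x ^ N)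
     = poly ([:0, 1:] * pderiv p - smult (of_nat N) p) x / x ^ Suc N"
    using assms by (cases N) (simp_all add: field_simps)
  finally show ?thesis .
qed

text \<open>Derivatives of Laurent polynomials remain Laurent polynomials, and each differentiation
  lowers the divisibility by a^2 - 1 by at most one.\<close>

lemma laurent_deriv_pow:
  assumes "\<And>x. 0 < x \<Longrightarrow> f x = poly p x / x ^ N"
  shows "\<exists>q M. (\<forall>x>0. (deriv ^^ k) f x = poly q x / x ^ M) \<and> (\<forall>s. sq_sub_one ^ s dvd p \<longrightarrow> sq_sub_one ^ (s - k) dvd q)"
proof (induction k)
  case 0 then show ?case using assms by (intro exI[of _ p] exI[of _ N]) auto
next
  case (Suc k)
  then obtain q M where q: "\<And>x. 0 < x \<Longrightarrow> (deriv ^^ k) f x = poly q x / x ^ M"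
     "\<And>s. sq_sub_one ^ s dvd p \<Longrightarrow> sq_sub_one ^ (s - k) dvd q" by blast
  define r where "r = [:0, 1:] * pderiv q - smult (of_nat M) q"
  have "(deriv ^^ Suc k) f x = poly r x / x ^ Suc M" if "0 < x" for x
  proof -
    have "deriv ((deriv ^^ k) f) x = deriv (\<lambda>x. poly q x / x ^ M) x"
      using deriv_pow_cong[of "(deriv ^^ k) f" "\<lambda>x. poly q x / x ^ M" x 1] q(1) that by simp
    also have "\<dots> = poly r x / x ^ Suc M" unfolding r_def by (rule DERIV_imp_deriv[OF laurent_has_deriv[OF that]])
    finally show ?thesis by simp
  qed
  moreover have "sq_sub_one ^ (s - Suc k) dvd r" if "sq_sub_one ^ s dvd p" for s
  proof -
    have "sq_sub_one ^ (s - k - 1) dvd pderiv q" "sq_sub_one ^ (s - k) dvd q"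
      using q(2)[OF that] sq_sub_one_dvd_pderiv[OF q(2)[OF that]] by auto
    moreover have "sq_sub_one ^ (s - k - 1) dvd sq_sub_one ^ (s - k)" by (intro le_imp_power_dvd) simp
    ultimately show ?thesis unfolding r_def
      by (metis (no_types) One_nat_def diff_Suc_eq_diff_pred diff_commute dvd_diff dvd_mult dvd_smult dvd_trans)
  qed
  ultimately show ?case by (intro exI[of _ r] exI[of _ "Suc M"]) blast
qed

text \<open>Linearity of \<open>deriv\<close> requires differentiability of all iterated
  derivatives, which the Laurent form supplies.\<close>

lemma laurent_deriv_sum:
  fixes f :: "'i \<Rightarrow> real \<Rightarrow> real" and x :: real
  assumes "finite I" "\<And>i x. i \<in> I \<Longrightarrow> 0 < x \<Longrightarrow> f i x = poly (p i) x / x ^ N i" "0 < x"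
  shows "(deriv ^^ k) (\<lambda>x. \<Sum>i\<in>I. c i * f i x) x = (\<Sum>i\<in>I. c i * (deriv ^^ k) (f i) x)"
  using assms(3)
proof (induction k arbitrary: x)
  case (Suc k)
  have d: "((deriv ^^ k) (f i) has_field_derivative (deriv ^^ Suc k) (f i) x) (at x)" if i: "i \<in> I" for i
  proof -
    obtain q M where q: "\<And>x. 0 < x \<Longrightarrow> (deriv ^^ k) (f i) x = poly q x / x ^ M"
      using laurent_deriv_pow[of "f i" "p i" "N i" k] assms(2)[OF i] by blast
    have "((deriv ^^ k) (f i) has_field_derivative
        poly ([:0, 1:] * pderiv q - smult (of_nat M) q) x / x ^ Suc M) (at x)"
      by (rule has_field_derivative_transform_within_open[OF laurent_has_deriv[OF Suc.prems], of "{0<..}"])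
         (use q Suc.prems in auto)
    then show ?thesis using DERIV_imp_deriv by fastforce
  qed
  have "((\<lambda>y. \<Sum>i\<in>I. c i * (deriv ^^ k) (f i) y) has_field_derivative (\<Sum>i\<in>I. c i * (deriv ^^ Suc k) (f i) x)) (at x)"
    by (intro DERIV_sum DERIV_cmult d)
  then have "deriv (\<lambda>y. \<Sum>i\<in>I. c i * (deriv ^^ k) (f i) y) x = (\<Sum>i\<in>I. c i * (deriv ^^ Suc k) (f i) x)"
    by (rule DERIV_imp_deriv)
  moreover have "deriv ((deriv ^^ k) (\<lambda>x. \<Sum>i\<in>I. c i * f i x)) x = deriv (\<lambda>y. \<Sum>i\<in>I. c i * (deriv ^^ k) (f i) y) x"
    using deriv_pow_cong[of "(deriv ^^ k) (\<lambda>x. \<Sum>i\<in>I. c i * f i x)" _ x 1] Suc by simp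
  ultimately show ?case by simp
qed simp

definition coef_fun :: "nat \<Rightarrow> int \<Rightarrow> real \<Rightarrow> real" where
  "coef_fun j e a = a powi e * (a\<^sup>2 - 1) ^ (j - 1)"

text \<open>The exponent may have either sign; one of \<open>nat e\<close> and
  \<open>nat (- e)\<close> is always 0.\<close>

lemma coef_fun_laurent: "0 < a \<Longrightarrow> coef_fun j e a = poly (monom 1 (nat e) * sq_sub_one ^ (j - 1)) a / a ^ nat (- e)"
  by (simp add: coef_fun_def poly_monom poly_uu power_int_def field_simps)

lemma fcoef_eq: "fcoef j (Suc k) m w = (deriv ^^ k) (coef_fun j (- int m - writhe w + 1)) 1"
  by (simp add: fcoef_def coef_fun_def[abs_def])

text \<open>The factor (a^2 - 1)^(j-1) has a zero of order above k at 1, so k derivatives leave at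
  least one factor.\<close>

lemma fcoef_zero: assumes "Suc k < j" shows "fcoef j (Suc k) m w = 0"
proof -
  obtain q M where q: "\<And>x. 0 < x \<Longrightarrow> (deriv ^^ k) (coef_fun j (- int m - writhe w + 1)) x = poly q x / x ^ M"
    "\<And>s. sq_sub_one ^ s dvd monom 1 (nat (- int m - writhe w + 1)) * sq_sub_one ^ (j - 1) \<Longrightarrow> sq_sub_one ^ (s - k) dvd q"
    using laurent_deriv_pow[of "coef_fun j (- int m - writhe w + 1)", OF coef_fun_laurent, where k = k] by blast
  have "sq_sub_one ^ (j - 1 - k) dvd q" by (intro q(2)) simp
  moreover have "sq_sub_one dvd sq_sub_one ^ (j - 1 - k)" using assms by (intro dvd_power) simp
  ultimately have "poly q 1 = 0" using poly_uu[of 1] by (auto elim!: dvdE)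
  then show ?thesis using q(1)[of 1] by (simp add: fcoef_eq)
qed

section \<open>The state sum and its derivatives\<close>

definition states :: "nat \<Rightarrow> letter list \<Rightarrow> nat set set" where
  "states m w = {S. S \<subseteq> {..<length w} \<and> valid m w S}"

definition sgnS :: "letter list \<Rightarrow> nat set \<Rightarrow> real" where
  "sgnS w S = of_int (\<Prod>t\<in>S. gd_sign w t)"

lemma finite_states: "finite (states m w)"
  unfolding states_def by (rule finite_subset[of _ "Pow {..<length w}"]) auto

lemma ncyc_bounds: assumes "1 \<le> m" "braid_word m w" shows "1 \<le> ncyc m w S" "ncyc m w S \<le> m"
proof -
  interpret perm_upto "strand_end S 0 w" m by (rule perm_upto_sp[OF assms(2)])
  show "1 \<le> ncyc m w S" using hd_mx_reps(1)[OF assms(1)] by (simp add: ncyc_def Suc_le_eq)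
  have "distinct (mx_reps (strand_end S 0 w) m)"
    unfolding mx_reps_def by simp
  then have "ncyc m w S = card (set (mx_reps (strand_end S 0 w) m))" by (simp add: ncyc_def distinct_card)
  also have "\<dots> \<le> card {1..m}" using mx_repsD(1) by (intro card_mono) auto
  finally show "ncyc m w S \<le> m" by simp
qed

text \<open>The equation \<open>n + j = card S + K\<close> expresses card S = n + j - K without
  natural subtraction; it has no solution with n + j < K, where \<open>Ankj\<close> is 0 by
  definition.\<close>

lemma Ankj_eq:
  assumes "1 \<le> m" "braid_word m w" "1 \<le> j"
  shows "of_int (Ankj n K j m w) = (\<Sum>S\<in>states m w. if ncyc m w S = j \<and> n + j = card S + K then sgnS w S else 0)"
proof -
  interpret closed_braid m w using assms by unfold_locales
  show ?thesis
  proof (cases "n + j < K")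
    case True then show ?thesis by (simp add: Ankj_def)
  next
    case False
    then have "Ankj n K j m w = (\<Sum>S | S \<subseteq> {..<length w} \<and> valid m w S \<and> ncyc m w S = j \<and> card S = n + j - K. \<Prod>t\<in>S. gd_sign w t)"
      using sum_pairings[OF assms(3)] by (simp add: Ankj_def)
    also have "\<dots> = (\<Sum>S\<in>states m w. if ncyc m w S = j \<and> n + j = card S + K then \<Prod>t\<in>S. gd_sign w t else 0)"
      using False finite_states by (intro sum.mono_neutral_cong_left) (auto simp: states_def)
    finally show ?thesis by (simp add: sgnS_def if_distrib cong: if_cong)
  qed
qed

lemma P_state_sum:
  assumes P: "homfly_braid P" and m: "1 \<le> m" and w: "braid_word m w" and a: "0 < a" and z: "z \<noteq> 0"
  shows "P m w a z = (\<Sum>S\<in>states m w. sgnS w S * z ^ card S / z ^ (ncyc m w S - 1)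
     * coef_fun (ncyc m w S) (- int m - writhe w + 1) a)"
proof -
  interpret homfly_eval P a z using P a z by unfold_locales auto
  have "P m w a z = a powi (- wr w) * Q m w"
    using a by (simp add: Q_def power_int_minus)
  also have "\<dots> = (\<Sum>S\<in>states m w. a powi (- wr w) * (sgnS w S * z ^ card S *
      inverse a ^ (m - ncyc m w S) * ((a - 1 / a) / z) ^ (ncyc m w S - 1)))"
    unfolding Q_state_sum[OF m w] sum_distrib_left states_def sgnS_def ..
  also have "\<dots> = (\<Sum>S\<in>states m w. sgnS w S * z ^ card S / z ^ (ncyc m w S - 1)
     * coef_fun (ncyc m w S) (- int m - writhe w + 1) a)"
  proof (rule sum.cong[OF refl])
    fix S
    define r where "r = ncyc m w S"
    have r: "1 \<le> r" "r \<le> m" using ncyc_bounds[OF m w] by (auto simp: r_def)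
    have "(a - 1 / a) = (a\<^sup>2 - 1) * inverse a" using a by (simp add: field_simps power2_eq_square)
    then have "inverse a ^ (m - r) * ((a - 1 / a) / z) ^ (r - 1)
        = (inverse a ^ (m - r) * inverse a ^ (r - 1)) * (a\<^sup>2 - 1) ^ (r - 1) / z ^ (r - 1)"
      by (simp add: power_divide power_mult_distrib)
    \<comment> \<open>The powers of 1/a from destabilisations and from splittings together no longer
      depend on the number of cycles.\<close>
    also have "inverse a ^ (m - r) * inverse a ^ (r - 1) = inverse a ^ (m - 1)"
      using r by (simp flip: power_add)
    also have "inverse a ^ (m - 1) = a powi (1 - int m)"
      using m by (simp add: power_int_def nat_diff_distrib')
    finally have *: "inverse a ^ (m - r) * ((a - 1 / a) / z) ^ (r - 1) = a powi (1 - int m) * (a\<^sup>2 - 1) ^ (r - 1) / z ^ (r - 1)" .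
    have "a powi (- int m - writhe w + 1) = a powi ((- wr w) + (1 - int m))" by (simp add: writhe_eq_wr algebra_simps)
    also have "\<dots> = a powi (- wr w) * a powi (1 - int m)" using a by (intro power_int_add) simp
    finally have F: "coef_fun r (- int m - writhe w + 1) a = a powi (- wr w) * a powi (1 - int m) * (a\<^sup>2 - 1) ^ (r - 1)"
      by (simp add: coef_fun_def)
    have "a powi (- wr w) * (sgnS w S * z ^ card S * inverse a ^ (m - r) * ((a - 1 / a) / z) ^ (r - 1))
       = sgnS w S * z ^ card S * (a powi (- wr w) * (inverse a ^ (m - r) * ((a - 1 / a) / z) ^ (r - 1)))"
      by (simp only: mult_ac)
    also have "\<dots> = sgnS w S * z ^ card S / z ^ (r - 1) * coef_fun r (- int m - writhe w + 1) a"
      unfolding * F by simp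
    finally show "a powi (- wr w) * (sgnS w S * z ^ card S * inverse a ^ (m - ncyc m w S) * ((a - 1 / a) / z) ^ (ncyc m w S - 1))
      = sgnS w S * z ^ card S / z ^ (ncyc m w S - 1) * coef_fun (ncyc m w S) (- int m - writhe w + 1) a"
      by (simp only: r_def)
  qed
  finally show ?thesis .
qed

lemma P_derivative:
  assumes P: "homfly_braid P" and m: "1 \<le> m" and w: "braid_word m w" and z: "z \<noteq> 0"
  shows "(deriv ^^ k) (\<lambda>a. P m w a z) 1 =
    (\<Sum>S\<in>states m w. sgnS w S * z ^ card S / z ^ (ncyc m w S - 1) * fcoef (ncyc m w S) (Suc k) m w)"
proof -
  let ?e = "- int m - writhe w + 1"
  let ?c = "\<lambda>S. sgnS w S * z ^ card S / z ^ (ncyc m w S - 1)"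
  have "(deriv ^^ k) (\<lambda>a. P m w a z) 1 = (deriv ^^ k) (\<lambda>a. \<Sum>S\<in>states m w. ?c S * coef_fun (ncyc m w S) ?e a) 1"
    by (rule deriv_pow_cong) (use P_state_sum[OF P m w _ z] in auto)
  also have "\<dots> = (\<Sum>S\<in>states m w. ?c S * (deriv ^^ k) (coef_fun (ncyc m w S) ?e) 1)"
    by (rule laurent_deriv_sum[OF finite_states coef_fun_laurent]) auto
  finally show ?thesis by (simp only: fcoef_eq)
qed

lemma Ank_eq:
  assumes "1 \<le> m" "braid_word m w"
  shows "Ank n K m w = (\<Sum>S\<in>states m w. if ncyc m w S \<le> K \<and> n + ncyc m w S = card S + K
     then fcoef (ncyc m w S) K m w * sgnS w S else 0)"
proof -
  have "Ank n K m w = (\<Sum>j=1..K. \<Sum>S\<in>states m w.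
      if ncyc m w S = j \<and> n + j = card S + K then fcoef j K m w * sgnS w S else 0)"
    unfolding Ank_def
    by (intro sum.cong refl) (simp add: Ankj_eq[OF assms] sum_distrib_left if_distrib cong: if_cong)
  also have "\<dots> = (\<Sum>S\<in>states m w. \<Sum>j=1..K.
      if ncyc m w S = j \<and> n + j = card S + K then fcoef j K m w * sgnS w S else 0)"
    by (rule sum.swap)
  also have "\<dots> = (\<Sum>S\<in>states m w. if ncyc m w S \<le> K \<and> n + ncyc m w S = card S + K
     then fcoef (ncyc m w S) K m w * sgnS w S else 0)"
  proof (rule sum.cong[OF refl])
    fix S
    let ?r = "ncyc m w S"
    have "(\<Sum>j=1..K. if ?r = j \<and> n + j = card S + K then fcoef j K m w * sgnS w S else 0)
       = (\<Sum>j=1..K. if ?r = j then (if n + ?r = card S + K then fcoef ?r K m w * sgnS w S else 0) else 0)"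
      by (intro sum.cong) auto
    also have "\<dots> = (if ?r \<le> K \<and> n + ?r = card S + K then fcoef ?r K m w * sgnS w S else 0)"
      using ncyc_bounds(1)[OF assms, of S] by (simp add: sum.delta)
    finally show "(\<Sum>j=1..K. if ?r = j \<and> n + j = card S + K then fcoef j K m w * sgnS w S else 0)
       = (if ?r \<le> K \<and> n + ?r = card S + K then fcoef ?r K m w * sgnS w S else 0)" .
  qed
  finally show ?thesis .
qed

theorem theorem5p1:
  fixes P :: "nat \<Rightarrow> letter list \<Rightarrow> real \<Rightarrow> real \<Rightarrow> real"
    and m k :: nat and w :: "letter list"
  assumes "homfly_braid P" and "1 \<le> m" and "braid_word m w"
  shows "\<forall>z::real. z \<noteq> 0 \<longrightarrow>
           (\<lambda>n. Ank n (Suc k) m w * z ^ n) sums (z ^ k * (deriv ^^ k) (\<lambda>a. P m w a z) 1)"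
proof (intro allI impI)
  fix z :: real assume z: "z \<noteq> 0"
  let ?K = "Suc k"
  let ?r = "\<lambda>S. ncyc m w S"
  let ?f = "\<lambda>S. fcoef (?r S) ?K m w * sgnS w S"
  have "(\<lambda>n. if ?r S \<le> ?K \<and> n + ?r S = card S + ?K then ?f S * z ^ n else 0)
      sums (z ^ k * (sgnS w S * z ^ card S / z ^ (?r S - 1) * fcoef (?r S) ?K m w))" for S
  proof (cases "?r S \<le> ?K")
    case True
    have r: "1 \<le> ?r S" by (rule ncyc_bounds(1)[OF assms(2,3)])
    \<comment> \<open>Each \<open>S\<close> contributes to a single n, namely card S + (k + 1) -
      \<open>?r S\<close>, so the series has finitely many nonzero terms.\<close>
    have "z ^ k * z ^ card S = z ^ (card S + ?K - ?r S) * z ^ (?r S - 1)"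
      using True r by (simp flip: power_add add: add.commute)
    then have "z ^ k * (sgnS w S * z ^ card S / z ^ (?r S - 1) * fcoef (?r S) ?K m w) = ?f S * z ^ (card S + ?K - ?r S)"
      using z by (simp add: field_simps)
    moreover have "(\<lambda>n. if n = card S + ?K - ?r S then ?f S * z ^ n else 0) sums (?f S * z ^ (card S + ?K - ?r S))"
      by (rule sums_single)
    moreover have "?r S \<le> ?K \<and> n + ?r S = card S + ?K \<longleftrightarrow> n = card S + ?K - ?r S" for n
      using True by auto
    ultimately show ?thesis by simp
  next
    case False
    then show ?thesis by (simp add: fcoef_zero)
  qed
  then have "(\<lambda>n. \<Sum>S\<in>states m w. if ?r S \<le> ?K \<and> n + ?r S = card S + ?K then ?f S * z ^ n else 0)
      sums (\<Sum>S\<in>states m w. z ^ k * (sgnS w S * z ^ card S / z ^ (?r S - 1) * fcoef (?r S) ?K m w))"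
    by (rule sums_sum)
  moreover have "Ank n ?K m w * z ^ n = (\<Sum>S\<in>states m w. if ?r S \<le> ?K \<and> n + ?r S = card S + ?K then ?f S * z ^ n else 0)" for n
    unfolding Ank_eq[OF assms(2,3)] sum_distrib_right by (intro sum.cong) auto
  ultimately show "(\<lambda>n. Ank n ?K m w * z ^ n) sums (z ^ k * (deriv ^^ k) (\<lambda>a. P m w a z) 1)"
    unfolding P_derivative[OF assms z] sum_distrib_left by simp
qed

end
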